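(* Assume $\frac{2a\omega}{\pi}\notin\mathbb Z$ and $q_1\in L_1(\mathbb R_+)$, and let $\beta>0$. Let $\varphi_\alpha(x,\lambda)$ be the solution of $$-\varphi''+\Big(q(x)+\frac{c\sin(2\omega x+\delta)}{(x+1)^\gamma}+q_1(x)\Big)\varphi=\lambda\varphi,\qquad\varphi(0)=\sin\alpha,\ \varphi'(0)=\cos\alpha.$$ Then for every $\lambda\in U(\beta)$ there exists $A_\alpha(\lambda)$ such that: (1) if $\lambda\in\mathbb C_+\cap U(\beta)$, then as $x\to\infty$ $\varphi_\alpha(x,\lambda)=A_\alpha(\lambda)\psi_-(x,\lambda)+o(e^{\operatorname{Im}k(\lambda)x/a})$ and $\varphi_\alpha'(x,\lambda)=A_\alpha(\lambda)\psi_-'(x,\lambda)+o(e^{\operatorname{Im}k(\lambda)x/a})$; (2) if $\lambda\in\sigma(\mathcal L_{per})\setminus E$, then as $x\to\infty$ $\varphi_\alpha(x,\lambda)=A_\alpha(\lambda)\psi_-(x,\lambda)+\overline{A_\alpha(\lambda)}\psi_+(x,\lambda)+o(1)$ and $\varphi_\alpha'(x,\lambda)=A_\alpha(\lambda)\psi_-'(x,\lambda)+\overline{A_\alpha(\lambda)}\psi_+'(x,\lambda)+o(1)$. Moreover, $A_\alpha$ is analytic in the interior of $U(\beta)$ and has boundary values on $\sigma(\mathcal L_{per})\setminus E$.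
   Context: Let $a>0$, $q$ a real-valued $a$-periodic function in $L_1(0,a)$, $c,\omega,\delta\in\mathbb R$, $\gamma\in(\tfrac12,1]$, $\alpha\in[0,\pi)$, $q_1$ real-valued. Let $\mathcal L_{per}=-\frac{d^2}{dx^2}+q$ on $L_2(\mathbb R)$, with spectrum $\bigcup_{n\ge0}([\lambda_{2n},\mu_{2n}]\cup[\mu_{2n+1},\lambda_{2n+1}])$, $\lambda_0<\mu_0\le\mu_1<\lambda_1\le\lambda_2<\mu_2\le\dots$ ($\lambda_j$ periodic, $\mu_j$ antiperiodic eigenvalues on $[0,a]$). The quasi-momentum $k(\lambda)=-i\ln\big(\frac{D(\lambda)+\sqrt{D(\lambda)^2-4}}{2}\big)$ ($D$ the discriminant) is chosen with $k(\lambda_0)=0$, $k(\mu_0)=k(\mu_1)=\pi$, $k(\lambda_1)=k(\lambda_2)=2\pi,\dots$, real on $\sigma(\mathcal L_{per})$, in $\mathbb C_+$ for $\lambda\in\mathbb C_+$. Bloch solutions $\psi_\pm(x,\lambda)$ solve $-\psi''+q\psi=\lambda\psi$, $\psi_\pm(x+a,\lambda)=e^{\pm ik(\lambda)}\psi_\pm(x,\lambda)$, normalized so that for each $x$ they and $W(\psi_+,\psi_-)$ ($W(f,g)=f'g-fg'$) are analytic in $\mathbb C_+$ and continuous up to $\sigma(\mathcal L_{per})\setminus\{\lambda_n,\mu_n\}$, $\psi_+=\overline{\psi_-}$ there, and the Wronskian never vanishes and lies in $i\mathbb R_+$ there. Critical points: in the $n$-th band ($[\lambda_n,\mu_n]$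 for even $n$, $[\mu_n,\lambda_n]$ for odd $n$), $k(\lambda_n^+)=\pi(n+1-\{a\omega/\pi\})$, $k(\lambda_n^-)=\pi(n+\{a\omega/\pi\})$, $\{\cdot\}$ the fractional part; $E=\{\lambda_n,\mu_n,\lambda_n^+,\lambda_n^-:n\ge0\}$. Define $\varepsilon(\mu)=\frac12\min_{n\in\mathbb Z}\{|\frac{2k(\mu)}a+2\omega+\frac{2\pi n}a|,|\frac{2k(\mu)}a-2\omega+\frac{2\pi n}a|\}$, $U(\beta,\mu)=\{\lambda\in\overline{\mathbb C_+}:2\varepsilon(\lambda)\ge\varepsilon(\mu),\ 0\le\operatorname{Im}2k(\lambda)/a\le1,\ |\operatorname{Re}k(\lambda)-k(\mu)|\le\beta\operatorname{Im}k(\lambda)\}$, and $U(\beta)=\bigcup_{\mu\in\sigma(\mathcal L_{per})\setminus E}U(\beta,\mu)$. *)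

theory Defs
  imports "HOL-Analysis.Analysis"
begin

text \<open>Solutions (in the Caratheodory sense) of  -y'' + Q y = lam y  on an interval S,
  for a locally integrable real potential Q.  y' is the (quasi-)derivative of y and
  y'' = (Q - lam) y holds in integrated form.\<close>
definition sl_solution ::
  "(real \<Rightarrow> real) \<Rightarrow> complex \<Rightarrow> real set \<Rightarrow> (real \<Rightarrow> complex) \<Rightarrow> (real \<Rightarrow> complex) \<Rightarrow> bool" where
  "sl_solution Q lam S y y' \<longleftrightarrow>
     is_interval S \<and>
     (\<forall>x\<in>S. (y has_vector_derivative y' x) (at x within S)) \<and>
     (\<forall>u\<in>S. \<forall>v\<in>S. u \<le> v \<longrightarrow>
        ((\<lambda>t. (complex_of_real (Q t) - lam) * y t) has_integral (y' v - y' u)) {u..v})"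

definition fund_sol ::
  "(real \<Rightarrow> real) \<Rightarrow> complex \<Rightarrow> complex \<Rightarrow> complex \<Rightarrow> (real \<Rightarrow> complex) \<times> (real \<Rightarrow> complex)" where
  "fund_sol Q lam y0 y1 =
     (THE p. sl_solution Q lam UNIV (fst p) (snd p) \<and> fst p 0 = y0 \<and> snd p 0 = y1)"

definition discr :: "(real \<Rightarrow> real) \<Rightarrow> real \<Rightarrow> complex \<Rightarrow> complex" where
  "discr q a lam = fst (fund_sol q lam 1 0) a + snd (fund_sol q lam 0 1) a"

definition spec_per :: "(real \<Rightarrow> real) \<Rightarrow> real \<Rightarrow> complex set" where
  "spec_per q a = {lam. lam \<in> \<real> \<and> discr q a lam \<in> \<real> \<and> cmod (discr q a lam) \<le> 2}"

definition band_edges :: "(real \<Rightarrow> real) \<Rightarrow> real \<Rightarrow> complex set" where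
  "band_edges q a = {lam \<in> spec_per q a. discr q a lam = 2 \<or> discr q a lam = -2}"

text \<open>The quasi-momentum: continuous on the closed upper half plane, analytic in the open one,
  2 cos k = D, Im k > 0 in the open upper half plane, and k(lam_0) = 0 where lam_0 is the
  bottom of the spectrum.  These conditions single out the branch described in the paper.\<close>
definition is_quasi_momentum :: "(real \<Rightarrow> real) \<Rightarrow> real \<Rightarrow> (complex \<Rightarrow> complex) \<Rightarrow> bool" where
  "is_quasi_momentum q a k \<longleftrightarrow>
     continuous_on {z. Im z \<ge> 0} k \<and>
     k holomorphic_on {z. Im z > 0} \<and>
     (\<forall>z. Im z \<ge> 0 \<longrightarrow> 2 * cos (k z) = discr q a z) \<and>
     (\<forall>z. Im z > 0 \<longrightarrow> Im (k z) > 0) \<and>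
     k (complex_of_real (Inf (Re ` spec_per q a))) = 0"

text \<open>Wronskian W(f,g) = f' g - f g' (evaluated at x = 0; it is independent of x).\<close>
definition wronsk :: "complex \<Rightarrow> complex \<Rightarrow> complex \<Rightarrow> complex \<Rightarrow> complex" where
  "wronsk f f' g g' = f' * g - f * g'"

definition is_bloch_pair ::
  "(real \<Rightarrow> real) \<Rightarrow> real \<Rightarrow> (complex \<Rightarrow> complex) \<Rightarrow>
   (real \<Rightarrow> complex \<Rightarrow> complex) \<Rightarrow> (real \<Rightarrow> complex \<Rightarrow> complex) \<Rightarrow>
   (real \<Rightarrow> complex \<Rightarrow> complex) \<Rightarrow> (real \<Rightarrow> complex \<Rightarrow> complex) \<Rightarrow> bool" where
  "is_bloch_pair q a k psp dpsp psm dpsm \<longleftrightarrow>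
     (let Hp = {z. Im z > 0}; B = spec_per q a - band_edges q a;
          W = (\<lambda>lam. wronsk (psp 0 lam) (dpsp 0 lam) (psm 0 lam) (dpsm 0 lam)) in
     (\<forall>lam \<in> Hp \<union> B.
        sl_solution q lam UNIV (\<lambda>x. psp x lam) (\<lambda>x. dpsp x lam) \<and>
        sl_solution q lam UNIV (\<lambda>x. psm x lam) (\<lambda>x. dpsm x lam) \<and>
        (\<forall>x. psp (x + a) lam = exp (\<i> * k lam) * psp x lam) \<and>
        (\<forall>x. psm (x + a) lam = exp (- \<i> * k lam) * psm x lam) \<and>
        W lam \<noteq> 0) \<and>
     (\<forall>x. (\<lambda>lam. psp x lam) holomorphic_on Hp \<and> (\<lambda>lam. psm x lam) holomorphic_on Hp \<and>
          continuous_on (Hp \<union> B) (\<lambda>lam. psp x lam) \<and>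
          continuous_on (Hp \<union> B) (\<lambda>lam. psm x lam)) \<and>
     W holomorphic_on Hp \<and> continuous_on (Hp \<union> B) W \<and>
     (\<forall>lam \<in> B. (\<forall>x. psp x lam = cnj (psm x lam) \<and> dpsp x lam = cnj (dpsm x lam)) \<and>
                 Re (W lam) = 0 \<and> Im (W lam) > 0))"

text \<open>Critical set E = {lam_n, mu_n, lam_n^+, lam_n^-}; lam_n^+- are the points of the n-th band
  where k = pi(n+1-{a omega/pi}) resp. k = pi(n+{a omega/pi}) (k maps the n-th band onto
  [n pi, (n+1) pi]).\<close>
definition crit_set :: "(real \<Rightarrow> real) \<Rightarrow> real \<Rightarrow> (complex \<Rightarrow> complex) \<Rightarrow> real \<Rightarrow> complex set" where
  "crit_set q a k \<omega> = band_edges q a \<union>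
     {lam \<in> spec_per q a. \<exists>n::nat.
        k lam = complex_of_real (pi * (real n + 1 - frac (a * \<omega> / pi))) \<or>
        k lam = complex_of_real (pi * (real n + frac (a * \<omega> / pi)))}"

definition eps_fun :: "real \<Rightarrow> (complex \<Rightarrow> complex) \<Rightarrow> real \<Rightarrow> complex \<Rightarrow> real" where
  "eps_fun a k \<omega> mu = 1/2 * (INF n::int.
      min (cmod (2 * k mu / of_real a + of_real (2 * \<omega>) + of_real (2 * pi * of_int n / a)))
          (cmod (2 * k mu / of_real a - of_real (2 * \<omega>) + of_real (2 * pi * of_int n / a))))"

definition U_mu :: "real \<Rightarrow> (complex \<Rightarrow> complex) \<Rightarrow> real \<Rightarrow> real \<Rightarrow> complex \<Rightarrow> complex set" where
  "U_mu a k \<omega> \<beta> mu = {lam. Im lam \<ge> 0 \<and>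
      2 * eps_fun a k \<omega> lam \<ge> eps_fun a k \<omega> mu \<and>
      0 \<le> Im (2 * k lam / of_real a) \<and> Im (2 * k lam / of_real a) \<le> 1 \<and>
      \<bar>Re (k lam) - Re (k mu)\<bar> \<le> \<beta> * Im (k lam)}"

definition U_set :: "(real \<Rightarrow> real) \<Rightarrow> real \<Rightarrow> (complex \<Rightarrow> complex) \<Rightarrow> real \<Rightarrow> real \<Rightarrow> complex set" where
  "U_set q a k \<omega> \<beta> = (\<Union>mu \<in> spec_per q a - crit_set q a k \<omega>. U_mu a k \<omega> \<beta> mu)"

end

theory Submission
  imports Defs "HOL-Complex_Analysis.Complex_Analysis"
begin

text \<open>Write \<open>\<phi> = u \<psi>\<^sub>- + v \<psi>\<^sub>+\<close> and \<open>\<phi>' = u \<psi>\<^sub>-' + v \<psi>\<^sub>+'\<close> by variation of parameters. The derivatives of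
  \<open>u\<close> and \<open>v\<close> contain the perturbation multiplied by \<open>\<psi>\<^sub>+\<psi>\<^sub>-\<close>, \<open>\<psi>\<^sub>+\<^sup>2\<close>, \<open>\<psi>\<^sub>-\<^sup>2\<close>. Times \<open>sin (2 \<omega> x + \<delta>)\<close>, these
  products are sums of quasi-periodic functions whose multipliers differ from \<open>1\<close> off the
  critical set, so they have primitives growing no faster than the products themselves.
  Subtracting \<open>(x + 1)\<^sup>-\<^sup>\<gamma>\<close> times these primitives (a Harris--Lutz transformation) leaves an
  integrable remainder because \<open>2 \<gamma> > 1\<close>. By Gronwall's inequality \<open>u\<close> converges as \<open>x \<rightarrow> \<infinity>\<close>, locally
  uniformly in the spectral parameter up to the noncritical part of the spectrum, and its
  limit is the amplitude \<open>A\<close>. On the spectrum, \<open>v\<close> is the conjugate of \<open>u\<close>.\<close>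

section \<open>Absolutely continuous functions\<close>

text \<open>The potential is only locally integrable, so the coefficients \<open>u\<close>,
  \<open>v\<close> have derivatives merely almost everywhere. The calculus is kept in integrated
  form: \<open>ac_prim a b F f\<close> makes \<open>F\<close> an antiderivative of an integrable
  density \<open>f\<close>, and such pairs obey the product rule. A second obstacle is uniformity.
  The rate \<kappa> = Im k / a tends to 0 at the spectrum, while \<open>v\<close> may grow almost
  like exp(2 \<kappa> x) above it, so exponential decay is of no use for uniform bounds. The
  quantity estimated is |u| + exp(-2 \<kappa> x) |v|, with \<kappa> = 0 allowed and constants
  depending only on a neighbourhood of the spectral parameter. The distance of \<open>u\<close> to
  its limit is then at most a multiple of the tail of one fixed integral plus a multiple of
  (x+1)^(-\<gamma>), both free of that parameter, and this is what gives analyticity and boundary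
  values at once. The multipliers in question are 1, exp(2ik), exp(-2ik), each times
  exp(2i\<omega>a) or exp(-2i\<omega>a). The first is kept from 1 by nonresonance, the others by Im
  k > 0 above the axis and by the critical set on it.\<close>

definition ac_prim :: "real \<Rightarrow> real \<Rightarrow> (real \<Rightarrow> 'a::euclidean_space) \<Rightarrow> (real \<Rightarrow> 'a) \<Rightarrow> bool" where
  "ac_prim a b F f \<longleftrightarrow> f absolutely_integrable_on {a..b} \<and>
     (\<forall>s t. a \<le> s \<longrightarrow> s \<le> t \<longrightarrow> t \<le> b \<longrightarrow> integral {s..t} f = F t - F s)"

lemma ac_primD:
  assumes "ac_prim a b F f"
  shows "f absolutely_integrable_on {a..b}"
    and "\<And>s t. a \<le> s \<Longrightarrow> s \<le> t \<Longrightarrow> t \<le> b \<Longrightarrow> integral {s..t} f = F t - F s"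
  using assms by (auto simp: ac_prim_def)

lemma ac_prim_sub:
  assumes "ac_prim a b F f" "a \<le> c" "d \<le> b"
  shows "ac_prim c d F f"
proof -
  have "f absolutely_integrable_on {c..d}"
    using assms by (intro absolutely_integrable_on_subinterval[OF ac_primD(1)[OF assms(1)]]) auto
  then show ?thesis using assms unfolding ac_prim_def by auto
qed

lemma ac_prim_continuous:
  assumes "ac_prim a b F f"
  shows "continuous_on {a..b} F"
proof -
  have "continuous_on {a..b} (\<lambda>x. F a + integral {a..x} f)"
    using ac_primD(1)[OF assms]
    by (intro continuous_intros indefinite_integral_continuous_1)
       (simp add: set_lebesgue_integral_eq_integral(1))
  moreover have "F a + integral {a..x} f = F x" if "x \<in> {a..b}" for x
    using ac_primD(2)[OF assms, of a x] that by auto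
  ultimately show ?thesis by (rule continuous_on_eq)
qed

lemma abs_int_mult_continuous:
  fixes f g :: "real \<Rightarrow> 'a::{euclidean_space, real_normed_field}"
  assumes "f absolutely_integrable_on {a..b}" "continuous_on {a..b} g"
  shows "(\<lambda>x. f x * g x) absolutely_integrable_on {a..b}"
proof -
  have "(\<lambda>x. g x * f x) absolutely_integrable_on {a..b}"
    using assms
    by (intro absolutely_integrable_bounded_measurable_product[OF bilinear_times]
         continuous_imp_measurable_on_sets_lebesgue compact_imp_bounded compact_continuous_image) auto
  then show ?thesis by (simp add: mult.commute)
qed

lemma abs_int_of_real:
  "f absolutely_integrable_on S \<Longrightarrow> (\<lambda>x. complex_of_real (f x)) absolutely_integrable_on S"
  for f :: "real \<Rightarrow> real"
  by (drule absolutely_integrable_linear[OF _ bounded_linear_of_real]) (simp add: o_def)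

lemma abs_int_integrable:
  "f absolutely_integrable_on S \<Longrightarrow> f integrable_on S"
  for f :: "real \<Rightarrow> 'a::euclidean_space"
  by (simp add: absolutely_integrable_on_def)

lemma abs_int_norm_integrable:
  "f absolutely_integrable_on S \<Longrightarrow> (\<lambda>x. norm (f x)) integrable_on S"
  for f :: "real \<Rightarrow> 'a::euclidean_space"
  by (simp add: absolutely_integrable_on_def)

text \<open>Bisection makes the local estimate global: the bounds on adjacent intervals add up
  because the increments of \<open>\<Phi>\<close> telescope, so the total increment of
  \<open>D\<close> is at most \<open>\<epsilon>\<close> times a fixed number, for every
  \<open>\<epsilon>\<close>. This replaces the fundamental theorem of calculus where derivatives
  exist only almost everywhere.\<close>

lemma small_increments_imp_eq:
  fixes D :: "real \<Rightarrow> 'a::real_normed_vector" and \<Phi> :: "real \<Rightarrow> real"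
  assumes "u \<le> v"
    and small: "\<And>\<epsilon>. \<epsilon> > 0 \<Longrightarrow> \<exists>\<delta>>0. \<forall>s t. u \<le> s \<longrightarrow> s \<le> t \<longrightarrow> t \<le> v \<longrightarrow> t - s < \<delta> \<longrightarrow>
                  norm (D t - D s) \<le> \<epsilon> * (\<Phi> t - \<Phi> s)"
  shows "D v = D u"
proof -
  have *: "norm (D v - D u) \<le> \<epsilon> * (\<Phi> v - \<Phi> u)" if "\<epsilon> > 0" for \<epsilon>
  proof -
    obtain \<delta> where d: "\<delta> > 0" "\<And>s t. u \<le> s \<Longrightarrow> s \<le> t \<Longrightarrow> t \<le> v \<Longrightarrow> t - s < \<delta> \<Longrightarrow>
                  norm (D t - D s) \<le> \<epsilon> * (\<Phi> t - \<Phi> s)"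
      using small[OF \<open>\<epsilon> > 0\<close>] by blast
    define P where "P s t \<longleftrightarrow> (u \<le> s \<longrightarrow> t \<le> v \<longrightarrow> norm (D t - D s) \<le> \<epsilon> * (\<Phi> t - \<Phi> s))" for s t
    have "P u v"
    proof (rule Bolzano[OF \<open>u \<le> v\<close>])
      fix a b c assume trans: "P a b" "P b c" "a \<le> b" "b \<le> c"
      show "P a c" unfolding P_def
      proof (intro impI)
        assume "u \<le> a" "c \<le> v"
        then have "norm (D b - D a) \<le> \<epsilon> * (\<Phi> b - \<Phi> a)" "norm (D c - D b) \<le> \<epsilon> * (\<Phi> c - \<Phi> b)"
          using trans by (auto simp: P_def)
        moreover have "norm (D c - D a) \<le> norm (D c - D b) + norm (D b - D a)"
          using norm_triangle_ineq[of "D c - D b" "D b - D a"] by simp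
        ultimately show "norm (D c - D a) \<le> \<epsilon> * (\<Phi> c - \<Phi> a)"
          by (simp add: algebra_simps)
      qed
    next
      fix x
      show "\<exists>d>0. \<forall>a b. a \<le> x \<and> x \<le> b \<and> b - a < d \<longrightarrow> P a b"
        using d by (intro exI[of _ \<delta>]) (auto simp: P_def)
    qed
    then show ?thesis by (simp add: P_def)
  qed
  have "norm (D v - D u) \<le> 0"
  proof (rule field_le_epsilon)
    fix e :: real assume "e > 0"
    \<comment> \<open>The added 1 keeps \<open>K\<close> positive when \<open>\<Phi>\<close> has
      equal values at both ends.\<close>
    define K where "K = \<bar>\<Phi> v - \<Phi> u\<bar> + 1"
    have "K > 0" by (simp add: K_def)
    have "norm (D v - D u) \<le> e / K * (\<Phi> v - \<Phi> u)" by (rule *) (use \<open>e > 0\<close> \<open>K > 0\<close> in simp)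
    also have "\<dots> \<le> e / K * K"
      using \<open>e > 0\<close> \<open>K > 0\<close> by (intro mult_left_mono) (auto simp: K_def)
    finally show "norm (D v - D u) \<le> 0 + e" using \<open>K > 0\<close> by simp
  qed
  then show ?thesis by simp
qed

lemma ac_primI:
  assumes f: "f absolutely_integrable_on {a..b}"
    and F: "\<And>t. a \<le> t \<Longrightarrow> t \<le> b \<Longrightarrow> F t = F a + integral {a..t} f"
  shows "ac_prim a b F f"
  unfolding ac_prim_def
proof (intro conjI allI impI f)
  fix s t assume st: "a \<le> s" "s \<le> t" "t \<le> b"
  have "f integrable_on {a..t}"
    using abs_int_integrable[OF f] integrable_on_subinterval st by fastforce
  then have "integral {a..s} f + integral {s..t} f = integral {a..t} f"
    using st by (intro Henstock_Kurzweil_Integration.integral_combine) auto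
  then show "integral {s..t} f = F t - F s" using F[of s] F[of t] st
    by (simp add: algebra_simps)
qed

text \<open>Almost everywhere differentiation is avoided: on a short interval the additive defect of
  the product rule is at most \<open>\<epsilon>\<close> times the integral of \<open>norm f + norm g\<close>.\<close>
lemma ac_prim_mult:
  fixes F G f g :: "real \<Rightarrow> complex"
  assumes F: "ac_prim a b F f" and G: "ac_prim a b G g"
  shows "ac_prim a b (\<lambda>x. F x * G x) (\<lambda>x. f x * G x + F x * g x)"
proof (rule ac_primI)
  define h where "h = (\<lambda>x. f x * G x + F x * g x)"
  note contF = ac_prim_continuous[OF F] and contG = ac_prim_continuous[OF G]
  have fG: "(\<lambda>x. f x * G x) absolutely_integrable_on {a..b}"
    using abs_int_mult_continuous[OF ac_primD(1)[OF F] contG] .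
  have Fg: "(\<lambda>x. F x * g x) absolutely_integrable_on {a..b}"
    using abs_int_mult_continuous[OF ac_primD(1)[OF G] contF] by (simp add: mult.commute)
  show hint: "(\<lambda>x. f x * G x + F x * g x) absolutely_integrable_on {a..b}"
    using fG Fg by (rule set_integral_add(1))
  fix T assume T: "a \<le> T" "T \<le> b"
  define \<Phi> where "\<Phi> x = integral {a..x} (\<lambda>x. norm (f x) + norm (g x))" for x
  define D where "D x = F x * G x - integral {a..x} h" for x
  have sub: "k integrable_on {s..t}" if "k absolutely_integrable_on {a..b}" "a \<le> s" "t \<le> b" for s t and k :: "real \<Rightarrow> complex"
    by (rule abs_int_integrable) (use that absolutely_integrable_on_subinterval in fastforce)
  have subn: "(\<lambda>x. norm (k x)) integrable_on {s..t}" if "k absolutely_integrable_on {a..b}" "a \<le> s" "t \<le> b" for s t and k :: "real \<Rightarrow> complex"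
    by (rule abs_int_norm_integrable) (use that absolutely_integrable_on_subinterval in fastforce)
  note fi = ac_primD(1)[OF F] and gi = ac_primD(1)[OF G]
  have "D T = D a"
  proof (rule small_increments_imp_eq[OF T(1), where \<Phi>=\<Phi>])
    fix \<epsilon> :: real assume "\<epsilon> > 0"
    have ucF: "uniformly_continuous_on {a..b} F" and ucG: "uniformly_continuous_on {a..b} G"
      using contF contG by (auto intro: compact_uniformly_continuous)
    obtain d1 where d1: "d1 > 0" "\<And>x y. x \<in> {a..b} \<Longrightarrow> y \<in> {a..b} \<Longrightarrow> dist y x < d1 \<Longrightarrow> dist (F y) (F x) < \<epsilon>"
      using ucF \<open>\<epsilon> > 0\<close> unfolding uniformly_continuous_on_def by metis
    obtain d2 where d2: "d2 > 0" "\<And>x y. x \<in> {a..b} \<Longrightarrow> y \<in> {a..b} \<Longrightarrow> dist y x < d2 \<Longrightarrow> dist (G y) (G x) < \<epsilon>"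
      using ucG \<open>\<epsilon> > 0\<close> unfolding uniformly_continuous_on_def by metis
    show "\<exists>\<delta>>0. \<forall>s t. a \<le> s \<longrightarrow> s \<le> t \<longrightarrow> t \<le> T \<longrightarrow> t - s < \<delta> \<longrightarrow>
                  norm (D t - D s) \<le> \<epsilon> * (\<Phi> t - \<Phi> s)"
    proof (intro exI[of _ "min d1 d2"] conjI allI impI)
      show "min d1 d2 > 0" using d1 d2 by simp
      fix s t assume st: "a \<le> s" "s \<le> t" "t \<le> T" "t - s < min d1 d2"
      have I1: "integral {a..s} h + integral {s..t} h = integral {a..t} h"
        using st T by (intro Henstock_Kurzweil_Integration.integral_combine sub) (auto simp: h_def hint)
      have I2: "integral {a..s} (\<lambda>x. norm (f x) + norm (g x)) + integral {s..t} (\<lambda>x. norm (f x) + norm (g x)) = \<Phi> t"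
        unfolding \<Phi>_def
        using st T fi gi by (intro Henstock_Kurzweil_Integration.integral_combine integrable_add subn) auto
      \<comment> \<open>With \<open>G\<close> frozen at the right end and \<open>F\<close> at the
        left end the integral is exactly the increment of the product. What remains as error is the
        oscillation of \<open>F\<close> and \<open>G\<close> over the short interval.\<close>
      have e1: "((\<lambda>x. f x * G t + F s * g x) has_integral (F t - F s) * G t + F s * (G t - G s)) {s..t}"
        using ac_primD(2)[OF F, of s t] ac_primD(2)[OF G, of s t] st T sub[OF fi, of s t] sub[OF gi, of s t]
        by (intro has_integral_add has_integral_mult_right has_integral_mult_left)
           (auto simp: has_integral_iff)
      have "D t - D s = F t * G t - F s * G s - integral {s..t} h"
        using I1 by (simp add: D_def algebra_simps)
      also have "\<dots> = integral {s..t} (\<lambda>x. f x * G t + F s * g x) - integral {s..t} h"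
        using e1 by (simp add: has_integral_iff algebra_simps)
      also have "\<dots> = integral {s..t} (\<lambda>x. (f x * G t + F s * g x) - h x)"
        by (rule Henstock_Kurzweil_Integration.integral_diff[symmetric, OF _ sub])
           (use e1 st T in \<open>auto simp: h_def hint has_integral_iff\<close>)
      also have "norm \<dots> \<le> integral {s..t} (\<lambda>x. \<epsilon> * (norm (f x) + norm (g x)))"
      proof (rule integral_norm_bound_integral)
        show "(\<lambda>x. (f x * G t + F s * g x) - h x) integrable_on {s..t}"
          by (rule integrable_diff[OF _ sub]) (use e1 st T in \<open>auto simp: h_def hint has_integral_iff\<close>)
        show "(\<lambda>x. \<epsilon> * (norm (f x) + norm (g x))) integrable_on {s..t}"
          using st T fi gi by (intro integrable_on_mult_right integrable_add subn) auto
        fix x assume x: "x \<in> {s..t}"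
        have "norm (F s - F x) \<le> \<epsilon>" "norm (G t - G x) \<le> \<epsilon>"
          using d1(2)[of x s] d2(2)[of x t] x st T by (auto simp: dist_norm)
        then have "norm (f x * (G t - G x)) \<le> \<epsilon> * norm (f x)" "norm ((F s - F x) * g x) \<le> \<epsilon> * norm (g x)"
          by (auto simp: norm_mult mult_right_mono mult.commute[of _ "norm (f x)"] mult_left_mono)
        moreover have "(f x * G t + F s * g x) - h x = f x * (G t - G x) + (F s - F x) * g x"
          by (simp add: h_def algebra_simps)
        ultimately show "norm ((f x * G t + F s * g x) - h x) \<le> \<epsilon> * (norm (f x) + norm (g x))"
          using norm_triangle_ineq[of "f x * (G t - G x)" "(F s - F x) * g x"]
          by (simp add: algebra_simps)
      qed
      also have "\<dots> = \<epsilon> * (\<Phi> t - \<Phi> s)"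
        using I2[symmetric] by (simp add: \<Phi>_def)
      finally show "norm (D t - D s) \<le> \<epsilon> * (\<Phi> t - \<Phi> s)" .
    qed
  qed
  then show "F T * G T = F a * G a + integral {a..T} (\<lambda>x. f x * G x + F x * g x)"
    by (simp add: D_def h_def diff_eq_eq)
qed

lemma ac_prim_add:
  assumes "ac_prim a b F f" "ac_prim a b G g"
  shows "ac_prim a b (\<lambda>x. F x + G x) (\<lambda>x. f x + g x)"
proof (rule ac_primI)
  show "(\<lambda>x. f x + g x) absolutely_integrable_on {a..b}"
    using assms ac_primD by (intro set_integral_add(1)) blast+
  fix t assume t: "a \<le> t" "t \<le> b"
  have "f integrable_on {a..t}" "g integrable_on {a..t}"
    using ac_prim_sub[OF assms(1), of a t] ac_prim_sub[OF assms(2), of a t] t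
    by (auto intro: abs_int_integrable dest: ac_primD(1))
  then have "integral {a..t} (\<lambda>x. f x + g x) = integral {a..t} f + integral {a..t} g"
    by (rule Henstock_Kurzweil_Integration.integral_add)
  then show "F t + G t = F a + G a + integral {a..t} (\<lambda>x. f x + g x)"
    using ac_primD(2)[OF assms(1), of a t] ac_primD(2)[OF assms(2), of a t] t by simp
qed

lemma ac_prim_C1:
  assumes "\<And>x. x \<in> {a..b} \<Longrightarrow> (F has_vector_derivative f x) (at x within {a..b})" "continuous_on {a..b} f"
  shows "ac_prim a b F f"
  unfolding ac_prim_def
proof (intro conjI allI impI)
  show "f absolutely_integrable_on {a..b}" using assms(2) by (rule absolutely_integrable_continuous_real)
  fix s t assume st: "a \<le> s" "s \<le> t" "t \<le> b"
  have "(f has_integral F t - F s) {s..t}"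
    using st by (intro fundamental_theorem_of_calculus has_vector_derivative_within_subset[OF assms(1), of _ "{s..t}"]) auto
  then show "integral {s..t} f = F t - F s" by (rule integral_unique)
qed

lemma ac_prim_const: "ac_prim a b (\<lambda>_. c) (\<lambda>_. 0)"
  by (rule ac_prim_C1) auto

lemma ac_prim_cmult:
  fixes F f :: "real \<Rightarrow> complex"
  assumes "ac_prim a b F f"
  shows "ac_prim a b (\<lambda>x. c * F x) (\<lambda>x. c * f x)"
  using ac_prim_mult[OF ac_prim_const assms] by simp

lemma ac_prim_diff:
  fixes F f :: "real \<Rightarrow> complex"
  assumes "ac_prim a b F f" "ac_prim a b G g"
  shows "ac_prim a b (\<lambda>x. F x - G x) (\<lambda>x. f x - g x)"
  using ac_prim_add[OF assms(1) ac_prim_cmult[OF assms(2), of "-1"]] by simp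

lemma ac_prim_cong:
  assumes "ac_prim a b F f" "\<And>x. a \<le> x \<Longrightarrow> x \<le> b \<Longrightarrow> F x = G x" "\<And>x. a \<le> x \<Longrightarrow> x \<le> b \<Longrightarrow> f x = g x"
  shows "ac_prim a b G g"
proof -
  have "g absolutely_integrable_on {a..b}"
    by (rule absolutely_integrable_spike[OF ac_primD(1)[OF assms(1)] negligible_empty]) (use assms(3) in auto)
  moreover have "integral {s..t} g = integral {s..t} f" if "a \<le> s" "t \<le> b" for s t
    using that assms(3) by (intro integral_cong) auto
  ultimately show ?thesis
    using assms unfolding ac_prim_def by auto
qed

section \<open>Integral inequalities of Gronwall type\<close>

lemma integral_increment:
  fixes f :: "real \<Rightarrow> real"
  assumes f: "f integrable_on {a..b}" "\<And>x. x \<in> {a..b} \<Longrightarrow> f x \<ge> 0" and st: "a \<le> s" "s \<le> t" "t \<le> b"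
  shows "integral {a..t} f - integral {a..s} f = integral {s..t} f" "integral {s..t} f \<ge> 0"
proof -
  have sub: "f integrable_on {c..d}" if "a \<le> c" "d \<le> b" for c d
    using that f integrable_on_subinterval by fastforce
  have "integral {a..s} f + integral {s..t} f = integral {a..t} f"
    using st by (intro Henstock_Kurzweil_Integration.integral_combine sub) auto
  then show "integral {a..t} f - integral {a..s} f = integral {s..t} f" by simp
  show "integral {s..t} f \<ge> 0" using st f(2) by (intro integral_nonneg sub) auto
qed

text \<open>Formally \<open>g * w\<close> is a quarter of the derivative of \<open>w\<close>, so the
  true value is (w x - 1) / 4. Claiming only \<open>w x / 2\<close> leaves a factor 2 of slack,
  enough to prove the bound on short intervals with \<open>w\<close> frozen at the right end.
  Bisection adds these up, and the exponential of an integral is never differentiated.\<close>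

lemma integral_exp_weight_le:
  fixes g :: "real \<Rightarrow> real"
  assumes g: "g integrable_on {a..b}" and g0: "\<And>x. x \<in> {a..b} \<Longrightarrow> g x \<ge> 0" and x: "x \<in> {a..b}"
  defines "w \<equiv> \<lambda>x. exp (4 * integral {a..x} g)"
  shows "(\<lambda>t. g t * w t) integrable_on {a..b}"
    and "integral {a..x} (\<lambda>t. g t * w t) \<le> w x / 2"
proof -
  define G where "G x = integral {a..x} g" for x
  have w: "w x = exp (4 * G x)" for x by (simp add: w_def G_def)
  have contG: "continuous_on {a..b} G"
    unfolding G_def using g by (rule indefinite_integral_continuous_1)
  have contw: "continuous_on {a..b} w" unfolding w by (intro continuous_intros contG)
  have gai: "g absolutely_integrable_on {a..b}"
    using g g0 by (auto intro: nonnegative_absolutely_integrable_1)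
  have "(\<lambda>t. g t * w t) absolutely_integrable_on {a..b}"
    by (rule abs_int_mult_continuous[OF gai contw])
  then show gw: "(\<lambda>t. g t * w t) integrable_on {a..b}" by (rule abs_int_integrable)
  have sub: "k integrable_on {s..t}" if "k integrable_on {a..b}" "a \<le> s" "t \<le> b" for s t and k :: "real \<Rightarrow> real"
    using that integrable_on_subinterval by fastforce
  have Gd: "G t - G s = integral {s..t} g" "integral {s..t} g \<ge> 0" if "a \<le> s" "s \<le> t" "t \<le> b" for s t
    unfolding G_def by (rule integral_increment[OF g _ that]; use g0 in auto)+
  define P where "P s t \<longleftrightarrow> (a \<le> s \<longrightarrow> t \<le> b \<longrightarrow> integral {s..t} (\<lambda>t. g t * w t) \<le> (w t - w s) / 2)" for s t
  have "P a x"
  proof (rule Bolzano[of a x P])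
    show "a \<le> x" using x by simp
  next
    fix s t r assume "P s t" "P t r" and o: "s \<le> t" "t \<le> r"
    show "P s r" unfolding P_def
    proof (intro impI)
      assume sr: "a \<le> s" "r \<le> b"
      have "integral {s..t} (\<lambda>t. g t * w t) + integral {t..r} (\<lambda>t. g t * w t) = integral {s..r} (\<lambda>t. g t * w t)"
        using o sr by (intro Henstock_Kurzweil_Integration.integral_combine sub[OF gw]) auto
      then show "integral {s..r} (\<lambda>t. g t * w t) \<le> (w r - w s) / 2"
        using \<open>P s t\<close> \<open>P t r\<close> o sr by (auto simp: P_def field_simps)
    qed
  next
    fix y assume y: "a \<le> y" "y \<le> x"
    \<comment> \<open>Two deviations below 1/16 give an increment \<open>D\<close> of at most 1/8,
      hence 4 D at most 1/2, which is small enough for exp(4 D) to stay below 2.\<close>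
    obtain d where d: "d > 0" "\<And>z. z \<in> {a..b} \<Longrightarrow> dist z y < d \<Longrightarrow> dist (G z) (G y) < 1/16"
      using contG y x unfolding continuous_on_iff by (metis atLeastAtMost_iff order_trans zero_less_divide_1_iff zero_less_numeral)
    show "\<exists>d>0. \<forall>s t. s \<le> y \<and> y \<le> t \<and> t - s < d \<longrightarrow> P s t"
    proof (intro exI[of _ d] conjI allI impI d)
      fix s t assume st: "s \<le> y \<and> y \<le> t \<and> t - s < d"
      show "P s t" unfolding P_def
      proof (intro impI)
        assume as: "a \<le> s" "t \<le> b"
        then have ab: "a \<le> s" "s \<le> t" "t \<le> b" using st by auto
        have "dist (G s) (G y) < 1/16" "dist (G t) (G y) < 1/16"
          using d(2)[of s] d(2)[of t] st as by (auto simp: dist_real_def)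
        then have "G t - G s \<le> 1/8" unfolding dist_real_def by linarith
        then have h: "4 * (G t - G s) \<le> 1/2" by simp
        define D where "D = G t - G s"
        have h0: "D \<ge> 0" using Gd[OF ab] by (simp add: D_def)
        have e1: "exp (4 * D) \<le> 2"
        proof -
          have "exp (4 * D) \<le> 1 + 4 * D + (4 * D)\<^sup>2" using h h0 by (intro exp_bound) (auto simp: D_def)
          also have "(4 * D)\<^sup>2 \<le> 1/2 * (1/2)" unfolding power2_eq_square
            using h h0 by (intro mult_mono) (auto simp: D_def)
          finally show ?thesis using h by (simp add: D_def)
        qed
        have wt: "w t = w s * exp (4 * D)" by (simp add: w D_def algebra_simps flip: exp_add)
        have "integral {s..t} (\<lambda>t. g t * w t) \<le> integral {s..t} (\<lambda>\<tau>. g \<tau> * w t)"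
        proof (rule integral_le)
          fix \<tau> assume "\<tau> \<in> {s..t}"
          then have "w \<tau> \<le> w t" using Gd[of \<tau> t] ab by (auto simp: w)
          then show "g \<tau> * w \<tau> \<le> g \<tau> * w t" using g0[of \<tau>] \<open>\<tau> \<in> {s..t}\<close> ab by (intro mult_left_mono) auto
        qed (use ab sub[OF gw] sub[OF g] in \<open>auto intro!: integrable_on_mult_left\<close>)
        also have "\<dots> = D * w t" using Gd[OF ab] by (simp add: D_def)
        also have "\<dots> = w s * (D * exp (4 * D))" by (simp add: wt)
        also have "\<dots> \<le> w s * (2 * D)"
          using mult_left_mono[OF e1 h0] by (intro mult_left_mono) (auto simp: w mult.commute)
        also have "\<dots> \<le> w s * ((exp (4 * D) - 1) / 2)"
        proof (rule mult_left_mono)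
          have "2 * D \<le> (E - 1) / 2" if "1 + 4 * D \<le> E" for E using that by simp
          then show "2 * D \<le> (exp (4 * D) - 1) / 2" using exp_ge_add_one_self by blast
        qed (simp add: w)
        also have "\<dots> = (w t - w s) / 2" by (simp add: wt field_simps)
        finally show "integral {s..t} (\<lambda>t. g t * w t) \<le> (w t - w s) / 2" .
      qed
    qed
  qed
  then have "integral {a..x} (\<lambda>t. g t * w t) \<le> (w x - w a) / 2" using x by (auto simp: P_def)
  then show "integral {a..x} (\<lambda>t. g t * w t) \<le> w x / 2" by (simp add: w field_simps) (smt (verit) exp_gt_zero)
qed

text \<open>The weight \<open>w\<close> turns the integral inequality into a contraction, so the constant \<open>C\<close>
  is doubled; sharpness is never needed.\<close>
lemma gronwall:
  fixes f g :: "real \<Rightarrow> real"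
  assumes g: "g integrable_on {a..b}" and g0: "\<And>x. x \<in> {a..b} \<Longrightarrow> g x \<ge> 0"
    and f: "continuous_on {a..b} f" and C: "C \<ge> 0"
    and le: "\<And>x. x \<in> {a..b} \<Longrightarrow> f x \<le> C + integral {a..x} (\<lambda>t. g t * f t)"
    and x: "x \<in> {a..b}"
  shows "f x \<le> 2 * C * exp (4 * integral {a..x} g)"
proof -
  define w where "w x = exp (4 * integral {a..x} g)" for x
  note weight = integral_exp_weight_le[OF g g0, folded w_def]
  have w: "continuous_on {a..b} w" and w0: "w x > 0" for x
    unfolding w_def by (intro continuous_intros indefinite_integral_continuous_1 g) simp
  have w1: "w x \<ge> 1" if "x \<in> {a..b}" for x
    using integral_increment(2)[OF g g0, of a x] that by (simp add: w_def)
  have gai: "g absolutely_integrable_on {a..b}"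
    using g g0 by (auto intro: nonnegative_absolutely_integrable_1)
  have gf: "(\<lambda>t. g t * f t) integrable_on {a..b}" "(\<lambda>t. g t * w t) integrable_on {a..b}"
    by (intro abs_int_integrable abs_int_mult_continuous gai f w)+
  have "continuous_on {a..b} (\<lambda>x. f x / w x)"
    using w0 by (intro continuous_intros f w) (simp add: less_imp_neq[symmetric])
  \<comment> \<open>At a maximum point \<open>y\<close> of \<open>f / w\<close>, with value
    \<open>N\<close>, the hypothesis becomes N w(y) \<le> C + N w(y) / 2 when N is nonnegative.
    Since \<open>w\<close> is at least 1, this forces \<open>N \<le> 2 * C\<close>.\<close>
  then obtain y where y: "y \<in> {a..b}" "\<And>z. z \<in> {a..b} \<Longrightarrow> f z / w z \<le> f y / w y"
    using continuous_attains_sup[of "{a..b}" "\<lambda>x. f x / w x"] x by auto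
  define N where "N = f y / w y"
  have fN: "f z \<le> N * w z" if "z \<in> {a..b}" for z
    using y(2)[OF that] w0[of z] by (simp add: N_def pos_divide_le_eq)
  have "integral {a..y} (\<lambda>t. g t * f t) \<le> integral {a..y} (\<lambda>t. N * (g t * w t))"
  proof (rule integral_le)
    show "(\<lambda>t. g t * f t) integrable_on {a..y}" "(\<lambda>t. N * (g t * w t)) integrable_on {a..y}"
      using gf y(1) by (auto intro!: integrable_on_mult_right intro: integrable_on_subinterval)
    fix t assume t: "t \<in> {a..y}"
    then have "g t * f t \<le> g t * (N * w t)" using y(1) by (intro mult_left_mono fN g0) auto
    then show "g t * f t \<le> N * (g t * w t)" by (simp add: mult_ac)
  qed
  then have *: "N * w y \<le> C + N * integral {a..y} (\<lambda>t. g t * w t)"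
    using le[OF y(1)] w0[of y] by (simp add: N_def)
  have "N \<le> 2 * C"
  proof (cases "N \<ge> 0")
    case True
    have "N * integral {a..y} (\<lambda>t. g t * w t) \<le> N * (w y / 2)" using weight(2)[OF _ y(1)] True by (intro mult_left_mono) auto
    then have "N * w y \<le> 2 * C" using * by simp
    moreover have "N * 1 \<le> N * w y" using w1[OF y(1)] True by (rule mult_left_mono)
    ultimately show ?thesis by simp
  qed (use C in auto)
  then have "N * w x \<le> 2 * C * w x" using w0[of x] by (intro mult_right_mono) auto
  then show ?thesis using fN[OF x] unfolding w_def by linarith
qed

section \<open>Sturm--Liouville equations with integrable potential\<close>

text \<open>Picard iteration, in the norm weighted by exp(4 times the integral of \<open>g\<close>).
  There each step contracts by 1/2 on every interval, however long, so no continuation argument is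
  required and an integrable, possibly unbounded Lipschitz function \<open>g\<close> suffices. The
  limit is written as a telescoping series to apply the Weierstrass test.\<close>

lemma volterra_exists:
  fixes F :: "real \<Rightarrow> 'a \<Rightarrow> 'a::euclidean_space" and g :: "real \<Rightarrow> real"
  assumes g: "\<And>T. g integrable_on {0..T}" and g0: "\<And>x. x \<ge> 0 \<Longrightarrow> g x \<ge> 0"
    and lip: "\<And>x y z. x \<ge> 0 \<Longrightarrow> norm (F x y - F x z) \<le> g x * norm (y - z)"
    and int: "\<And>T Y. continuous_on {0..T} Y \<Longrightarrow> (\<lambda>t. F t (Y t)) absolutely_integrable_on {0..T}"
  shows "\<exists>Y. (\<forall>T. ac_prim 0 T Y (\<lambda>t. F t (Y t))) \<and> Y 0 = y0"
proof -
  define Yn where "Yn = rec_nat (\<lambda>x::real. y0) (\<lambda>n Y x. y0 + integral {0..x} (\<lambda>t. F t (Y t)))"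
  have Y0: "Yn 0 x = y0" and YS: "Yn (Suc n) x = y0 + integral {0..x} (\<lambda>t. F t (Yn n t))" for n x
    by (simp_all add: Yn_def)
  have contYn: "continuous_on {0..T} (Yn n)" for n T
  proof (induction n)
    case 0 then show ?case by (simp add: Y0[abs_def])
  next
    case (Suc n)
    show ?case unfolding YS[abs_def]
      by (intro continuous_intros indefinite_integral_continuous_1 abs_int_integrable int Suc)
  qed
  have fint: "(\<lambda>t. F t (Y t)) integrable_on {0..x}" if "continuous_on {0..T} Y" "x \<le> T" for Y T x
    using that by (intro abs_int_integrable int continuous_on_subset[OF that(1)]) auto
  define Y where "Y x = y0 + (\<Sum>n. Yn (Suc n) x - Yn n x)" for x
  have ul: "uniform_limit {0..T} Yn Y sequentially" for T
  proof -
    define w where "w x = exp (4 * integral {0..x} g)" for x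
    have "bounded ((\<lambda>x. Yn 1 x - Yn 0 x) ` {0..T})"
      by (intro compact_imp_bounded compact_continuous_image continuous_intros contYn) auto
    then obtain M where M: "M > 0" "\<And>x. x \<in> {0..T} \<Longrightarrow> norm (Yn 1 x - Yn 0 x) \<le> M"
      unfolding bounded_pos by auto
    have w1: "w x \<ge> 1" if "x \<in> {0..T}" for x
    proof -
      have "0 \<le> integral {0..x} g" by (rule integral_nonneg[OF g]) (use g0 in auto)
      then show ?thesis by (simp add: w_def)
    qed
    have wT: "w x \<le> w T" if "x \<in> {0..T}" for x
    proof -
      have "integral {0..x} g \<le> integral {0..T} g"
        by (rule integral_subset_le[OF _ g g]) (use that g0 in auto)
      then show ?thesis by (simp add: w_def)
    qed
    have bnd: "norm (Yn (Suc n) x - Yn n x) \<le> M * (1/2)^n * w x" if "x \<in> {0..T}" for n x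
      using that
    proof (induction n arbitrary: x)
      case 0
      have "norm (Yn 1 x - Yn 0 x) \<le> M * 1" using M 0 by simp
      also have "\<dots> \<le> M * w x" using w1[OF 0] M by (intro mult_left_mono) auto
      finally show ?case by simp
    next
      case (Suc n)
      have gw: "(\<lambda>t. g t * w t) integrable_on {0..x}" "integral {0..x} (\<lambda>t. g t * w t) \<le> w x / 2"
        unfolding w_def using integral_exp_weight_le[OF g[of x], of x] g0 Suc.prems by auto
      have "Yn (Suc (Suc n)) x - Yn (Suc n) x = integral {0..x} (\<lambda>t. F t (Yn (Suc n) t)) - integral {0..x} (\<lambda>t. F t (Yn n t))"
        unfolding YS[of "Suc n"] YS[of n x] by simp
      also have "\<dots> = integral {0..x} (\<lambda>t. F t (Yn (Suc n) t) - F t (Yn n t))"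
        by (intro Henstock_Kurzweil_Integration.integral_diff[symmetric] fint[OF contYn order_refl])
      also have "norm \<dots> \<le> integral {0..x} (\<lambda>t. (M * (1/2)^n) * (g t * w t))"
      proof (rule integral_norm_bound_integral)
        show "(\<lambda>t. F t (Yn (Suc n) t) - F t (Yn n t)) integrable_on {0..x}"
          by (intro integrable_diff fint[OF contYn order_refl])
        show "(\<lambda>t. (M * (1/2)^n) * (g t * w t)) integrable_on {0..x}"
          by (intro integrable_on_mult_right gw)
        fix t assume t: "t \<in> {0..x}"
        have "norm (F t (Yn (Suc n) t) - F t (Yn n t)) \<le> g t * norm (Yn (Suc n) t - Yn n t)"
          using t by (intro lip) auto
        also have "\<dots> \<le> g t * (M * (1/2)^n * w t)"
          using t Suc.prems g0[of t] by (intro mult_left_mono Suc.IH) auto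
        finally show "norm (F t (Yn (Suc n) t) - F t (Yn n t)) \<le> (M * (1/2)^n) * (g t * w t)"
          by (simp add: mult_ac)
      qed
      also have "\<dots> = (M * (1/2)^n) * integral {0..x} (\<lambda>t. g t * w t)" by simp
      also have "\<dots> \<le> (M * (1/2)^n) * (w x / 2)" using gw M by (intro mult_left_mono) auto
      finally show ?case by (simp add: mult_ac)
    qed
    have "uniform_limit {0..T} (\<lambda>n x. \<Sum>i<n. Yn (Suc i) x - Yn i x) (\<lambda>x. \<Sum>i. Yn (Suc i) x - Yn i x) sequentially"
    proof (rule Weierstrass_m_test)
      show "norm (Yn (Suc n) x - Yn n x) \<le> M * (1/2)^n * w T" if "x \<in> {0..T}" for n x
      proof -
        have "M * (1/2)^n * w x \<le> M * (1/2)^n * w T"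
          using wT[OF that] M(1) by (intro mult_left_mono) auto
        then show ?thesis using bnd[OF that, of n] by linarith
      qed
      show "summable (\<lambda>n. M * (1/2)^n * w T)"
        by (intro summable_mult summable_mult2 summable_geometric) auto
    qed
    then have "uniform_limit {0..T} (\<lambda>n x. y0 + (\<Sum>i<n. Yn (Suc i) x - Yn i x)) Y sequentially"
      unfolding Y_def by (rule uniform_limit_add[OF uniform_limit_const])
    moreover have "y0 + (\<Sum>i<n. Yn (Suc i) x - Yn i x) = Yn n x" for n x
      by (subst sum_lessThan_telescope[of "\<lambda>i. Yn i x"]) (simp add: Y0)
    ultimately show ?thesis by simp
  qed
  have contY: "continuous_on {0..T} Y" for T
    by (rule uniform_limit_theorem[OF always_eventually ul]) (auto simp: contYn)
  have eq: "Y x = y0 + integral {0..x} (\<lambda>t. F t (Y t))" if "x \<ge> 0" for x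
  proof -
    have "(\<lambda>n. Yn (Suc n) x) \<longlonglongrightarrow> Y x"
      using tendsto_uniform_limitI[OF ul, of x x] that by (subst filterlim_sequentially_Suc) auto
    moreover have "(\<lambda>n. Yn (Suc n) x) \<longlonglongrightarrow> y0 + integral {0..x} (\<lambda>t. F t (Y t))"
      unfolding YS
    proof (rule tendsto_add[OF tendsto_const tendstoI])
      fix e :: real assume e: "e > 0"
      define I where "I = integral {0..x} g"
      have I: "I \<ge> 0" unfolding I_def by (rule integral_nonneg[OF g]) (use g0 in auto)
      have "e / (I + 1) > 0" using e I by simp
      with ul[of x] have "\<forall>\<^sub>F n in sequentially. \<forall>t\<in>{0..x}. dist (Yn n t) (Y t) < e / (I + 1)"
        unfolding uniform_limit_iff by blast
      then show "\<forall>\<^sub>F n in sequentially. dist (integral {0..x} (\<lambda>t. F t (Yn n t))) (integral {0..x} (\<lambda>t. F t (Y t))) < e"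
      proof eventually_elim
        case (elim n)
        have "integral {0..x} (\<lambda>t. F t (Yn n t)) - integral {0..x} (\<lambda>t. F t (Y t)) = integral {0..x} (\<lambda>t. F t (Yn n t) - F t (Y t))"
          by (intro Henstock_Kurzweil_Integration.integral_diff[symmetric] fint[OF contYn order_refl] fint[OF contY order_refl])
        also have "norm \<dots> \<le> integral {0..x} (\<lambda>t. g t * (e / (I + 1)))"
        proof (rule integral_norm_bound_integral)
          show "(\<lambda>t. F t (Yn n t) - F t (Y t)) integrable_on {0..x}"
            by (intro integrable_diff fint[OF contYn order_refl] fint[OF contY order_refl])
          show "(\<lambda>t. g t * (e / (I + 1))) integrable_on {0..x}"
            by (intro integrable_on_mult_left g)
          fix t assume t: "t \<in> {0..x}"
          have "norm (F t (Yn n t) - F t (Y t)) \<le> g t * norm (Yn n t - Y t)"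
            using t by (intro lip) auto
          also have "\<dots> \<le> g t * (e / (I + 1))"
            using t g0[of t] elim by (intro mult_left_mono) (auto simp: dist_norm less_imp_le)
          finally show "norm (F t (Yn n t) - F t (Y t)) \<le> g t * (e / (I + 1))" .
        qed
        also have "\<dots> = I * (e / (I + 1))" by (simp add: I_def)
        also have "\<dots> < e" using e I by (simp add: field_simps)
        finally show ?case by (simp add: dist_norm)
      qed
    qed
    ultimately show ?thesis by (rule LIMSEQ_unique)
  qed
  have "Y 0 = y0" using eq[of 0] by simp
  moreover have "ac_prim 0 T Y (\<lambda>t. F t (Y t))" for T
    by (rule ac_primI) (use int[OF contY] eq \<open>Y 0 = y0\<close> in auto)
  ultimately show ?thesis by blast
qed

text \<open>The equation is a first order system for the pair of \<open>y\<close> and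
  \<open>y'\<close>, with Lipschitz function 1 + |Q| + |lam|. The second component of the Volterra
  equation is literally the integrated form in \<open>sl_solution\<close>; the first one has a
  continuous integrand and can be differentiated everywhere.\<close>

lemma sl_solution_exists_half_line:
  assumes Q: "\<And>T. Q absolutely_integrable_on {0..T}"
  shows "\<exists>y y'. sl_solution Q lam {0..} y y' \<and> y 0 = y0 \<and> y' 0 = y1"
proof -
  define F where "F t p = (snd p, (complex_of_real (Q t) - lam) * fst p)" for t and p :: "complex \<times> complex"
  define g where "g t = 1 + \<bar>Q t\<bar> + cmod lam" for t
  have qai: "(\<lambda>t. complex_of_real (Q t) - lam) absolutely_integrable_on {0..T}" for T
    by (intro set_integral_diff(1) abs_int_of_real Q absolutely_integrable_on_const) auto
  have gint: "g integrable_on {0..T}" for T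
    unfolding g_def using abs_int_norm_integrable[OF Q] by (auto intro!: integrable_add)
  have int2: "(\<lambda>t. (complex_of_real (Q t) - lam) * fst (Y t)) absolutely_integrable_on {0..T}"
    if "continuous_on {0..T} Y" for T and Y :: "real \<Rightarrow> complex \<times> complex"
    by (intro abs_int_mult_continuous qai continuous_intros that)
  have int: "(\<lambda>t. F t (Y t)) absolutely_integrable_on {0..T}" if "continuous_on {0..T} Y" for T Y
  proof -
    have "(\<lambda>t. (snd (Y t), 0::complex)) absolutely_integrable_on {0..T}"
      by (intro absolutely_integrable_continuous_real continuous_intros that)
    moreover have "bounded_linear (\<lambda>z. (0::complex, z::complex))"
      by (intro bounded_linear_intros)
    from absolutely_integrable_linear[OF int2[OF that] this]
    have "(\<lambda>t. (0::complex, (complex_of_real (Q t) - lam) * fst (Y t))) absolutely_integrable_on {0..T}"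
      by (simp add: o_def)
    ultimately have "(\<lambda>t. (snd (Y t), 0) + (0, (complex_of_real (Q t) - lam) * fst (Y t))) absolutely_integrable_on {0..T}"
      by (rule set_integral_add(1))
    then show ?thesis by (simp add: F_def)
  qed
  obtain Y where Y: "\<And>T. ac_prim 0 T Y (\<lambda>t. F t (Y t))" "Y 0 = (y0, y1)"
  proof -
    have "\<exists>Y. (\<forall>T. ac_prim 0 T Y (\<lambda>t. F t (Y t))) \<and> Y 0 = (y0, y1)"
    proof (rule volterra_exists[where g=g])
      fix x :: real and y z :: "complex \<times> complex"
      have n1: "norm (snd (y - z)) \<le> norm (y - z)" and n2: "norm (fst (y - z)) \<le> norm (y - z)"
        by (metis norm_snd_le prod.collapse) (metis norm_fst_le prod.collapse)
      have "norm (F x y - F x z) = norm (snd (y - z), (complex_of_real (Q x) - lam) * fst (y - z))"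
        by (simp add: F_def algebra_simps)
      also have "\<dots> \<le> norm (snd (y - z)) + norm ((complex_of_real (Q x) - lam) * fst (y - z))"
        by (rule norm_Pair_le)
      also have "\<dots> \<le> norm (y - z) + (\<bar>Q x\<bar> + cmod lam) * norm (y - z)"
        unfolding norm_mult
        using norm_triangle_ineq4[of "complex_of_real (Q x)" lam]
        by (intro add_mono mult_mono n1 n2) auto
      finally show "norm (F x y - F x z) \<le> g x * norm (y - z)" by (simp add: g_def algebra_simps)
    qed (use gint int in \<open>auto simp: g_def\<close>)
    then show ?thesis using that by blast
  qed
  define y where "y x = fst (Y x)" for x
  define y' where "y' x = snd (Y x)" for x
  have contY: "continuous_on {0..T} Y" for T using ac_prim_continuous[OF Y(1)] .
  have Yi: "((\<lambda>t. F t (Y t)) has_integral (Y v - Y u)) {u..v}" if "0 \<le> u" "u \<le> v" for u v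
    using ac_primD(2)[OF Y(1)[of v], of u v] abs_int_integrable[OF ac_primD(1)[OF ac_prim_sub[OF Y(1)[of v], of u v]]] that
    by (auto simp: has_integral_iff)
  have fsti: "(y' has_integral (y v - y u)) {u..v}" if "0 \<le> u" "u \<le> v" for u v
    using has_integral_linear[OF Yi[OF that] bounded_linear_fst] by (simp add: o_def F_def y_def[abs_def] y'_def[abs_def])
  have sndi: "((\<lambda>t. (complex_of_real (Q t) - lam) * y t) has_integral (y' v - y' u)) {u..v}" if "0 \<le> u" "u \<le> v" for u v
    using has_integral_linear[OF Yi[OF that] bounded_linear_snd] by (simp add: o_def F_def y_def[abs_def] y'_def[abs_def])
  have "(y has_vector_derivative y' x) (at x within {0..})" if "x \<ge> 0" for x
  proof -
    have "continuous_on {0..x+1} y'" unfolding y'_def by (intro continuous_intros contY)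
    then have "((\<lambda>u. integral {0..u} y') has_vector_derivative y' x) (at x within {0..x+1})"
      using that by (intro integral_has_vector_derivative) auto
    then have "((\<lambda>u. y 0 + integral {0..u} y') has_vector_derivative y' x) (at x within {0..x+1})"
      by (auto intro!: derivative_eq_intros)
    then have "(y has_vector_derivative y' x) (at x within {0..x+1})"
      by (rule has_vector_derivative_transform[rotated 2])
         (use that fsti[of 0] in \<open>auto simp: has_integral_iff\<close>)
    moreover have "at x within {0..x+1} = at x within {0..}"
      using that by (intro at_within_nhd[of x "{..<x+1}"]) auto
    ultimately show ?thesis by simp
  qed
  then have "sl_solution Q lam {0..} y y'"
    unfolding sl_solution_def using sndi by (auto simp: is_interval_ci)
  moreover have "y 0 = y0" "y' 0 = y1" using Y(2) by (auto simp: y_def y'_def)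
  ultimately show ?thesis by blast
qed

section \<open>Wronskians, uniqueness and fundamental solutions\<close>

definition loc_int :: "real set \<Rightarrow> (real \<Rightarrow> real) \<Rightarrow> bool" where
  "loc_int S Q \<longleftrightarrow> (\<forall>u\<in>S. \<forall>v\<in>S. Q absolutely_integrable_on {u..v})"

text \<open>The passage from solutions to the integrated calculus. The second claim comes first in
  the proof: it makes \<open>y'\<close> continuous, and then \<open>y\<close> is continuously
  differentiable.\<close>

lemma sl_solution_ac_prim:
  assumes sol: "sl_solution Q lam S y y'" and sub: "{a..b} \<subseteq> S" and Q: "Q absolutely_integrable_on {a..b}"
  shows "ac_prim a b y y'" and "ac_prim a b y' (\<lambda>t. (complex_of_real (Q t) - lam) * y t)"
proof -
  have der: "(y has_vector_derivative y' x) (at x within {a..b})" if "x \<in> {a..b}" for x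
    by (rule has_vector_derivative_within_subset[OF _ sub]) (use sol sub that in \<open>auto simp: sl_solution_def\<close>)
  have cont: "continuous_on {a..b} y"
    unfolding continuous_on_eq_continuous_within using der has_vector_derivative_continuous by blast
  have "(\<lambda>t. complex_of_real (Q t) - lam) absolutely_integrable_on {a..b}"
    by (intro set_integral_diff(1) abs_int_of_real Q absolutely_integrable_on_const) auto
  then have "(\<lambda>t. (complex_of_real (Q t) - lam) * y t) absolutely_integrable_on {a..b}"
    by (rule abs_int_mult_continuous[OF _ cont])
  moreover have "integral {s..t} (\<lambda>t. (complex_of_real (Q t) - lam) * y t) = y' t - y' s"
    if "a \<le> s" "s \<le> t" "t \<le> b" for s t
  proof (rule integral_unique)
    have "s \<in> S" "t \<in> S" using sub that by auto
    then show "((\<lambda>t. (complex_of_real (Q t) - lam) * y t) has_integral (y' t - y' s)) {s..t}"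
      using sol that unfolding sl_solution_def by blast
  qed
  ultimately show ac: "ac_prim a b y' (\<lambda>t. (complex_of_real (Q t) - lam) * y t)"
    unfolding ac_prim_def by blast
  show "ac_prim a b y y'" using der ac_prim_continuous[OF ac] by (rule ac_prim_C1)
qed

text \<open>In the product rule the terms \<open>f' g'\<close> cancel, leaving the difference of the
  two equations. The lemma has three uses: equal potentials and parameters give constancy of the
  Wronskian, equal potentials alone give Green's identity in the spectral parameter, and equal
  parameters alone give the derivatives of the variation of parameters coefficients.\<close>

lemma wronsk_ac_prim:
  assumes "sl_solution Q\<^sub>1 \<mu> S f f'" "sl_solution Q\<^sub>2 lam S g g'" and sub: "{a..b} \<subseteq> S"
    and Q: "Q\<^sub>1 absolutely_integrable_on {a..b}" "Q\<^sub>2 absolutely_integrable_on {a..b}"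
  shows "ac_prim a b (\<lambda>x. wronsk (f x) (f' x) (g x) (g' x))
           (\<lambda>x. (of_real (Q\<^sub>1 x - Q\<^sub>2 x) - \<mu> + lam) * (f x * g x))"
proof -
  note f = sl_solution_ac_prim[OF assms(1) sub Q(1)] and g = sl_solution_ac_prim[OF assms(2) sub Q(2)]
  show ?thesis
    using ac_prim_diff[OF ac_prim_mult[OF f(2) g(1)] ac_prim_mult[OF f(1) g(2)]]
    by (rule ac_prim_cong) (simp_all add: wronsk_def algebra_simps)
qed

lemma sl_solution_is_interval: "sl_solution Q lam S y y' \<Longrightarrow> is_interval S"
  by (simp add: sl_solution_def)

lemma is_interval_Icc_subset: "is_interval S \<Longrightarrow> u \<in> S \<Longrightarrow> v \<in> S \<Longrightarrow> {u..v} \<subseteq> S" for S :: "real set"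
  by (meson atLeastAtMost_iff is_interval_1 subsetI)

lemma wronsk_constant:
  assumes f: "sl_solution Q lam S f f'" and g: "sl_solution Q lam S g g'" and Q: "loc_int S Q"
    and uv: "u \<in> S" "v \<in> S"
  shows "wronsk (f u) (f' u) (g u) (g' u) = wronsk (f v) (f' v) (g v) (g' v)"
proof -
  have *: "wronsk (f u) (f' u) (g u) (g' u) = wronsk (f v) (f' v) (g v) (g' v)"
    if uv: "u \<in> S" "v \<in> S" "u \<le> v" for u v
  proof -
    have "{u..v} \<subseteq> S" "Q absolutely_integrable_on {u..v}"
      using is_interval_Icc_subset[OF sl_solution_is_interval[OF f] uv(1,2)] Q uv by (auto simp: loc_int_def)
    then     have "ac_prim u v (\<lambda>x. wronsk (f x) (f' x) (g x) (g' x))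
           (\<lambda>x. (of_real (Q x - Q x) - lam + lam) * (f x * g x))"
      by (intro wronsk_ac_prim[OF f g])
    from ac_primD(2)[OF this, of u v] show ?thesis using uv by simp
  qed
  show ?thesis
  proof (cases "u \<le> v")
    case True then show ?thesis by (intro * uv)
  next
    case False then show ?thesis by (intro *[symmetric] uv) simp
  qed
qed

text \<open>Cramer's rule for a pair whose Wronskian has constant modulus one: \<open>y 0\<close>
  and \<open>y' 0\<close> are the Wronskians of \<open>y\<close> with the two basis solutions, by
  constancy evaluated at \<open>x\<close>. Uniqueness for the initial value problem follows from
  this and from existence, without another estimate.\<close>

lemma sl_solution_expand:
  assumes y: "sl_solution Q lam S y y'"
    and th: "sl_solution Q lam S \<theta> \<theta>'" "\<theta> 0 = 1" "\<theta>' 0 = 0"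
    and ph: "sl_solution Q lam S \<phi> \<phi>'" "\<phi> 0 = 0" "\<phi>' 0 = 1"
    and Q: "loc_int S Q" and x: "0 \<in> S" "x \<in> S"
  shows "y x = y 0 * \<theta> x + y' 0 * \<phi> x" "y' x = y 0 * \<theta>' x + y' 0 * \<phi>' x"
proof -
  have 1: "\<theta> x * \<phi>' x - \<theta>' x * \<phi> x = 1"
    using wronsk_constant[OF th(1) ph(1) Q x] th ph by (simp add: wronsk_def algebra_simps)
  have 2: "y' 0 = y' x * \<theta> x - y x * \<theta>' x"
    using wronsk_constant[OF y th(1) Q x] th ph by (simp add: wronsk_def algebra_simps)
  have 3: "y 0 = y x * \<phi>' x - y' x * \<phi> x"
    using wronsk_constant[OF y ph(1) Q x] th ph by (simp add: wronsk_def algebra_simps)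
  have "y x = y x * (\<theta> x * \<phi>' x - \<theta>' x * \<phi> x)" "y' x = y' x * (\<theta> x * \<phi>' x - \<theta>' x * \<phi> x)" by (simp_all add: 1)
  then show "y x = y 0 * \<theta> x + y' 0 * \<phi> x" "y' x = y 0 * \<theta>' x + y' 0 * \<phi>' x"
    unfolding 2 3 by (simp_all add: algebra_simps)
qed

lemma sl_solution_subset:
  assumes "sl_solution Q lam S y y'" "T \<subseteq> S" "is_interval T"
  shows "sl_solution Q lam T y y'"
  using assms unfolding sl_solution_def by (auto intro: has_vector_derivative_within_subset)

lemma loc_int_subset: "loc_int S Q \<Longrightarrow> T \<subseteq> S \<Longrightarrow> loc_int T Q"
  by (auto simp: loc_int_def)

lemma sl_solution_cnj:
  assumes "sl_solution Q lam S f f'"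
  shows "sl_solution Q (cnj lam) S (\<lambda>x. cnj (f x)) (\<lambda>x. cnj (f' x))"
  unfolding sl_solution_def
proof (intro conjI ballI impI)
  show "is_interval S" using assms by (rule sl_solution_is_interval)
  show "((\<lambda>x. cnj (f x)) has_vector_derivative cnj (f' x)) (at x within S)" if "x \<in> S" for x
    using assms that unfolding sl_solution_def by (intro has_vector_derivative_cnj) auto
  fix u v assume uv: "u \<in> S" "v \<in> S" "u \<le> v"
  have "((\<lambda>t. (complex_of_real (Q t) - lam) * f t) has_integral (f' v - f' u)) {u..v}"
    using assms uv unfolding sl_solution_def by auto
  from has_integral_linear[OF this bounded_linear_cnj]
  show "((\<lambda>t. (complex_of_real (Q t) - cnj lam) * cnj (f t)) has_integral (cnj (f' v) - cnj (f' u))) {u..v}"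
    by (simp add: o_def)
qed

lemma sl_solution_reflect:
  assumes f: "sl_solution (\<lambda>x. Q (- x)) lam {0..} f f'"
  shows "sl_solution Q lam {..0} (\<lambda>x. f (- x)) (\<lambda>x. - f' (- x))"
  unfolding sl_solution_def
proof (intro conjI ballI impI)
  show "is_interval {..0::real}" by (simp add: is_interval_ic)
  fix x :: real assume x: "x \<in> {..0}"
  have im: "uminus ` {..0::real} = {0..}"
  proof (intro equalityI subsetI)
    fix t :: real assume "t \<in> {0..}"
    then show "t \<in> uminus ` {..0}" by (intro image_eqI[of _ _ "- t"]) auto
  qed auto
  have "(f has_vector_derivative f' (-x)) (at (- x) within uminus ` {..0})"
    using f x unfolding sl_solution_def im by auto
  moreover have "(uminus has_vector_derivative (-1::real)) (at x within {..0})"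
    by (auto intro!: derivative_eq_intros)
  ultimately show "((\<lambda>x. f (- x)) has_vector_derivative - f' (- x)) (at x within {..0})"
    using vector_diff_chain_within[of uminus "-1" x "{..0}" f "f' (-x)"] by (simp add: o_def)
next
  fix u v :: real assume uv: "u \<in> {..0}" "v \<in> {..0}" "u \<le> v"
  have "((\<lambda>t. (complex_of_real (Q (- t)) - lam) * f t) has_integral (f' (-u) - f' (-v))) {-v..-u}"
    using f uv unfolding sl_solution_def by auto
  then have "((\<lambda>t. (complex_of_real (Q (- (- t))) - lam) * f (- t)) has_integral (f' (-u) - f' (-v))) {- (- u)..- (- v)}"
    by (subst has_integral_reflect_real)
  then show "((\<lambda>t. (complex_of_real (Q t) - lam) * f (- t)) has_integral - f' (- v) - - f' (- u)) {u..v}"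
    by simp
qed

lemma sl_solution_glue:
  assumes f: "sl_solution Q lam {0..} f f'" and g: "sl_solution Q lam {..0} g g'"
    and eq: "f 0 = g 0" "f' 0 = g' 0"
  shows "sl_solution Q lam UNIV (\<lambda>x. if x \<in> {0..} then f x else g x) (\<lambda>x. if x \<in> {0..} then f' x else g' x)"
  unfolding sl_solution_def
proof (intro conjI ballI impI)
  fix x :: real
  have cl: "{0..} \<union> closure {0..} \<inter> closure {..0} = {0::real..}" "{..0} \<union> closure {0..} \<inter> closure {..0} = {..0::real}"
    by auto
  show "((\<lambda>x. if x \<in> {0..} then f x else g x) has_vector_derivative (if x \<in> {0..} then f' x else g' x)) (at x within UNIV)"
  proof (rule has_vector_derivative_If_within_closures[where T="{..0}"])
    show "x \<in> {0..} \<union> closure {0..} \<inter> closure {..0} \<Longrightarrow>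
      (f has_vector_derivative f' x) (at x within {0..} \<union> closure {0..} \<inter> closure {..0})"
      unfolding cl using f by (simp add: sl_solution_def)
    show "x \<in> {..0} \<union> closure {0..} \<inter> closure {..0} \<Longrightarrow>
      (g has_vector_derivative g' x) (at x within {..0} \<union> closure {0..} \<inter> closure {..0})"
      unfolding cl using g by (simp add: sl_solution_def)
  qed (use eq in auto)
next
  let ?h = "\<lambda>t. (complex_of_real (Q t) - lam) * (if t \<in> {0..} then f t else g t)"
  let ?d = "\<lambda>t. if t \<in> {0..} then f' t else g' t"
  have pos: "(?h has_integral (?d v - ?d u)) {u..v}" if "0 \<le> u" "u \<le> v" for u v
  proof -
    have "((\<lambda>t. (complex_of_real (Q t) - lam) * f t) has_integral (f' v - f' u)) {u..v}"
      using f that by (simp add: sl_solution_def)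
    then have "(?h has_integral (f' v - f' u)) {u..v}"
      by (rule has_integral_eq[rotated]) (use that in auto)
    then show ?thesis using that by simp
  qed
  have neg: "(?h has_integral (?d v - ?d u)) {u..v}" if "v \<le> 0" "u \<le> v" for u v
  proof -
    have "((\<lambda>t. (complex_of_real (Q t) - lam) * g t) has_integral (g' v - g' u)) {u..v}"
      using g that by (simp add: sl_solution_def)
    then have "(?h has_integral (g' v - g' u)) {u..v}"
    proof (rule has_integral_eq[rotated])
      fix x assume "x \<in> {u..v}"
      then have "x = 0 \<or> x < 0" using that by auto
      then show "(complex_of_real (Q x) - lam) * g x = ?h x" using eq by auto
    qed
    then show ?thesis using that eq by (smt (verit) atLeast_iff)
  qed
  fix u v :: real assume "u \<le> v"
  consider "0 \<le> u" | "v \<le> 0" | "u < 0" "0 < v" by linarith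
  then show "(?h has_integral (?d v - ?d u)) {u..v}"
  proof cases
    case 3
    have "(?h has_integral ((?d 0 - ?d u) + (?d v - ?d 0))) {u..v}"
      using 3 by (intro has_integral_combine[OF _ _ neg pos]) auto
    then show ?thesis by simp
  qed (use pos neg \<open>u \<le> v\<close> in blast)+
qed auto

lemma sl_solution_exists_line:
  assumes Q: "loc_int UNIV Q"
  shows "\<exists>y y'. sl_solution Q lam UNIV y y' \<and> y 0 = y0 \<and> y' 0 = y1"
proof -
  have Qr: "(\<lambda>x. Q (- x)) absolutely_integrable_on {0..T}" for T
  proof -
    have "(\<lambda>x. Q (- x)) absolutely_integrable_on {- 0..- (- T)}"
      by (subst absolutely_integrable_reflect_real) (use Q in \<open>simp add: loc_int_def\<close>)
    then show ?thesis by simp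
  qed
  obtain f f' where f: "sl_solution Q lam {0..} f f'" "f 0 = y0" "f' 0 = y1"
    using sl_solution_exists_half_line[of Q lam y0 y1] Q by (auto simp: loc_int_def)
  \<comment> \<open>The reflection x to -x changes the sign of the derivative, so the reflected
    problem starts with \<open>- y1\<close>.\<close>
  obtain g g' where g: "sl_solution (\<lambda>x. Q (- x)) lam {0..} g g'" "g 0 = y0" "g' 0 = - y1"
    using sl_solution_exists_half_line[OF Qr] by blast
  show ?thesis
    using sl_solution_glue[OF f(1) sl_solution_reflect[OF g(1)]] f g
    by (intro exI conjI) (assumption | simp)+
qed

text \<open>Both functions are the same combination of a basis of solutions. The two choices of
  \<open>S\<close> are the domains on which existence of such a basis has been established.\<close>

lemma sl_solution_unique:
  assumes y: "sl_solution Q lam S y y'" "sl_solution Q lam S z z'" "y 0 = z 0" "y' 0 = z' 0"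
    and Q: "loc_int S Q" and S: "S = UNIV \<or> S = {0..}" and x: "x \<in> S"
  shows "y x = z x" "y' x = z' x"
proof -
  have ex: "\<exists>f f'. sl_solution Q lam S f f' \<and> f 0 = y0 \<and> f' 0 = y1" for y0 y1
    using S
  proof
    assume "S = UNIV" then show ?thesis using sl_solution_exists_line Q by blast
  next
    assume S: "S = {0..}"
    have "Q absolutely_integrable_on {0..T}" for T
      using Q S by (cases "T \<ge> 0") (auto simp: loc_int_def)
    then show ?thesis using S sl_solution_exists_half_line by blast
  qed
  obtain th th' where th: "sl_solution Q lam S th th'" "th 0 = 1" "th' 0 = 0" using ex by blast
  obtain ph ph' where ph: "sl_solution Q lam S ph ph'" "ph 0 = 0" "ph' 0 = 1" using ex by blast
  have "0 \<in> S" using S by auto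
  note e = sl_solution_expand[OF _ th ph Q this x]
  show "y x = z x" using e(1)[OF y(1)] e(1)[OF y(2)] y by simp
  show "y' x = z' x" using e(2)[OF y(1)] e(2)[OF y(2)] y by simp
qed

text \<open>\<open>fund_sol\<close> is a definite description, so its properties become available
  only after existence and uniqueness on the whole line, where equality of the pairs of functions is
  meant at every point.\<close>

lemma fund_sol_works:
  assumes Q: "loc_int UNIV Q"
  shows "sl_solution Q lam UNIV (fst (fund_sol Q lam y0 y1)) (snd (fund_sol Q lam y0 y1))"
    "fst (fund_sol Q lam y0 y1) 0 = y0" "snd (fund_sol Q lam y0 y1) 0 = y1"
proof -
  have "\<exists>!p. sl_solution Q lam UNIV (fst p) (snd p) \<and> fst p 0 = y0 \<and> snd p 0 = y1"
  proof (rule ex_ex1I)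
    show "\<exists>p. sl_solution Q lam UNIV (fst p) (snd p) \<and> fst p 0 = y0 \<and> snd p 0 = y1"
      using sl_solution_exists_line[OF Q, of lam y0 y1] by auto
    fix p r assume p: "sl_solution Q lam UNIV (fst p) (snd p) \<and> fst p 0 = y0 \<and> snd p 0 = y1"
      and r: "sl_solution Q lam UNIV (fst r) (snd r) \<and> fst r 0 = y0 \<and> snd r 0 = y1"
    have "fst p x = fst r x" "snd p x = snd r x" for x
      using sl_solution_unique[of Q lam UNIV "fst p" "snd p" "fst r" "snd r" x] p r Q by auto
    then show "p = r" by (auto simp: prod_eq_iff)
  qed
  from theI'[OF this]
  show "sl_solution Q lam UNIV (fst (fund_sol Q lam y0 y1)) (snd (fund_sol Q lam y0 y1))"
    "fst (fund_sol Q lam y0 y1) 0 = y0" "snd (fund_sol Q lam y0 y1) 0 = y1"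
    unfolding fund_sol_def by blast+
qed

text \<open>Gronwall's inequality for |y| + |y'|. The bound involves \<open>R\<close> in place of
  |lam|, so one constant serves a whole disc of spectral parameters; both the difference quotients
  in \<open>lam\<close> and the local bounds for Bloch solutions rely on this.\<close>

lemma sl_solution_bound:
  assumes y: "sl_solution Q lam {0..} y y'" and Q: "loc_int {0..} Q" and R: "cmod lam \<le> R" and t: "t \<in> {0..T}"
  shows "cmod (y t) + cmod (y' t) \<le> (cmod (y 0) + cmod (y' 0)) * (2 * exp (4 * integral {0..T} (\<lambda>s. 1 + \<bar>Q s\<bar> + R)))"
proof -
  define g where "g s = 1 + \<bar>Q s\<bar> + R" for s
  define N where "N s = cmod (y s) + cmod (y' s)" for s
  have R0: "R \<ge> 0" using R norm_ge_zero order_trans by blast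
  have Qi: "Q absolutely_integrable_on {0..T}" using Q t by (auto simp: loc_int_def)
  note ac = sl_solution_ac_prim[OF y _ Qi]
  have ac: "ac_prim 0 T y y'" "ac_prim 0 T y' (\<lambda>t. (complex_of_real (Q t) - lam) * y t)"
    by (rule ac; auto)+
  have contN: "continuous_on {0..T} N"
    unfolding N_def by (intro continuous_intros ac_prim_continuous[OF ac(1)] ac_prim_continuous[OF ac(2)])
  have gai: "g absolutely_integrable_on {0..T}"
    unfolding g_def using Qi by (intro set_integral_add(1) absolutely_integrable_on_const) (auto simp: absolutely_integrable_abs_iff)
  have gNi: "(\<lambda>s. g s * N s) integrable_on {0..T}"
    by (intro abs_int_integrable abs_int_mult_continuous gai contN)
  have "N t \<le> 2 * N 0 * exp (4 * integral {0..t} g)"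
  proof (rule gronwall[where g=g and f=N and a=0 and b=T])
    fix x assume x: "x \<in> {0..T}"
    have i: "k integrable_on {0..x}" if "k integrable_on {0..T}" for k :: "real \<Rightarrow> 'b::euclidean_space"
      using that x integrable_on_subinterval by fastforce
    have yi: "y' integrable_on {0..x}" "(\<lambda>t. (complex_of_real (Q t) - lam) * y t) integrable_on {0..x}"
      by (intro i abs_int_integrable ac_primD(1)[OF ac(1)] ac_primD(1)[OF ac(2)])+
    have ni: "(\<lambda>s. cmod (y' s)) integrable_on {0..x}" "(\<lambda>s. (\<bar>Q s\<bar> + R) * cmod (y s)) integrable_on {0..x}"
    proof -
      show "(\<lambda>s. cmod (y' s)) integrable_on {0..x}"
        by (intro i abs_int_norm_integrable ac_primD(1)[OF ac(1)])
      show "(\<lambda>s. (\<bar>Q s\<bar> + R) * cmod (y s)) integrable_on {0..x}"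
        using Qi by (intro i abs_int_integrable abs_int_mult_continuous set_integral_add(1) absolutely_integrable_on_const
            continuous_intros ac_prim_continuous[OF ac(1)]) (auto simp: absolutely_integrable_abs_iff)
    qed
    have "y x = y 0 + integral {0..x} y'" using ac_primD(2)[OF ac(1), of 0 x] x by simp
    then have "cmod (y x) \<le> cmod (y 0) + cmod (integral {0..x} y')"
      by (metis norm_triangle_ineq)
    also have "cmod (integral {0..x} y') \<le> integral {0..x} (\<lambda>s. cmod (y' s))"
      by (rule integral_norm_bound_integral[OF yi(1) ni(1)]) simp
    finally have 1: "cmod (y x) \<le> cmod (y 0) + integral {0..x} (\<lambda>s. cmod (y' s))" by simp
    have "y' x = y' 0 + integral {0..x} (\<lambda>t. (complex_of_real (Q t) - lam) * y t)" using ac_primD(2)[OF ac(2), of 0 x] x by simp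
    then have "cmod (y' x) \<le> cmod (y' 0) + cmod (integral {0..x} (\<lambda>t. (complex_of_real (Q t) - lam) * y t))"
      by (metis norm_triangle_ineq)
    also have "cmod (integral {0..x} (\<lambda>t. (complex_of_real (Q t) - lam) * y t)) \<le> integral {0..x} (\<lambda>s. (\<bar>Q s\<bar> + R) * cmod (y s))"
    proof (rule integral_norm_bound_integral[OF yi(2) ni(2)])
      fix s show "cmod ((complex_of_real (Q s) - lam) * y s) \<le> (\<bar>Q s\<bar> + R) * cmod (y s)"
        using norm_triangle_ineq4[of "complex_of_real (Q s)" lam] R
        unfolding norm_mult by (intro mult_right_mono) auto
    qed
    finally have 2: "cmod (y' x) \<le> cmod (y' 0) + integral {0..x} (\<lambda>s. (\<bar>Q s\<bar> + R) * cmod (y s))" by simp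
    have "integral {0..x} (\<lambda>s. cmod (y' s)) + integral {0..x} (\<lambda>s. (\<bar>Q s\<bar> + R) * cmod (y s)) =
       integral {0..x} (\<lambda>s. cmod (y' s) + (\<bar>Q s\<bar> + R) * cmod (y s))"
      by (rule Henstock_Kurzweil_Integration.integral_add[symmetric, OF ni])
    also have "\<dots> \<le> integral {0..x} (\<lambda>s. g s * N s)"
    proof (rule integral_le)
      fix s
      have "cmod (y' s) * (1 + (\<bar>Q s\<bar> + R)) \<ge> cmod (y' s) * 1"
        using R0 by (intro mult_left_mono) auto
      then show "cmod (y' s) + (\<bar>Q s\<bar> + R) * cmod (y s) \<le> g s * N s"
        by (simp add: g_def N_def algebra_simps)
    qed (intro integrable_add ni i gNi)+
    finally show "N x \<le> N 0 + integral {0..x} (\<lambda>s. g s * N s)" using 1 2 by (simp add: N_def)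
  qed (use t contN R0 abs_int_integrable[OF gai] in \<open>auto simp: g_def N_def\<close>)
  also have "\<dots> \<le> N 0 * (2 * exp (4 * integral {0..T} g))"
  proof -
    have "g integrable_on {0..t}" using abs_int_integrable[OF gai] t integrable_on_subinterval by fastforce
    then have "integral {0..t} g \<le> integral {0..T} g"
      by (rule integral_subset_le[rotated]) (use t R0 abs_int_integrable[OF gai] in \<open>auto simp: g_def\<close>)
    then have "2 * N 0 * exp (4 * integral {0..t} g) \<le> 2 * N 0 * exp (4 * integral {0..T} g)"
      by (intro mult_left_mono) (auto simp: N_def)
    then show ?thesis by simp
  qed
  finally show ?thesis by (simp add: N_def g_def[abs_def])
qed

lemma abs_int_shift:
  fixes f :: "real \<Rightarrow> real"
  assumes "f absolutely_integrable_on {u..v}"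
  shows "(\<lambda>x. f (x + c)) absolutely_integrable_on {u - c..v - c}"
proof -
  have *: "(\<lambda>x. h (x + c)) integrable_on {u - c..v - c}" if h: "h integrable_on {u..v}" for h :: "real \<Rightarrow> real"
  proof -
    obtain I where "(h has_integral I) (cbox u v)" using h by (auto simp: integrable_on_def)
    from has_integral_affinity'[OF this, of 1 c] show ?thesis by (auto simp: integrable_on_def)
  qed
  show ?thesis
    using *[OF abs_int_integrable[OF assms]] *[OF abs_int_norm_integrable[OF assms]]
    by (simp add: absolutely_integrable_on_def)
qed

lemma periodic_loc_int:
  assumes per: "\<forall>x. q (x + a) = q x" and q: "q absolutely_integrable_on {0..a}" and a: "a > 0"
  shows "loc_int UNIV q"
proof -
  have per': "q (x + real n * a) = q x" for x n
  proof (induction n)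
    case (Suc n)
    have "q (x + real (Suc n) * a) = q ((x + real n * a) + a)" by (simp add: algebra_simps)
    also have "\<dots> = q x" using per Suc by simp
    finally show ?case .
  qed simp
  have pos: "q absolutely_integrable_on {0..real n * a}" for n
  proof (induction n)
    case (Suc n)
    have "(\<lambda>x. q (x + (- (real n * a)))) absolutely_integrable_on {0 - (- (real n * a))..a - (- (real n * a))}"
      by (rule abs_int_shift[OF q])
    moreover have "q (x + (- (real n * a))) = q x" for x
      using per'[of "x + (- (real n * a))" n] by simp
    ultimately have "q absolutely_integrable_on {real n * a..real (Suc n) * a}"
      by (simp add: algebra_simps)
    then show ?case
      using a by (intro absolutely_integrable_on_combine[OF Suc.IH]) (auto intro: mult_right_mono)
  next
    case 0 then show ?case using absolutely_integrable_on_subinterval[OF q, of 0 0] a by simp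
  qed
  \<comment> \<open>The symmetric interval is the translate by \<open>n\<close> periods of an
    interval that starts at 0.\<close>
  have neg: "q absolutely_integrable_on {- (real n * a)..real n * a}" for n
  proof -
    have "(\<lambda>x. q (x + real n * a)) absolutely_integrable_on {0 - real n * a..real (2 * n) * a - real n * a}"
      by (rule abs_int_shift[OF pos])
    then show ?thesis by (simp add: per' mult.commute[of a])
  qed
  show ?thesis unfolding loc_int_def
  proof (intro ballI)
    fix u v :: real
    obtain n where n: "real n * a > max \<bar>u\<bar> \<bar>v\<bar>" using reals_Archimedean3[OF a] by blast
    show "q absolutely_integrable_on {u..v}"
      by (rule absolutely_integrable_on_subinterval[OF neg[of n]]) (use n in auto)
  qed
qed

section \<open>Analytic dependence on the spectral parameter\<close>

lemma integral_mult_bound: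
  fixes f g :: "real \<Rightarrow> complex"
  assumes "continuous_on {0..t} f" "continuous_on {0..t} g" "t \<ge> 0"
    and "\<And>s. s \<in> {0..t} \<Longrightarrow> cmod (f s) \<le> A" "\<And>s. s \<in> {0..t} \<Longrightarrow> cmod (g s) \<le> B"
  shows "cmod (integral {0..t} (\<lambda>s. f s * g s)) \<le> t * (A * B)"
proof -
  have "cmod (integral {0..t} (\<lambda>s. f s * g s)) \<le> integral {0..t} (\<lambda>s. A * B)"
  proof (rule integral_norm_bound_integral)
    show "(\<lambda>s. f s * g s) integrable_on {0..t}"
      by (intro integrable_continuous_real continuous_intros assms)
    fix s assume s: "s \<in> {0..t}"
    have "0 \<le> A" using assms(4)[OF s] norm_ge_zero order_trans by blast
    then show "cmod (f s * g s) \<le> A * B"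
      using assms(4,5)[OF s] by (simp add: norm_mult mult_mono)
  qed auto
  then show ?thesis using assms(3) by (simp add: mult_ac)
qed

text \<open>Green's identity expresses the difference quotient in the spectral parameter through
  integrals of products of solutions.\<close>
lemma sl_family_holomorphic:
  assumes fam: "\<And>lam. sl_solution Q lam {0..} (y lam) (y' lam)"
    and init: "\<And>lam. y lam 0 = y0" "\<And>lam. y' lam 0 = y1"
    and Q: "loc_int {0..} Q" and x: "x \<ge> 0"
  shows "(\<lambda>lam. y lam x) holomorphic_on UNIV" "(\<lambda>lam. y' lam x) holomorphic_on UNIV"
proof -
  have Qi: "Q absolutely_integrable_on {0..T}" for T
    using Q by (cases "T \<ge> 0") (auto simp: loc_int_def)
  have "(\<lambda>lam. y lam x) field_differentiable at lam0 \<and> (\<lambda>lam. y' lam x) field_differentiable at lam0" for lam0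
  proof -
    obtain th th' where th: "sl_solution Q lam0 {0..} th th'" "th 0 = 1" "th' 0 = 0"
      using sl_solution_exists_half_line[OF Qi] by blast
    obtain ph ph' where ph: "sl_solution Q lam0 {0..} ph ph'" "ph 0 = 0" "ph' 0 = 1"
      using sl_solution_exists_half_line[OF Qi] by blast
    have cont: "continuous_on {0..t} f" if "sl_solution Q lam {0..} f f'" for f f' t lam
      by (rule ac_prim_continuous[OF sl_solution_ac_prim(1)[OF that _ Qi]]) auto
    define I where "I f t \<mu> = integral {0..t} (\<lambda>s. y \<mu> s * f s)" for f t \<mu>
    have green: "wronsk (y \<mu> t) (y' \<mu> t) (g t) (g' t) = wronsk y0 y1 (g 0) (g' 0) + (lam0 - \<mu>) * I g t \<mu>"
      if g: "sl_solution Q lam0 {0..} g g'" and t: "t \<ge> 0" for g g' t \<mu>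
    proof -
      have "ac_prim 0 t (\<lambda>x. wronsk (y \<mu> x) (y' \<mu> x) (g x) (g' x))
           (\<lambda>x. (of_real (Q x - Q x) - \<mu> + lam0) * (y \<mu> x * g x))"
        by (rule wronsk_ac_prim[OF fam g]) (use Qi in auto)
      from ac_primD(2)[OF this, of 0 t] t init show ?thesis
        by (simp add: I_def diff_eq_eq add.commute)
    qed
    have w1: "th t * ph' t - th' t * ph t = 1" if "t \<ge> 0" for t
      using wronsk_constant[OF th(1) ph(1) Q, of 0 t] th ph that by (simp add: wronsk_def algebra_simps)
    \<comment> \<open>Green's identities with \<open>th\<close> and with \<open>ph\<close> form a
      linear system for the increments of \<open>y\<close> and \<open>y'\<close>; its determinant is
      the Wronskian of the two, equal to 1.\<close>
    have diff: "y \<mu> t - y lam0 t = (lam0 - \<mu>) * (ph t * I th t \<mu> - th t * I ph t \<mu>)"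
       "y' \<mu> t - y' lam0 t = (lam0 - \<mu>) * (ph' t * I th t \<mu> - th' t * I ph t \<mu>)" if t: "t \<ge> 0" for t \<mu>
    proof -
      define d d' where "d = y \<mu> t - y lam0 t" and "d' = y' \<mu> t - y' lam0 t"
      have A: "d' * th t - d * th' t = (lam0 - \<mu>) * I th t \<mu>"
      proof -
        have "d' * th t - d * th' t = wronsk (y \<mu> t) (y' \<mu> t) (th t) (th' t) - wronsk (y lam0 t) (y' lam0 t) (th t) (th' t)"
          by (simp add: wronsk_def d_def d'_def algebra_simps)
        then show ?thesis by (simp add: green[OF th(1) t])
      qed
      have B: "d' * ph t - d * ph' t = (lam0 - \<mu>) * I ph t \<mu>"
      proof -
        have "d' * ph t - d * ph' t = wronsk (y \<mu> t) (y' \<mu> t) (ph t) (ph' t) - wronsk (y lam0 t) (y' lam0 t) (ph t) (ph' t)"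
          by (simp add: wronsk_def d_def d'_def algebra_simps)
        then show ?thesis by (simp add: green[OF ph(1) t])
      qed
      have "(d' * th t - d * th' t) * ph t - (d' * ph t - d * ph' t) * th t = d * (th t * ph' t - th' t * ph t)"
           "(d' * th t - d * th' t) * ph' t - (d' * ph t - d * ph' t) * th' t = d' * (th t * ph' t - th' t * ph t)"
        by (simp_all add: algebra_simps)
      then have "(lam0 - \<mu>) * I th t \<mu> * ph t - (lam0 - \<mu>) * I ph t \<mu> * th t = d"
        "(lam0 - \<mu>) * I th t \<mu> * ph' t - (lam0 - \<mu>) * I ph t \<mu> * th' t = d'"
        unfolding A B w1[OF t] by simp_all
      then show "y \<mu> t - y lam0 t = (lam0 - \<mu>) * (ph t * I th t \<mu> - th t * I ph t \<mu>)"
        "y' \<mu> t - y' lam0 t = (lam0 - \<mu>) * (ph' t * I th t \<mu> - th' t * I ph t \<mu>)"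
        by (simp_all add: d_def d'_def algebra_simps)
    qed
    \<comment> \<open>A common bound on {0..x} for \<open>y \<mu>\<close>, \<open>th\<close> and
      \<open>ph\<close> over the disc of radius 1 about \<open>lam0\<close>. The 1 in the first
      factor covers the initial data of \<open>th\<close> and \<open>ph\<close>, the other one the
      radius of the disc.\<close>
    define K where "K = (cmod y0 + cmod y1 + 1) * (2 * exp (4 * integral {0..x} (\<lambda>s. 1 + \<bar>Q s\<bar> + (cmod lam0 + 1))))"
    have bnd: "cmod (f t) \<le> K" if f: "sl_solution Q lam {0..} f f'" and n: "cmod (f 0) + cmod (f' 0) \<le> cmod y0 + cmod y1 + 1"
      and l: "cmod lam \<le> cmod lam0 + 1" and t: "t \<in> {0..x}" for f f' lam t
    proof -
      have "cmod (f t) \<le> cmod (f t) + cmod (f' t)" by simp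
      also have "\<dots> \<le> (cmod (f 0) + cmod (f' 0)) * (2 * exp (4 * integral {0..x} (\<lambda>s. 1 + \<bar>Q s\<bar> + (cmod lam0 + 1))))"
        by (rule sl_solution_bound[OF f Q l t])
      also have "\<dots> \<le> K" unfolding K_def using n by (intro mult_right_mono) auto
      finally show ?thesis .
    qed
    have near: "cmod \<mu> \<le> cmod lam0 + 1" if "cmod (\<mu> - lam0) \<le> 1" for \<mu>
      using norm_triangle_ineq2[of \<mu> lam0] that by linarith
    have yb: "cmod (y \<mu> t) \<le> K" if "cmod (\<mu> - lam0) \<le> 1" "t \<in> {0..x}" for \<mu> t
      by (rule bnd[OF fam]) (use init that near in auto)
    have thb: "cmod (th t) \<le> K" if "t \<in> {0..x}" for t by (rule bnd[OF th(1)]) (use th that in auto)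
    have phb: "cmod (ph t) \<le> K" if "t \<in> {0..x}" for t by (rule bnd[OF ph(1)]) (use ph that in auto)
    have K0: "K \<ge> 0" by (simp add: K_def)
    have Ib: "cmod (I f t \<mu>) \<le> x * (K * K)"
      if "continuous_on {0..t} f" "\<And>s. s \<in> {0..x} \<Longrightarrow> cmod (f s) \<le> K" "cmod (\<mu> - lam0) \<le> 1" "t \<in> {0..x}" for f t \<mu>
    proof -
      have "cmod (I f t \<mu>) \<le> t * (K * K)"
        unfolding I_def by (rule integral_mult_bound[OF cont[OF fam] that(1)]) (use that yb in auto)
      also have "\<dots> \<le> x * (K * K)" using that K0 by (intro mult_right_mono) auto
      finally show ?thesis .
    qed
    \<comment> \<open>Boundedness already yields a Lipschitz estimate in the parameter. It makes the
      integrals \<open>I\<close> continuous at \<open>lam0\<close>, and the difference quotient then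
      converges.\<close>
    have db: "cmod (y \<mu> t - y lam0 t) \<le> cmod (\<mu> - lam0) * (2 * K * (x * (K * K)))"
      if m: "cmod (\<mu> - lam0) \<le> 1" and t: "t \<in> {0..x}" for \<mu> t
    proof -
      have "cmod (ph t * I th t \<mu> - th t * I ph t \<mu>) \<le> cmod (ph t) * cmod (I th t \<mu>) + cmod (th t) * cmod (I ph t \<mu>)"
        by (metis norm_mult norm_triangle_ineq4)
      also have "\<dots> \<le> K * (x * (K * K)) + K * (x * (K * K))"
        using t m K0 by (intro add_mono mult_mono thb phb Ib cont[OF th(1)] cont[OF ph(1)]) auto
      finally have "cmod (ph t * I th t \<mu> - th t * I ph t \<mu>) \<le> 2 * K * (x * (K * K))" by (simp add: mult_ac)
      then show ?thesis using diff(1)[of t \<mu>] t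
        by (simp add: norm_mult norm_minus_commute mult_left_mono)
    qed
    have lim: "((\<lambda>\<mu>. I f x \<mu>) \<longlongrightarrow> I f x lam0) (at lam0)"
      if c: "continuous_on {0..x} f" and f: "\<And>s. s \<in> {0..x} \<Longrightarrow> cmod (f s) \<le> K" for f
    proof -
      define M where "M = x * ((2 * K * (x * (K * K))) * K)"
      have "cmod (I f x \<mu> - I f x lam0) \<le> cmod (\<mu> - lam0) * M" if "cmod (\<mu> - lam0) \<le> 1" for \<mu>
      proof -
        have "I f x \<mu> - I f x lam0 = integral {0..x} (\<lambda>s. (y \<mu> s - y lam0 s) * f s)"
          unfolding I_def left_diff_distrib
          by (intro Henstock_Kurzweil_Integration.integral_diff[symmetric] integrable_continuous_real continuous_intros c cont[OF fam])
        also have "cmod \<dots> \<le> x * ((cmod (\<mu> - lam0) * (2 * K * (x * (K * K)))) * K)"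
          by (rule integral_mult_bound) (use c x f db that in \<open>auto intro!: continuous_intros cont[OF fam]\<close>)
        finally show ?thesis by (simp add: M_def mult_ac)
      qed
      then have ev: "\<forall>\<^sub>F \<mu> in at lam0. norm (I f x \<mu> - I f x lam0) \<le> cmod (\<mu> - lam0) * M"
        unfolding eventually_at by (intro exI[of _ 1]) (auto simp: dist_norm)
      have "((\<lambda>\<mu>. cmod (\<mu> - lam0) * M) \<longlongrightarrow> 0) (at lam0)"
        by (auto intro!: tendsto_eq_intros)
      then have "((\<lambda>\<mu>. I f x \<mu> - I f x lam0) \<longlongrightarrow> 0) (at lam0)"
        by (rule Lim_null_comparison[OF ev])
      then show ?thesis by (rule LIM_zero_cancel)
    qed
    have l1: "((\<lambda>\<mu>. I th x \<mu>) \<longlongrightarrow> I th x lam0) (at lam0)" by (rule lim[OF cont[OF th(1)] thb])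
    have l2: "((\<lambda>\<mu>. I ph x \<mu>) \<longlongrightarrow> I ph x lam0) (at lam0)" by (rule lim[OF cont[OF ph(1)] phb])
    have "((\<lambda>\<mu>. y \<mu> x) has_field_derivative - (ph x * I th x lam0 - th x * I ph x lam0)) (at lam0)"
      unfolding has_field_derivative_iff
    proof (rule Lim_transform_eventually)
      show "((\<lambda>\<mu>. - (ph x * I th x \<mu> - th x * I ph x \<mu>)) \<longlongrightarrow> - (ph x * I th x lam0 - th x * I ph x lam0)) (at lam0)"
        by (intro tendsto_intros l1 l2)
      show "\<forall>\<^sub>F \<mu> in at lam0. - (ph x * I th x \<mu> - th x * I ph x \<mu>) = (y \<mu> x - y lam0 x) / (\<mu> - lam0)"
        unfolding diff(1)[OF x] by (auto simp: eventually_at_filter field_simps)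
    qed
    moreover have "((\<lambda>\<mu>. y' \<mu> x) has_field_derivative - (ph' x * I th x lam0 - th' x * I ph x lam0)) (at lam0)"
      unfolding has_field_derivative_iff
    proof (rule Lim_transform_eventually)
      show "((\<lambda>\<mu>. - (ph' x * I th x \<mu> - th' x * I ph x \<mu>)) \<longlongrightarrow> - (ph' x * I th x lam0 - th' x * I ph x lam0)) (at lam0)"
        by (intro tendsto_intros l1 l2)
      show "\<forall>\<^sub>F \<mu> in at lam0. - (ph' x * I th x \<mu> - th' x * I ph x \<mu>) = (y' \<mu> x - y' lam0 x) / (\<mu> - lam0)"
        unfolding diff(2)[OF x] by (auto simp: eventually_at_filter field_simps)
    qed
    ultimately show ?thesis unfolding field_differentiable_def by blast
  qed
  then show "(\<lambda>lam. y lam x) holomorphic_on UNIV" "(\<lambda>lam. y' lam x) holomorphic_on UNIV"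
    by (auto simp: holomorphic_on_def)
qed

section \<open>The quasi-momentum on the spectrum\<close>

text \<open>At the parameter -\<kappa>^2 the free operator factors: without \<open>q\<close>,
  \<open>f\<close> would be a multiple of exp(\<kappa> x) and \<open>g\<close> of exp(-\<kappa> x).
  With \<open>q\<close>, the functions exp(-\<kappa> x) f and exp(\<kappa> x) g have derivatives
  \<open>q * y\<close> times the same exponentials. Since 2 \<kappa> y = f - g, Gronwall's
  inequality closes the estimate for exp(-\<kappa> x) |y|. The factor 1/\<kappa> in \<open>M\<close>
  is what later makes the error in the discriminant small.\<close>

lemma exponential_growth:
  fixes q :: "real \<Rightarrow> real"
  assumes k: "\<kappa> \<ge> 1" and a: "a \<ge> 0" and y: "sl_solution q (of_real (- \<kappa>\<^sup>2)) UNIV y y'" and q: "loc_int UNIV q"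
  defines "N \<equiv> integral {0..a} (\<lambda>t. \<bar>q t\<bar>)"
  defines "f \<equiv> \<lambda>x. y' x + of_real \<kappa> * y x" and "g \<equiv> \<lambda>x. y' x - of_real \<kappa> * y x"
  defines "M \<equiv> (cmod (f 0) + cmod (g 0)) / (2 * \<kappa>)"
  shows "cmod (of_real (exp (- \<kappa> * a)) * f a - f 0) \<le> N * (M * (2 * exp (4 * N)))"
    and "cmod (of_real (exp (- \<kappa> * a)) * g a - of_real (exp (- 2 * \<kappa> * a)) * g 0) \<le> N * (M * (2 * exp (4 * N)))"
proof -
  have qi: "q absolutely_integrable_on {0..a}" using q by (simp add: loc_int_def)
  have yac: "ac_prim 0 a y y'" "ac_prim 0 a y' (\<lambda>t. (complex_of_real (q t) - of_real (- \<kappa>\<^sup>2)) * y t)"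
    by (rule sl_solution_ac_prim[OF y _ qi]; simp)+
  define e1 where "e1 x = complex_of_real (exp (- \<kappa> * x))" for x
  define e2 where "e2 x = complex_of_real (exp (\<kappa> * x))" for x
  have e1: "ac_prim 0 a e1 (\<lambda>x. - of_real \<kappa> * e1 x)"
    unfolding e1_def
    by (rule ac_prim_C1)
       (auto intro!: derivative_eq_intros continuous_intros has_vector_derivative_of_real simp: has_real_derivative_iff_has_vector_derivative[symmetric])
  have e2: "ac_prim 0 a e2 (\<lambda>x. of_real \<kappa> * e2 x)"
    unfolding e2_def
    by (rule ac_prim_C1)
       (auto intro!: derivative_eq_intros continuous_intros has_vector_derivative_of_real simp: has_real_derivative_iff_has_vector_derivative[symmetric])
  have F: "ac_prim 0 a (\<lambda>x. e1 x * f x) (\<lambda>x. e1 x * (of_real (q x) * y x))"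
    by (rule ac_prim_cong[OF ac_prim_mult[OF e1 ac_prim_add[OF yac(2) ac_prim_cmult[OF yac(1), of "of_real \<kappa>"]]]])
       (simp_all add: f_def algebra_simps power2_eq_square)
  have G: "ac_prim 0 a (\<lambda>x. e2 x * g x) (\<lambda>x. e2 x * (of_real (q x) * y x))"
    by (rule ac_prim_cong[OF ac_prim_mult[OF e2 ac_prim_diff[OF yac(2) ac_prim_cmult[OF yac(1), of "of_real \<kappa>"]]]])
       (simp_all add: g_def algebra_simps power2_eq_square)
  define h where "h t = exp (- \<kappa> * t) * cmod (y t)" for t
  have hc: "continuous_on {0..a} h" unfolding h_def by (intro continuous_intros ac_prim_continuous[OF yac(1)])
  have qai: "(\<lambda>t. \<bar>q t\<bar>) absolutely_integrable_on {0..a}" using qi by (simp add: absolutely_integrable_abs_iff)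
  have qh: "(\<lambda>t. \<bar>q t\<bar> * h t) integrable_on {0..a}"
    by (intro abs_int_integrable abs_int_mult_continuous hc qai)
  define J where "J x = integral {0..x} (\<lambda>t. \<bar>q t\<bar> * h t)" for x
  have sub: "k integrable_on {0..x}" if "k integrable_on {0..a}" "x \<le> a" for x and k :: "real \<Rightarrow> 'b::banach"
    using that integrable_on_subinterval by fastforce
  have B1: "cmod (e1 x * f x - f 0) \<le> J x" if x: "x \<in> {0..a}" for x
  proof -
    have "e1 x * f x - f 0 = integral {0..x} (\<lambda>x. e1 x * (of_real (q x) * y x))"
      using ac_primD(2)[OF F, of 0 x] x by (simp add: e1_def)
    also have "cmod \<dots> \<le> J x" unfolding J_def
    proof (rule integral_norm_bound_integral)
      show "(\<lambda>x. e1 x * (of_real (q x) * y x)) integrable_on {0..x}"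
        by (rule sub[OF abs_int_integrable[OF ac_primD(1)[OF F]]]) (use x in auto)
    qed (use sub[OF qh] x in \<open>auto simp: norm_mult h_def e1_def\<close>)
    finally show ?thesis .
  qed
  \<comment> \<open>Both functions are measured on the scale exp(\<kappa> x). For \<open>g\<close>
    this means multiplying by exp(-2 \<kappa> x) the natural estimate, which is on the scale
    exp(-\<kappa> x).\<close>
  have B2: "cmod (e1 x * g x - of_real (exp (- 2 * \<kappa> * x)) * g 0) \<le> J x" if x: "x \<in> {0..a}" for x
  proof -
    have "e2 x * g x - g 0 = integral {0..x} (\<lambda>x. e2 x * (of_real (q x) * y x))"
      using ac_primD(2)[OF G, of 0 x] x by (simp add: e2_def)
    also have "cmod \<dots> \<le> integral {0..x} (\<lambda>t. exp (2 * \<kappa> * x) * (\<bar>q t\<bar> * h t))"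
    proof (rule integral_norm_bound_integral)
      show "(\<lambda>x. e2 x * (of_real (q x) * y x)) integrable_on {0..x}"
        by (rule sub[OF abs_int_integrable[OF ac_primD(1)[OF G]]]) (use x in auto)
      fix t assume t: "t \<in> {0..x}"
      have "exp (\<kappa> * t) = exp (2 * \<kappa> * t) * exp (- \<kappa> * t)" by (simp flip: exp_add)
      also have "\<dots> \<le> exp (2 * \<kappa> * x) * exp (- \<kappa> * t)" using t k by (intro mult_right_mono) auto
      finally have "exp (\<kappa> * t) * (\<bar>q t\<bar> * cmod (y t)) \<le> exp (2 * \<kappa> * x) * exp (- \<kappa> * t) * (\<bar>q t\<bar> * cmod (y t))"
        by (intro mult_right_mono) auto
      then show "cmod (e2 t * (of_real (q t) * y t)) \<le> exp (2 * \<kappa> * x) * (\<bar>q t\<bar> * h t)"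
        by (simp add: norm_mult h_def e2_def mult_ac)
    qed (use sub[OF qh] x in \<open>auto intro!: integrable_on_mult_right\<close>)
    also have "\<dots> = exp (2 * \<kappa> * x) * J x" by (simp add: J_def)
    finally have *: "cmod (e2 x * g x - g 0) \<le> exp (2 * \<kappa> * x) * J x" .
    have e12: "of_real (exp (- 2 * \<kappa> * x)) * e2 x = e1 x"
      by (simp add: e1_def e2_def flip: of_real_mult exp_add)
    have "e1 x * g x - of_real (exp (- 2 * \<kappa> * x)) * g 0 = of_real (exp (- 2 * \<kappa> * x)) * (e2 x * g x - g 0)"
      by (simp only: right_diff_distrib mult.assoc[symmetric] e12)
    also have "cmod \<dots> = exp (- 2 * \<kappa> * x) * cmod (e2 x * g x - g 0)" by (simp add: norm_mult)
    also have "\<dots> \<le> exp (- 2 * \<kappa> * x) * (exp (2 * \<kappa> * x) * J x)" by (intro mult_left_mono *) auto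
    also have "\<dots> = J x" by (simp add: mult.assoc[symmetric] flip: exp_add)
    finally show ?thesis .
  qed
  have hb: "h x \<le> M + J x" if x: "x \<in> {0..a}" for x
  proof -
    have "2 * of_real \<kappa> * (e1 x * y x) = e1 x * f x - e1 x * g x" by (simp add: f_def g_def algebra_simps)
    also have "\<dots> = (e1 x * f x - f 0) + f 0 - (e1 x * g x - of_real (exp (- 2 * \<kappa> * x)) * g 0) - of_real (exp (- 2 * \<kappa> * x)) * g 0"
      by simp
    also have "cmod \<dots> \<le> cmod (e1 x * f x - f 0) + cmod (f 0) + cmod (e1 x * g x - of_real (exp (- 2 * \<kappa> * x)) * g 0) + cmod (of_real (exp (- 2 * \<kappa> * x)) * g 0)"
      by (intro order_trans[OF norm_triangle_ineq4] add_mono norm_triangle_ineq order_refl)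
    also have "\<dots> \<le> J x + cmod (f 0) + J x + cmod (g 0)"
    proof -
      have "cmod (of_real (exp (- 2 * \<kappa> * x)) * g 0) \<le> 1 * cmod (g 0)"
        unfolding norm_mult using k x by (intro mult_right_mono) auto
      then show ?thesis using B1[OF x] B2[OF x] by linarith
    qed
    finally have "2 * \<kappa> * h x \<le> cmod (f 0) + cmod (g 0) + 2 * J x"
      using k by (simp add: norm_mult h_def e1_def)
    then have "h x \<le> M + J x / \<kappa>" using k by (simp add: M_def field_simps)
    also have "J x / \<kappa> \<le> J x"
    proof -
      have "J x \<ge> 0" using B1[OF x] norm_ge_zero order_trans by blast
      then show ?thesis using k by (simp add: divide_le_eq mult_le_cancel_left1)
    qed
    finally show ?thesis by simp
  qed
  have M0: "M \<ge> 0" using k by (simp add: M_def)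
  have hM: "h x \<le> M * (2 * exp (4 * N))" if x: "x \<in> {0..a}" for x
  proof -
    have "h x \<le> 2 * M * exp (4 * integral {0..x} (\<lambda>t. \<bar>q t\<bar>))"
      by (rule gronwall[where f=h and g="\<lambda>t. \<bar>q t\<bar>" and a=0 and b=a, OF abs_int_integrable[OF qai] _ hc M0])
         (use hb x in \<open>auto simp: J_def\<close>)
    also have "integral {0..x} (\<lambda>t. \<bar>q t\<bar>) \<le> N"
      unfolding N_def by (rule integral_subset_le) (use x sub[OF abs_int_integrable[OF qai]] abs_int_integrable[OF qai] in auto)
    finally show ?thesis using M0 by (simp add: mult_left_mono mult_ac)
  qed
  have Ja: "J a \<le> N * (M * (2 * exp (4 * N)))"
  proof -
    have "J a \<le> integral {0..a} (\<lambda>t. \<bar>q t\<bar> * (M * (2 * exp (4 * N))))"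
      unfolding J_def
      by (rule integral_le[OF qh]) (use hM abs_int_integrable[OF qai] in \<open>auto intro!: integrable_on_mult_left mult_left_mono\<close>)
    then show ?thesis by (simp add: N_def)
  qed
  show "cmod (of_real (exp (- \<kappa> * a)) * f a - f 0) \<le> N * (M * (2 * exp (4 * N)))"
    using B1[of a] Ja a by (simp add: e1_def)
  show "cmod (of_real (exp (- \<kappa> * a)) * g a - of_real (exp (- 2 * \<kappa> * a)) * g 0) \<le> N * (M * (2 * exp (4 * N)))"
    using B2[of a] Ja a by (simp add: e1_def)
qed

text \<open>The discriminant at -\<kappa>^2 is 2 cosh(\<kappa> a) up to an error of order
  exp(\<kappa> a) / \<kappa>. This shows that the periodic spectrum has no points far to the
  left.\<close>

lemma discr_large:
  assumes q: "loc_int UNIV q" and a: "a > 0"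
  shows "\<exists>K. \<forall>\<kappa>\<ge>K. cmod (discr q a (of_real (- \<kappa>\<^sup>2))) > 2"
proof -
  define N where "N = integral {0..a} (\<lambda>t. \<bar>q t\<bar>)"
  define E where "E = N * (2 * exp (4 * N))"
  show ?thesis
  \<comment> \<open>The bound \<open>4 * E\<close> keeps the scaled error at most 1/2, against a
    main term of modulus at least 1. The bound \<open>4 / a\<close> gives exp(\<kappa> a) > 4, so
    half of it exceeds 2.\<close>
  proof (intro exI[of _ "max 1 (max (4 * E) (4 / a))"] allI impI)
    fix \<kappa> assume "\<kappa> \<ge> max 1 (max (4 * E) (4 / a))"
    then have k: "\<kappa> \<ge> 1" "4 * E \<le> \<kappa>" "4 / a \<le> \<kappa>" by auto
    define lam where "lam = complex_of_real (- \<kappa>\<^sup>2)"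
    define th th' where "th = fst (fund_sol q lam 1 0)" and "th' = snd (fund_sol q lam 1 0)"
    define ph ph' where "ph = fst (fund_sol q lam 0 1)" and "ph' = snd (fund_sol q lam 0 1)"
    have th: "sl_solution q lam UNIV th th'" "th 0 = 1" "th' 0 = 0"
      unfolding th_def th'_def using fund_sol_works[OF q] by auto
    have ph: "sl_solution q lam UNIV ph ph'" "ph 0 = 0" "ph' 0 = 1"
      unfolding ph_def ph'_def using fund_sol_works[OF q] by auto
    define e where "e = complex_of_real (exp (- \<kappa> * a))"
    define \<eta> where "\<eta> = complex_of_real (exp (- 2 * \<kappa> * a))"
    define K where "K = complex_of_real \<kappa>"
    have kk: "\<kappa> \<noteq> 0" "K \<noteq> 0" "cmod K = \<kappa>" using k by (auto simp: K_def)
    note T = exponential_growth[OF k(1) less_imp_le[OF a] th(1)[unfolded lam_def] q, folded N_def e_def \<eta>_def K_def]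
    have t1: "cmod (e * (th' a + K * th a) - K) \<le> E" "cmod (e * (th' a - K * th a) + \<eta> * K) \<le> E"
      using T kk k(1) by (simp_all add: th E_def)
    note P = exponential_growth[OF k(1) less_imp_le[OF a] ph(1)[unfolded lam_def] q, folded N_def e_def \<eta>_def K_def]
    have p1: "cmod (e * (ph' a + K * ph a) - 1) \<le> E / \<kappa>" "cmod (e * (ph' a - K * ph a) - \<eta>) \<le> E / \<kappa>"
      using P kk k(1) by (simp_all add: ph E_def field_simps)
    have D: "discr q a lam = th a + ph' a" by (simp add: discr_def th_def ph'_def)
    \<comment> \<open>\<open>th a\<close> is recovered as a difference and \<open>ph' a\<close> as a
      sum of the two factored combinations. The error terms of \<open>ph\<close> carry a factor
      \<open>K\<close>, compensated by the 1/\<kappa> in their bounds.\<close>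
    have "2 * K * (e * discr q a lam - (1 + \<eta>)) = (e * (th' a + K * th a) - K) - (e * (th' a - K * th a) + \<eta> * K)
        + K * (e * (ph' a + K * ph a) - 1) + K * (e * (ph' a - K * ph a) - \<eta>)"
      by (simp add: D algebra_simps)
    also have "cmod \<dots> \<le> E + E + \<kappa> * (E / \<kappa>) + \<kappa> * (E / \<kappa>)"
    proof -
      have tri: "cmod (x1 - x2 + K * x3 + K * x4) \<le> cmod x1 + cmod x2 + \<kappa> * cmod x3 + \<kappa> * cmod x4" for x1 x2 x3 x4
        using norm_triangle_ineq[of "x1 - x2 + K * x3" "K * x4"] norm_triangle_ineq[of "x1 - x2" "K * x3"]
          norm_triangle_ineq4[of x1 x2] by (simp add: norm_mult kk)
      show ?thesis
        by (rule order_trans[OF tri]) (intro add_mono mult_left_mono t1 p1, use k(1) in auto)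
    qed
    also have "\<dots> \<le> \<kappa>" using k kk by simp
    finally have "cmod (e * discr q a lam - (1 + \<eta>)) \<le> 1/2"
      using kk k(1) by (simp add: norm_mult)
    moreover have "cmod (1 + \<eta>) \<ge> 1"
    proof -
      have "1 + \<eta> = of_real (1 + exp (- 2 * \<kappa> * a))" by (simp add: \<eta>_def)
      then show ?thesis by (simp del: of_real_add)
    qed
    ultimately have "cmod (e * discr q a lam) \<ge> 1/2"
      using norm_triangle_ineq4[of "e * discr q a lam" "e * discr q a lam - (1 + \<eta>)"] by simp
    then have "exp (- \<kappa> * a) * cmod (discr q a lam) \<ge> 1/2" by (simp add: norm_mult e_def)
    then have "exp (\<kappa> * a) * (exp (- \<kappa> * a) * cmod (discr q a lam)) \<ge> exp (\<kappa> * a) * (1/2)"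
      by (intro mult_left_mono) auto
    then have "cmod (discr q a lam) \<ge> exp (\<kappa> * a) / 2"
      by (simp add: mult.assoc[symmetric] flip: exp_add)
    moreover have "exp (\<kappa> * a) > 4"
    proof -
      have "4 \<le> \<kappa> * a" using k a by (simp add: field_simps)
      moreover have "1 + \<kappa> * a \<le> exp (\<kappa> * a)" by (rule exp_ge_add_one_self)
      ultimately show ?thesis by (rule_tac less_le_trans[of _ "1 + \<kappa> * a"]) auto
    qed
    ultimately have "cmod (discr q a lam) > 2" by linarith
    then show "cmod (discr q a (of_real (- \<kappa>\<^sup>2))) > 2" by (simp add: lam_def)
  qed
qed

text \<open>The quasi-momentum is normalized at the \<open>Inf\<close> of the real parts of the
  spectrum. This number is known to lie to the left of the spectrum only once boundedness from below
  is established.\<close>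

lemma spec_per_bdd_below:
  assumes q: "loc_int UNIV q" and a: "a > 0"
  shows "bdd_below (Re ` spec_per q a)"
proof -
  obtain K where K: "\<And>\<kappa>. \<kappa> \<ge> K \<Longrightarrow> cmod (discr q a (of_real (- \<kappa>\<^sup>2))) > 2"
    using discr_large[OF assms] by blast
  show ?thesis
  proof (intro bdd_belowI2[of _ "- (max K 0)\<^sup>2"])
    fix lam assume lam: "lam \<in> spec_per q a"
    show "- (max K 0)\<^sup>2 \<le> Re lam"
    proof (rule ccontr)
      assume "\<not> - (max K 0)\<^sup>2 \<le> Re lam"
      then have less: "(max K 0)\<^sup>2 < - Re lam" by simp
      define \<kappa> where "\<kappa> = sqrt (- Re lam)"
      have "\<kappa> \<ge> max K 0" unfolding \<kappa>_def using less by (intro real_le_rsqrt) auto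
      moreover have "- \<kappa>\<^sup>2 = Re lam"
      proof -
        have "0 \<le> - Re lam" using less zero_le_power2[of "max K 0"] by linarith
        then show ?thesis by (simp add: \<kappa>_def)
      qed
      moreover have "of_real (Re lam) = lam" using lam by (simp add: spec_per_def)
      ultimately have "cmod (discr q a lam) > 2" using K[of \<kappa>] by simp
      then show False using lam by (simp add: spec_per_def)
    qed
  qed
qed

section \<open>Reality, monotonicity and sign of the quasi-momentum\<close>

lemma discr_real:
  assumes q: "loc_int UNIV q" and lam: "lam \<in> \<real>"
  shows "discr q a lam \<in> \<real>"
proof -
  have "fst F a \<in> \<real> \<and> snd F a \<in> \<real>" if F: "F = fund_sol q lam (of_real y0) (of_real y1)" for F y0 y1
  proof -
    note f = fund_sol_works[OF q, of lam "of_real y0" "of_real y1", folded F]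
    have "cnj lam = lam" using lam by (simp add: Reals_cnj_iff)
    then have c: "sl_solution q lam UNIV (\<lambda>x. cnj (fst F x)) (\<lambda>x. cnj (snd F x))"
      using sl_solution_cnj[OF f(1)] by simp
    show ?thesis
      using sl_solution_unique[OF c f(1) _ _ q, of a] f by (simp add: Reals_cnj_iff)
  qed
  from this[of _ 1 0] this[of _ 0 1] show ?thesis
    unfolding discr_def by (intro Reals_add) auto
qed

text \<open>Where \<open>Re k\<close> is not a multiple of \<open>pi\<close>, \<open>k\<close> is real on the real axis, extends by reflection, and
  has nonnegative derivative there because \<open>Im k > 0\<close> above the axis. So \<open>Re k\<close> cannot cross such a
  value downwards.\<close>
lemma quasi_momentum_mono:
  assumes k: "is_quasi_momentum q a k" and q: "loc_int UNIV q" and "x \<le> y"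
  shows "Re (k (of_real x)) \<le> Re (k (of_real y))"
proof (rule ccontr)
  define K where "K t = Re (k (of_real t))" for t
  assume "\<not> Re (k (of_real x)) \<le> Re (k (of_real y))"
  then have xy: "K y < K x" by (simp add: K_def)
  have kc: "continuous_on {z. Im z \<ge> 0} k" and kh: "k holomorphic_on {z. Im z > 0}"
    and kD: "\<And>z. Im z \<ge> 0 \<Longrightarrow> 2 * cos (k z) = discr q a z" and kp: "\<And>z. Im z > 0 \<Longrightarrow> Im (k z) > 0"
    using k by (auto simp: is_quasi_momentum_def)
  have Kc: "continuous_on S K" for S
    unfolding K_def by (intro continuous_intros continuous_on_compose2[OF kc]) auto
  have "countable (range (\<lambda>n::int. of_int n * pi))" by simp
  from real_interval_avoid_countable_set[OF xy this]
  obtain v where v: "K y < v" "v < K x" "v \<notin> range (\<lambda>n::int. of_int n * pi)" by auto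
  have sinv: "sin v \<noteq> 0" using v(3) by (auto simp: sin_zero_iff_int2)
  \<comment> \<open>The contradiction is sought at the last point \<open>s\<close> where the level
    \<open>v\<close> is attained: immediately after it \<open>K\<close> stays below
    \<open>v\<close>, while a nonnegative derivative near \<open>s\<close> forbids any
    decrease.\<close>
  define S where "S = {t \<in> {x..y}. K t = v}"
  have "S \<noteq> {}" using IVT2'[of K y v x] v \<open>x \<le> y\<close> Kc by (auto simp: S_def)
  moreover have "compact S"
  proof -
    have "S = {x..y} \<inter> K -` {v}" by (auto simp: S_def)
    moreover have "closed (K -` {v})" using Kc[of UNIV] by (intro closed_vimage) auto
    ultimately show ?thesis by (simp add: compact_Int_closed)
  qed
  ultimately have "\<exists>s\<in>S. \<forall>t\<in>S. t \<le> s" by (rule compact_attains_sup[rotated])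
  then obtain s where s: "s \<in> {x..y}" "K s = v" and smax: "\<And>t. t \<in> {x..y} \<Longrightarrow> K t = v \<Longrightarrow> t \<le> s"
    by (auto simp: S_def)
  have sy: "s < y" using s v by (cases "s = y") auto
  have after: "K t < v" if t: "s < t" "t \<le> y" for t
  proof (rule ccontr)
    assume "\<not> K t < v"
    then obtain t' where "t \<le> t'" "t' \<le> y" "K t' = v" using IVT2'[of K y v t] v t Kc by auto
    then show False using smax[of t'] t s by auto
  qed
  \<comment> \<open>Im(cos k) is sin(Re k) times a function of Im k that vanishes only at 0, and cos
    k, half the discriminant, is real on the axis.\<close>
  have real_k: "Im (k (of_real t)) = 0" if "sin (K t) \<noteq> 0" for t
  proof -
    have "Im (cos (k (of_real t))) = 0"
      using kD[of "of_real t"] discr_real[OF q, of "of_real t" a] by (auto simp: complex_is_Real_iff complex_eq_iff)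
    then have "exp (- Im (k (of_real t))) = exp (Im (k (of_real t)))" using that by (simp add: Im_cos K_def)
    then show ?thesis by simp
  qed
  have "isCont (\<lambda>t. sin (K t)) s"
    using Kc[of UNIV] by (intro continuous_intros) (simp add: continuous_on_eq_continuous_at)
  moreover have "sin (K s) \<noteq> 0" using sinv s by simp
  ultimately have "\<forall>\<^sub>F t in at s. sin (K t) \<noteq> 0"
    by (simp add: isCont_def tendsto_imp_eventually_ne)
  then obtain r where r: "r > 0" "\<And>t. t \<noteq> s \<Longrightarrow> dist t s < r \<Longrightarrow> sin (K t) \<noteq> 0"
    unfolding eventually_at by auto
  then have rr: "sin (K t) \<noteq> 0" if "dist t s < r" for t using \<open>sin (K s) \<noteq> 0\<close> that by (cases "t = s") auto
  define B where "B = ball (complex_of_real s) r"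
  define g where "g z = (if 0 \<le> Im z then k z else cnj (k (cnj z)))" for z
  have Bt: "dist t s < r" if "of_real t \<in> B" for t
    using that by (simp add: B_def dist_commute dist_of_real)
  have gh: "g holomorphic_on B" unfolding g_def
  proof (rule Schwarz_reflection)
    show "open B" by (simp add: B_def)
    show "cnj ` B \<subseteq> B"
    proof
      fix z assume "z \<in> cnj ` B"
      then obtain w where w: "z = cnj w" "w \<in> B" by auto
      have "dist (complex_of_real s) (cnj w) = dist (complex_of_real s) w"
        unfolding dist_norm by (metis complex_cnj_complex_of_real complex_cnj_diff complex_mod_cnj)
      then show "z \<in> B" using w by (simp add: B_def)
    qed
    show "k holomorphic_on B \<inter> {z. 0 < Im z}" by (rule holomorphic_on_subset[OF kh]) auto
    show "continuous_on (B \<inter> {z. 0 \<le> Im z}) k" by (rule continuous_on_subset[OF kc]) auto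
    fix z assume z: "z \<in> B" "z \<in> \<real>"
    then obtain t where t: "z = of_real t" by (auto elim: Reals_cases)
    show "k z \<in> \<real>" using real_k[OF rr[OF Bt]] z t by (simp add: complex_is_Real_iff)
  qed
  define g' where "g' t = deriv g (of_real t)" for t
  have der: "\<exists>D. (K has_real_derivative D) (at t) \<and> D \<ge> 0" if t: "dist t s < r" for t
  proof -
    have tB: "of_real t \<in> B" using t by (simp add: B_def dist_commute dist_of_real)
    then have gd: "(g has_field_derivative g' t) (at (of_real t))"
      unfolding g'_def using gh by (intro holomorphic_derivI[of _ B]) (auto simp: B_def)
    have of_real: "(complex_of_real has_vector_derivative 1) (at t)"
      unfolding has_vector_derivative_def
      by (rule has_derivative_eq_rhs[OF bounded_linear.has_derivative[OF bounded_linear_of_real has_derivative_ident]])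
         (auto simp: scaleR_conv_of_real)
    have "((\<lambda>u. g (of_real u)) has_vector_derivative 1 * g' t) (at t)"
      using field_vector_diff_chain_at[of of_real 1 t g "g' t"] gd
      by (simp add: o_def of_real)
    then have "((\<lambda>u. Re (g (of_real u))) has_vector_derivative Re (g' t)) (at t)"
      using bounded_linear.has_vector_derivative[OF bounded_linear_Re] by fastforce
    then have 1: "(K has_real_derivative Re (g' t)) (at t)"
      by (simp add: g_def K_def[abs_def] has_real_derivative_iff_has_vector_derivative)
    \<comment> \<open>The complex derivative is taken along the upward vertical direction, where the
      real part of the quotient is Im k divided by the positive step, because \<open>k\<close> is
      real at the base point.\<close>
    have "((\<lambda>h. (g (of_real t + h) - g (of_real t)) / h) \<longlongrightarrow> g' t) (at 0)"
      using gd by (simp add: DERIV_def)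
    moreover have "filterlim (\<lambda>h. \<i> * complex_of_real h) (at 0) (at_right 0)"
    proof (rule filterlim_atI)
      have "((\<lambda>h. \<i> * complex_of_real h) \<longlongrightarrow> \<i> * of_real 0) (at_right 0)" by (intro tendsto_intros)
      then show "((\<lambda>h. \<i> * complex_of_real h) \<longlongrightarrow> 0) (at_right 0)" by simp
      show "\<forall>\<^sub>F h in at_right 0. \<i> * complex_of_real h \<noteq> 0"
        by (auto simp: eventually_at_filter)
    qed
    ultimately have "((\<lambda>h. (g (of_real t + \<i> * of_real h) - g (of_real t)) / (\<i> * of_real h)) \<longlongrightarrow> g' t) (at_right 0)"
      by (rule filterlim_compose)
    then have "((\<lambda>h. Re ((g (of_real t + \<i> * of_real h) - g (of_real t)) / (\<i> * of_real h))) \<longlongrightarrow> Re (g' t)) (at_right 0)"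
      by (rule tendsto_Re)
    moreover have "\<forall>\<^sub>F h in at_right 0. Re ((g (of_real t + \<i> * of_real h) - g (of_real t)) / (\<i> * of_real h)) \<ge> 0"
      using eventually_at_right_less[of "0::real"]
    proof eventually_elim
      case (elim h)
      have "Im (k (of_real t)) = 0" by (rule real_k[OF rr[OF t]])
      moreover have "Im (k (of_real t + \<i> * of_real h)) > 0" using elim by (intro kp) simp
      moreover have "Re (z / (\<i> * of_real h)) = Im z / h" for z
        using elim by (simp add: Re_divide power2_eq_square)
      ultimately show ?case using elim by (simp add: g_def)
    qed
    ultimately have "Re (g' t) \<ge> 0"
      by (rule tendsto_lowerbound) simp
    with 1 show ?thesis by blast
  qed
  define t where "t = min y (s + r / 2)"
  have t: "s < t" "t \<le> y" "t < s + r" using sy r by (auto simp: t_def)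
  have "K s \<le> K t"
    by (rule DERIV_nonneg_imp_nondecreasing) (use t der in \<open>auto simp: dist_real_def\<close>)
  then show False using after[OF t(1,2)] s by simp
qed

text \<open>Monotonicity from the bottom of the spectrum, where \<open>k\<close> is 0, gives the
  sign. For reality, a nonzero imaginary part \<open>v\<close> would force sin(Re k) = 0, as cos k
  is real, and then |cos k| = cosh v > 1, contrary to |D| \<le> 2. This argument includes the band
  edges.\<close>

lemma quasi_momentum_spec:
  assumes k: "is_quasi_momentum q a k" and q: "loc_int UNIV q" and a: "a > 0" and lam: "lam \<in> spec_per q a"
  shows "k lam \<in> \<real>" "Re (k lam) \<ge> 0"
proof -
  define l0 where "l0 = Inf (Re ` spec_per q a)"
  have r: "lam = of_real (Re lam)" using lam by (simp add: spec_per_def)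
  have "l0 \<le> Re lam" unfolding l0_def
    by (rule cInf_lower[OF _ spec_per_bdd_below[OF q a]]) (use lam in auto)
  from quasi_momentum_mono[OF k q this] show "Re (k lam) \<ge> 0"
    using k r by (simp add: is_quasi_momentum_def l0_def)
  have "2 * cos (k lam) = discr q a lam" using k r by (simp add: is_quasi_momentum_def) (metis Im_complex_of_real order_refl)
  moreover have "discr q a lam \<in> \<real>" "cmod (discr q a lam) \<le> 2" using lam by (auto simp: spec_per_def)
  ultimately have "2 * cos (k lam) \<in> \<real>" "cmod (2 * cos (k lam)) \<le> 2" by simp_all
  then have c: "Im (cos (k lam)) = 0" "cmod (cos (k lam)) \<le> 1"
    by (simp_all add: complex_is_Real_iff norm_mult)
  define u v where "u = Re (k lam)" and "v = Im (k lam)"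
  have "v = 0"
  proof (rule ccontr)
    assume "v \<noteq> 0"
    then have "sin u = 0" using c(1) by (auto simp: Im_cos u_def v_def)
    then have "(cos u)\<^sup>2 = 1" using sin_cos_squared_add[of u] by simp
    then have "\<bar>cos u\<bar> = 1" using power2_eq_1_iff by fastforce
    moreover have "\<bar>Re (cos (k lam))\<bar> \<le> 1" using c(2) abs_Re_le_cmod order_trans by blast
    ultimately have le: "exp v + exp (- v) \<le> 2" by (simp add: Re_cos u_def[symmetric] v_def[symmetric] abs_mult)
    have "exp (v/2) \<noteq> exp (- v/2)" using \<open>v \<noteq> 0\<close> by simp
    then have "0 < (exp (v/2) - exp (-v/2))\<^sup>2" by (simp only: zero_less_power2 right_minus_eq) simp
    also have "(exp (v/2) - exp (-v/2))\<^sup>2 = exp v + exp (-v) - 2"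
    proof -
      have "exp (v/2) * exp (v/2) = exp v" "exp (-v/2) * exp (-v/2) = exp (-v)" "exp (v/2) * exp (-v/2) = 1"
        by (simp_all flip: exp_add)
      then show ?thesis by (simp add: power2_eq_square algebra_simps)
    qed
    finally show False using le by linarith
  qed
  then show "k lam \<in> \<real>" by (simp add: complex_is_Real_iff v_def)
qed

text \<open>The critical set only involves indices \<open>n \<ge> 0\<close>, so this relies on \<open>k \<ge> 0\<close> on the spectrum.\<close>
lemma noncritical_multiplier:
  assumes k: "is_quasi_momentum q a k" and q: "loc_int UNIV q" and a: "a > 0"
    and lam: "lam \<in> spec_per q a - crit_set q a k \<omega>" and nonres: "2 * a * \<omega> / pi \<notin> \<int>"
  shows "exp (2 * \<i> * k lam) * exp (2 * \<i> * of_real (\<omega> * a)) \<noteq> 1"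
    and "exp (2 * \<i> * k lam) * exp (- 2 * \<i> * of_real (\<omega> * a)) \<noteq> 1"
proof -
  have kr: "k lam = of_real (Re (k lam))" and k0: "Re (k lam) \<ge> 0"
    using quasi_momentum_spec[OF k q a, of lam] lam by auto
  define p where "p = Re (k lam) / pi"
  have p0: "p \<ge> 0" using k0 by (simp add: p_def)
  have kp: "k lam = of_real (pi * p)" using kr by (simp add: p_def)
  define b where "b = a * \<omega> / pi"
  have nb: "2 * b \<notin> \<int>" using nonres by (simp add: b_def mult.assoc)
  have fr: "frac b = b - of_int \<lfloor>b\<rfloor>" by (simp add: frac_def)
  have nc: "p \<noteq> real n + 1 - frac b" "p \<noteq> real n + frac b" for n
    using lam kp unfolding crit_set_def b_def[symmetric] by auto
  have one: "exp (2 * \<i> * of_real (pi * y)) = 1 \<longleftrightarrow> y \<in> \<int>" for y :: real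
  proof -
    have "exp (2 * \<i> * of_real (pi * y)) = 1 \<longleftrightarrow> (\<exists>n::int. 2 * (pi * y) = of_int (2 * n) * pi)"
      by (simp add: exp_eq_1)
    also have "\<dots> \<longleftrightarrow> (\<exists>n::int. y = of_int n)" by (rule arg_cong[where f=Ex], rule ext) auto
    finally show ?thesis by (auto elim!: Ints_cases)
  qed
  have wb: "\<omega> * a = pi * b" by (simp add: b_def)
  have e1: "exp (2 * \<i> * k lam) * exp (2 * \<i> * of_real (\<omega> * a)) = exp (2 * \<i> * of_real (pi * (p + b)))"
    unfolding kp wb exp_add[symmetric] by (simp add: algebra_simps)
  have e2: "exp (2 * \<i> * k lam) * exp (- 2 * \<i> * of_real (\<omega> * a)) = exp (2 * \<i> * of_real (pi * (p - b)))"
    unfolding kp wb exp_add[symmetric] by (simp add: algebra_simps)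
  show "exp (2 * \<i> * k lam) * exp (2 * \<i> * of_real (\<omega> * a)) \<noteq> 1"
  proof
    assume "exp (2 * \<i> * k lam) * exp (2 * \<i> * of_real (\<omega> * a)) = 1"
    then have "p + b \<in> \<int>" unfolding e1 one .
    then obtain m :: int where m: "p + b = of_int m" by (auto elim: Ints_cases)
    \<comment> \<open>The shift by 1 brings p = m - b into the form of the critical points with 1 -
      frac b. From p \<ge> 0 follows j \<ge> -1 + frac b, so it is frac b > 0, a consequence of
      nonresonance, that rules out j = -1.\<close>
    define j where "j = m - \<lfloor>b\<rfloor> - 1"
    have pj: "p = of_int j + 1 - frac b" using m by (simp add: fr j_def)
    have "frac b \<noteq> 0" using nb by (auto simp: frac_eq_0_iff)
    then have "frac b > 0" using frac_ge_0[of b] by linarith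
    then have "real_of_int j > -1" using pj p0 by linarith
    then have "j \<ge> 0" by linarith
    then show False using nc(1)[of "nat j"] pj by simp
  qed
  show "exp (2 * \<i> * k lam) * exp (- 2 * \<i> * of_real (\<omega> * a)) \<noteq> 1"
  proof
    assume "exp (2 * \<i> * k lam) * exp (- 2 * \<i> * of_real (\<omega> * a)) = 1"
    then have "p - b \<in> \<int>" unfolding e2 one .
    then obtain m :: int where m: "p - b = of_int m" by (auto elim: Ints_cases)
    define j where "j = m + \<lfloor>b\<rfloor>"
    have pj: "p = of_int j + frac b" using m by (simp add: fr j_def)
    have "real_of_int j > -1" using pj p0 frac_lt_1[of b] by linarith
    then have "j \<ge> 0" by linarith
    then show False using nc(2)[of "nat j"] pj by simp
  qed
qed

section \<open>The Harris--Lutz transformation\<close>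

text \<open>The integration constant P(a) / (z - 1) is the one that makes the primitive itself
  quasi-periodic. Then (z - 1) H(x) is the integral of \<open>g\<close> over the single period from
  x to x + a, so \<open>H\<close> grows no faster than \<open>g\<close>; exp(|\<sigma>| a) accounts
  for the variation of the exponential over a period.\<close>

lemma quasi_periodic_primitive:
  fixes g :: "real \<Rightarrow> complex"
  assumes g: "continuous_on {0..} g" and per: "\<And>x. x \<ge> 0 \<Longrightarrow> g (x + a) = z * g x" and a: "a > 0" and z: "z \<noteq> 1"
    and bnd: "\<And>x. x \<ge> 0 \<Longrightarrow> cmod (g x) \<le> K * exp (\<sigma> * x)" and K: "K \<ge> 0"
  shows "\<exists>H. (\<forall>T. ac_prim 0 T H g) \<and>
    (\<forall>x\<ge>0. cmod (H x) \<le> a * K * exp (\<bar>\<sigma>\<bar> * a) / cmod (z - 1) * exp (\<sigma> * x))"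
proof -
  define P where "P x = integral {0..x} g" for x
  define H where "H x = P a / (z - 1) + P x" for x
  have gc: "continuous_on {u..v} g" if "u \<ge> 0" for u v
    using g by (rule continuous_on_subset) (use that in auto)
  have gi: "g integrable_on {u..v}" if "u \<ge> 0" for u v
    by (intro integrable_continuous_real gc that)
  have "ac_prim 0 T H g" for T
    by (rule ac_primI) (auto simp: H_def P_def intro!: absolutely_integrable_continuous_real gc)
  moreover have "cmod (H x) \<le> a * K * exp (\<bar>\<sigma>\<bar> * a) / cmod (z - 1) * exp (\<sigma> * x)" if x: "x \<ge> 0" for x
  proof -
    have "(g has_integral integral {a..x + a} g) (cbox a (x + a))"
      using gi[of a "x+a"] a by (simp add: integrable_integral)
    from has_integral_affinity'[OF this, of 1 a]
    have "((\<lambda>t. g (t + a)) has_integral integral {a..x + a} g) {0..x}" by simp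
    moreover have "((\<lambda>t. g (t + a)) has_integral z * P x) {0..x}"
    proof (rule has_integral_eq[of _ "\<lambda>t. z * g t"])
      show "((\<lambda>t. z * g t) has_integral z * P x) {0..x}"
        unfolding P_def by (intro has_integral_mult_right integrable_integral gi) simp
    qed (use per in auto)
    ultimately have sh: "integral {a..x + a} g = z * P x" by (rule has_integral_unique)
    have c1: "P a + integral {a..x + a} g = P (x + a)"
      unfolding P_def using x a by (intro Henstock_Kurzweil_Integration.integral_combine gi) auto
    have c2: "P x + integral {x..x + a} g = P (x + a)"
      unfolding P_def using x a by (intro Henstock_Kurzweil_Integration.integral_combine gi) auto
    have "integral {x..x + a} g = P a + (z - 1) * P x" using c1 c2 sh by (simp add: algebra_simps)
    then have H: "H x = integral {x..x + a} g / (z - 1)" using z by (simp add: H_def field_simps)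
    have "cmod (integral {x..x + a} g) \<le> integral {x..x + a} (\<lambda>t. K * exp (\<bar>\<sigma>\<bar> * a) * exp (\<sigma> * x))"
    proof (rule integral_norm_bound_integral)
      show "g integrable_on {x..x + a}" using gi x by simp
      fix t assume t: "t \<in> {x..x + a}"
      have "\<sigma> * (t - x) \<le> \<bar>\<sigma>\<bar> * (t - x)" using t by (intro mult_right_mono) auto
      also have "\<dots> \<le> \<bar>\<sigma>\<bar> * a" using t by (intro mult_left_mono) auto
      finally have "\<sigma> * t \<le> \<bar>\<sigma>\<bar> * a + \<sigma> * x" by (simp add: algebra_simps)
      then have "K * exp (\<sigma> * t) \<le> K * (exp (\<bar>\<sigma>\<bar> * a) * exp (\<sigma> * x))"
        using K by (intro mult_left_mono) (simp_all flip: exp_add)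
      then show "cmod (g t) \<le> K * exp (\<bar>\<sigma>\<bar> * a) * exp (\<sigma> * x)"
        using bnd[of t] t x by (simp add: mult.assoc)
    qed auto
    also have "\<dots> = a * K * exp (\<bar>\<sigma>\<bar> * a) * exp (\<sigma> * x)" using a by simp
    finally show ?thesis unfolding H norm_divide by (simp add: divide_right_mono)
  qed
  ultimately show ?thesis by blast
qed

text \<open>The sine splits into two exponentials, which multiply the quasi-periodicity factor by
  exp(2i\<omega>a) and exp(-2i\<omega>a). A lower bound \<open>d\<close> is assumed instead of mere
  difference from 1, so that the resulting bound can be uniform in the spectral parameter.\<close>

lemma oscillating_primitive:
  fixes F :: "real \<Rightarrow> complex"
  assumes F: "continuous_on {0..} F" and per: "\<And>x. x \<ge> 0 \<Longrightarrow> F (x + a) = \<zeta> * F x" and a: "a > 0" and d: "d > 0"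
    and z: "d \<le> cmod (\<zeta> * exp (2 * \<i> * of_real (\<omega> * a)) - 1)" "d \<le> cmod (\<zeta> * exp (- 2 * \<i> * of_real (\<omega> * a)) - 1)"
    and bnd: "\<And>x. x \<ge> 0 \<Longrightarrow> cmod (F x) \<le> K * exp (\<sigma> * x)" and K: "K \<ge> 0"
  shows "\<exists>H. (\<forall>T. ac_prim 0 T H (\<lambda>x. of_real (c * sin (2 * \<omega> * x + \<delta>)) * F x)) \<and>
    (\<forall>x\<ge>0. cmod (H x) \<le> \<bar>c\<bar> * (a * K * exp (\<bar>\<sigma>\<bar> * a) / d) * exp (\<sigma> * x))"
proof -
  have ex: "\<exists>H. (\<forall>T. ac_prim 0 T H (\<lambda>x. exp (of_real x * w) * F x)) \<and>
    (\<forall>x\<ge>0. cmod (H x) \<le> a * K * exp (\<bar>\<sigma>\<bar> * a) / d * exp (\<sigma> * x))"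
    if w: "Re w = 0" and zw: "d \<le> cmod (\<zeta> * exp (of_real a * w) - 1)" for w
  proof -
    have "\<exists>H. (\<forall>T. ac_prim 0 T H (\<lambda>x. exp (of_real x * w) * F x)) \<and>
      (\<forall>x\<ge>0. cmod (H x) \<le> a * K * exp (\<bar>\<sigma>\<bar> * a) / cmod (\<zeta> * exp (of_real a * w) - 1) * exp (\<sigma> * x))"
    proof (rule quasi_periodic_primitive[OF _ _ a _ _ K])
      show "continuous_on {0..} (\<lambda>x. exp (of_real x * w) * F x)" by (intro continuous_intros F)
      show "exp (of_real (x + a) * w) * F (x + a) = \<zeta> * exp (of_real a * w) * (exp (of_real x * w) * F x)" if "x \<ge> 0" for x
        using per[OF that] by (simp add: ring_distribs exp_add)
      show "\<zeta> * exp (of_real a * w) \<noteq> 1" using d zw by auto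
      show "cmod (exp (of_real x * w) * F x) \<le> K * exp (\<sigma> * x)" if "x \<ge> 0" for x
        using bnd[OF that] w by (simp add: norm_mult)
    qed
    then obtain H where H: "\<forall>T. ac_prim 0 T H (\<lambda>x. exp (of_real x * w) * F x)"
      "\<And>x. x \<ge> 0 \<Longrightarrow> cmod (H x) \<le> a * K * exp (\<bar>\<sigma>\<bar> * a) / cmod (\<zeta> * exp (of_real a * w) - 1) * exp (\<sigma> * x)" by blast
    have "cmod (H x) \<le> a * K * exp (\<bar>\<sigma>\<bar> * a) / d * exp (\<sigma> * x)" if "x \<ge> 0" for x
    proof -
      have "a * K * exp (\<bar>\<sigma>\<bar> * a) / cmod (\<zeta> * exp (of_real a * w) - 1) \<le> a * K * exp (\<bar>\<sigma>\<bar> * a) / d"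
        using a K d zw by (intro divide_left_mono mult_pos_pos) auto
      then show ?thesis using H(2)[OF that] by (meson exp_ge_zero mult_right_mono order_trans)
    qed
    with H(1) show ?thesis by blast
  qed
  have "\<exists>H. (\<forall>T. ac_prim 0 T H (\<lambda>x. exp (of_real x * (2 * \<i> * of_real \<omega>)) * F x)) \<and>
    (\<forall>x\<ge>0. cmod (H x) \<le> a * K * exp (\<bar>\<sigma>\<bar> * a) / d * exp (\<sigma> * x))"
    by (rule ex) (use z(1) in \<open>simp_all add: mult_ac\<close>)
  then obtain H1 where H1: "\<And>T. ac_prim 0 T H1 (\<lambda>x. exp (of_real x * (2 * \<i> * of_real \<omega>)) * F x)"
    "\<And>x. x \<ge> 0 \<Longrightarrow> cmod (H1 x) \<le> a * K * exp (\<bar>\<sigma>\<bar> * a) / d * exp (\<sigma> * x)" by blast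
  have "\<exists>H. (\<forall>T. ac_prim 0 T H (\<lambda>x. exp (of_real x * (- 2 * \<i> * of_real \<omega>)) * F x)) \<and>
    (\<forall>x\<ge>0. cmod (H x) \<le> a * K * exp (\<bar>\<sigma>\<bar> * a) / d * exp (\<sigma> * x))"
    by (rule ex) (use z(2) in \<open>simp_all add: mult_ac\<close>)
  then obtain H2 where H2: "\<And>T. ac_prim 0 T H2 (\<lambda>x. exp (of_real x * (- 2 * \<i> * of_real \<omega>)) * F x)"
    "\<And>x. x \<ge> 0 \<Longrightarrow> cmod (H2 x) \<le> a * K * exp (\<bar>\<sigma>\<bar> * a) / d * exp (\<sigma> * x)" by blast
  \<comment> \<open>Euler's coefficients of the sine, including the phase. Each has modulus |c| / 2,
    so the two bounds add up to a factor |c|.\<close>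
  define d1 where "d1 = of_real c * exp (\<i> * of_real \<delta>) / (2 * \<i>)"
  define d2 where "d2 = - of_real c * exp (- \<i> * of_real \<delta>) / (2 * \<i>)"
  have dn: "cmod d1 = \<bar>c\<bar> / 2" "cmod d2 = \<bar>c\<bar> / 2" by (simp_all add: d1_def d2_def norm_mult norm_divide)
  have sin: "of_real (c * sin (2 * \<omega> * x + \<delta>)) = d1 * exp (of_real x * (2 * \<i> * of_real \<omega>)) + d2 * exp (of_real x * (- 2 * \<i> * of_real \<omega>))" for x
  proof -
    have "complex_of_real (c * sin (2 * \<omega> * x + \<delta>)) = of_real c * sin (of_real (2 * \<omega> * x + \<delta>))"
      by (simp only: of_real_mult sin_of_real)
    also have "\<dots> = of_real c * ((exp (\<i> * of_real (2 * \<omega> * x + \<delta>)) - exp (- (\<i> * of_real (2 * \<omega> * x + \<delta>)))) / (2 * \<i>))"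
      by (simp only: sin_exp_eq)
    also have "exp (\<i> * of_real (2 * \<omega> * x + \<delta>)) = exp (\<i> * of_real \<delta>) * exp (of_real x * (2 * \<i> * of_real \<omega>))"
      unfolding exp_add[symmetric] by (simp add: algebra_simps)
    also have "exp (- (\<i> * of_real (2 * \<omega> * x + \<delta>))) = exp (- \<i> * of_real \<delta>) * exp (of_real x * (- 2 * \<i> * of_real \<omega>))"
      unfolding exp_add[symmetric] by (simp add: algebra_simps)
    finally show ?thesis by (simp add: d1_def d2_def algebra_simps diff_divide_distrib)
  qed
  define H where "H x = d1 * H1 x + d2 * H2 x" for x
  have "ac_prim 0 T H (\<lambda>x. of_real (c * sin (2 * \<omega> * x + \<delta>)) * F x)" for T
    by (rule ac_prim_cong[OF ac_prim_add[OF ac_prim_cmult[where c=d1, OF H1(1)] ac_prim_cmult[where c=d2, OF H2(1)]]])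
       (simp_all only: H_def sin, simp add: algebra_simps)
  moreover have "cmod (H x) \<le> \<bar>c\<bar> * (a * K * exp (\<bar>\<sigma>\<bar> * a) / d) * exp (\<sigma> * x)" if x: "x \<ge> 0" for x
  proof -
    define B where "B = a * K * exp (\<bar>\<sigma>\<bar> * a) / d * exp (\<sigma> * x)"
    have "cmod (H x) \<le> cmod d1 * cmod (H1 x) + cmod d2 * cmod (H2 x)"
      unfolding H_def by (metis norm_mult norm_triangle_ineq)
    also have "\<dots> \<le> \<bar>c\<bar> / 2 * B + \<bar>c\<bar> / 2 * B"
      unfolding dn B_def using H1(2)[OF x] H2(2)[OF x] by (intro add_mono mult_left_mono) auto
    finally show ?thesis by (simp add: B_def mult_ac)
  qed
  ultimately show ?thesis by blast
qed

section \<open>Limits at infinity for the transformed system\<close>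

lemma bounded_integral_converges:
  fixes f :: "real \<Rightarrow> real"
  assumes int: "\<And>x. f integrable_on {0..x}" and nn: "\<And>x. x \<ge> 0 \<Longrightarrow> f x \<ge> 0"
    and B: "\<And>x. integral {0..x} f \<le> B"
  shows "\<exists>I. ((\<lambda>x. integral {0..x} f) \<longlongrightarrow> I) at_top \<and> (\<forall>x. integral {0..x} f \<le> I)"
proof -
  define P where "P x = integral {0..x} f" for x
  have mono: "P x \<le> P y" if "x \<le> y" for x y
    unfolding P_def by (rule integral_subset_le) (use that int nn in auto)
  have bdd: "bdd_above (range P)" using B by (auto simp: P_def intro!: bdd_aboveI2)
  define I where "I = (SUP x. P x)"
  have le: "P x \<le> I" for x unfolding I_def by (rule cSUP_upper[OF _ bdd]) simp
  have "(P \<longlongrightarrow> I) at_top"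
  proof (rule order_tendstoI)
    fix l assume "l < I"
    then obtain x where "l < P x" unfolding I_def using less_cSUP_iff[OF _ bdd] by auto
    then show "\<forall>\<^sub>F x in at_top. l < P x"
      using mono unfolding eventually_at_top_linorder by (meson less_le_trans)
  next
    fix l assume "I < l"
    then show "\<forall>\<^sub>F x in at_top. P x < l" using le by (auto intro!: always_eventually intro: le_less_trans)
  qed
  then show ?thesis using le unfolding P_def by blast
qed

text \<open>Harris--Lutz transformation: the functions \<open>z1\<close>, \<open>z2\<close> in the proof absorb the
  conditionally integrable part \<open>m s\<close> of the perturbation, so that only the integrable
  remainder \<open>\<rho>\<close> enters the Gronwall estimate.\<close>
lemma perturbed_system_asymptotics:
  fixes u v b0 bp bm H0 Hp Hm :: "real \<Rightarrow> complex" and m m' s q1 :: "real \<Rightarrow> real" and K L \<kappa> x0 I :: real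
  assumes K: "K \<ge> 1" and kappa: "\<kappa> \<ge> 0" and x0: "x0 \<ge> 0"
    and m: "\<And>T. ac_prim 0 T (\<lambda>x. complex_of_real (m x)) (\<lambda>x. complex_of_real (m' x))"
      "\<And>x. x \<ge> 0 \<Longrightarrow> 0 \<le> m x \<and> m x \<le> 1" "(m \<longlongrightarrow> 0) at_top" "\<And>x. x \<ge> x0 \<Longrightarrow> 4 * K * m x \<le> 1"
    and s: "\<And>x. \<bar>s x\<bar> \<le> K"
    and b: "\<And>x. x \<ge> 0 \<Longrightarrow> cmod (b0 x) \<le> K" "\<And>x. x \<ge> 0 \<Longrightarrow> cmod (bp x) \<le> K * exp (- 2 * \<kappa> * x)"
      "\<And>x. x \<ge> 0 \<Longrightarrow> cmod (bm x) \<le> K * exp (2 * \<kappa> * x)"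
    and H: "\<And>x. x \<ge> 0 \<Longrightarrow> cmod (H0 x) \<le> K" "\<And>x. x \<ge> 0 \<Longrightarrow> cmod (Hp x) \<le> K * exp (- 2 * \<kappa> * x)"
      "\<And>x. x \<ge> 0 \<Longrightarrow> cmod (Hm x) \<le> K * exp (2 * \<kappa> * x)"
    and Hac: "\<And>T. ac_prim 0 T H0 (\<lambda>x. of_real (s x) * b0 x)" "\<And>T. ac_prim 0 T Hp (\<lambda>x. of_real (s x) * bp x)"
      "\<And>T. ac_prim 0 T Hm (\<lambda>x. of_real (s x) * bm x)"
    and u: "\<And>T. ac_prim 0 T u (\<lambda>x. - (of_real (m x * s x + q1 x) * (b0 x * u x + bp x * v x)))"
    and v: "\<And>T. ac_prim 0 T v (\<lambda>x. of_real (m x * s x + q1 x) * (bm x * u x + b0 x * v x))"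
    and \<rho>: "\<And>T. (\<lambda>x. \<bar>q1 x\<bar> + \<bar>m' x\<bar> + (m x)\<^sup>2) absolutely_integrable_on {0..T}"
      "((\<lambda>x. integral {0..x} (\<lambda>x. \<bar>q1 x\<bar> + \<bar>m' x\<bar> + (m x)\<^sup>2)) \<longlongrightarrow> I) at_top"
      "\<And>x. integral {0..x} (\<lambda>x. \<bar>q1 x\<bar> + \<bar>m' x\<bar> + (m x)\<^sup>2) \<le> I"
    and L: "cmod (u x0) + cmod (v x0) \<le> L"
  defines "M \<equiv> 8 * L * exp (48 * K ^ 3 * I)"
  shows "\<exists>A. (\<forall>x\<ge>x0. cmod (u x - A) \<le> 3 * K ^ 3 * M * (I - integral {0..x} (\<lambda>x. \<bar>q1 x\<bar> + \<bar>m' x\<bar> + (m x)\<^sup>2)) + K * M * m x)"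
    and "\<kappa> > 0 \<Longrightarrow> ((\<lambda>x. exp (- 2 * \<kappa> * x) * cmod (v x)) \<longlongrightarrow> 0) at_top"
proof -
  define r where "r x = m x * s x + q1 x" for x
  define \<rho>' where "\<rho>' x = \<bar>q1 x\<bar> + \<bar>m' x\<bar> + (m x)\<^sup>2" for x
  note \<rho> = \<rho>[folded \<rho>'_def]
  define C where "C = 3 * K ^ 3"
  define E where "E x = exp (2 * \<kappa> * x)" for x
  have Ei: "exp (- 2 * \<kappa> * x) = 1 / E x" for x by (simp add: E_def exp_minus field_simps)
  have E0: "E x > 0" for x by (simp add: E_def)
  note b = b[unfolded Ei, folded E_def] and H = H[unfolded Ei, folded E_def]
  \<comment> \<open>Dividing \<open>v\<close> by E x balances the system: \<open>bm\<close> and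
    \<open>Hm\<close> may be as large as E x, \<open>bp\<close> and \<open>Hp\<close> are as small
    as 1 / E x, and relative to \<open>S\<close> all coefficients become bounded by
    \<open>K\<close>.\<close>
  define S where "S x = cmod (u x) + cmod (v x) / E x" for x
  define P where "P x = b0 x * u x + bp x * v x" for x
  define Q where "Q x = bm x * u x + b0 x * v x" for x
  define PH where "PH x = H0 x * u x + Hp x * v x" for x
  define QH where "QH x = Hm x * u x + H0 x * v x" for x
  \<comment> \<open>The densities of \<open>u\<close> and \<open>v\<close> contain -m s P and m s Q,
    those of \<open>PH\<close> and \<open>QH\<close> contain s P and s Q. Hence the opposite signs
    in \<open>z1\<close> and \<open>z2\<close>: the terms in m s cancel. What is left carries q1, m'
    or the product m r.\<close>
  define z1 where "z1 x = u x + of_real (m x) * PH x" for x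
  define z2 where "z2 x = v x - of_real (m x) * QH x" for x
  define g1 where "g1 x = - of_real (q1 x) * P x + of_real (m' x) * PH x + of_real (m x * r x) * (- (H0 x * P x) + Hp x * Q x)" for x
  define g2 where "g2 x = of_real (q1 x) * Q x - of_real (m' x) * QH x - of_real (m x * r x) * (- (Hm x * P x) + H0 x * Q x)" for x
  have S0: "S x \<ge> 0" for x using E0[of x] by (simp add: S_def)
  have u': "ac_prim 0 T u (\<lambda>x. - (of_real (r x) * P x))" and v': "ac_prim 0 T v (\<lambda>x. of_real (r x) * Q x)" for T
    using u v by (simp_all add: r_def P_def Q_def)
  have PHac: "ac_prim 0 T PH (\<lambda>x. of_real (s x) * P x + of_real (r x) * (- (H0 x * P x) + Hp x * Q x))" for T
    unfolding PH_def
    by (rule ac_prim_cong[OF ac_prim_add[OF ac_prim_mult[OF Hac(1) u'] ac_prim_mult[OF Hac(2) v']]])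
       (simp_all add: P_def algebra_simps)
  have QHac: "ac_prim 0 T QH (\<lambda>x. of_real (s x) * Q x + of_real (r x) * (- (Hm x * P x) + H0 x * Q x))" for T
    unfolding QH_def
    by (rule ac_prim_cong[OF ac_prim_add[OF ac_prim_mult[OF Hac(3) u'] ac_prim_mult[OF Hac(1) v']]])
       (simp_all add: Q_def algebra_simps)
  have z1ac: "ac_prim 0 T z1 g1" for T
    by (rule ac_prim_cong[OF ac_prim_add[OF u' ac_prim_mult[OF m(1) PHac]]])
       (simp_all add: z1_def g1_def r_def algebra_simps)
  have z2ac: "ac_prim 0 T z2 g2" for T
    by (rule ac_prim_cong[OF ac_prim_diff[OF v' ac_prim_mult[OF m(1) QHac]]])
       (simp_all add: z2_def g2_def r_def algebra_simps)
  have comb: "cmod (x1 * u x + x2 * v x) \<le> k * (K * S x)"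
    if "cmod x1 \<le> k * K" "cmod x2 \<le> k * (K / E x)" for x1 x2 k x
  proof -
    have "cmod (x1 * u x + x2 * v x) \<le> cmod x1 * cmod (u x) + cmod x2 * cmod (v x)"
      by (metis norm_mult norm_triangle_ineq)
    also have "\<dots> \<le> k * K * cmod (u x) + k * (K / E x) * cmod (v x)"
      using that by (intro add_mono mult_right_mono) auto
    finally show ?thesis by (simp add: S_def algebra_simps)
  qed
  have Pb: "cmod (P x) \<le> K * S x" and PHb: "cmod (PH x) \<le> K * S x" if "x \<ge> 0" for x
    using comb[of "b0 x" 1 "bp x" x] comb[of "H0 x" 1 "Hp x" x] b[OF that] H[OF that]
    by (simp_all add: P_def PH_def)
  have Qb: "cmod (Q x) \<le> E x * (K * S x)" and QHb: "cmod (QH x) \<le> E x * (K * S x)" if "x \<ge> 0" for x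
    using comb[of "bm x" "E x" "b0 x" x] comb[of "Hm x" "E x" "H0 x" x] b[OF that] H[OF that] E0[of x]
    by (simp_all add: Q_def QH_def mult.commute)
  have mr: "m x * \<bar>r x\<bar> \<le> K * (m x)\<^sup>2 + \<bar>q1 x\<bar>" if "x \<ge> 0" for x
  proof -
    have "\<bar>r x\<bar> \<le> m x * \<bar>s x\<bar> + \<bar>q1 x\<bar>" using m(2)[OF that] by (simp add: r_def abs_mult order_trans[OF abs_triangle_ineq])
    also have "\<dots> \<le> m x * K + \<bar>q1 x\<bar>" using m(2)[OF that] s by (intro add_mono mult_left_mono) auto
    finally have "m x * \<bar>r x\<bar> \<le> m x * (m x * K + \<bar>q1 x\<bar>)" using m(2)[OF that] by (intro mult_left_mono) auto
    also have "\<dots> \<le> K * (m x)\<^sup>2 + \<bar>q1 x\<bar>"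
      using m(2)[OF that] by (simp add: algebra_simps power2_eq_square mult_left_le_one_le)
    finally show ?thesis .
  qed
  have K1: "K \<le> K ^ 3" "K ^ 2 \<le> K ^ 3" "1 \<le> K ^ 3" using K by (auto intro: power_increasing[of 2 3 K] self_le_power one_le_power)
  \<comment> \<open>This fixes \<open>C = 3 * K ^ 3\<close>: after bounding m |r| by K m^2 + |q1|,
    the coefficients of |q1|, |m'| and m^2 are K + 2 K^2, K and 2 K^3.\<close>
  have key: "\<bar>q1 x\<bar> * (K * S x) + \<bar>m' x\<bar> * (K * S x) + (m x * \<bar>r x\<bar>) * (2 * (K * (K * S x))) \<le> C * \<rho>' x * S x"
    if "x \<ge> 0" for x
  proof -
    have "\<bar>q1 x\<bar> * (K * S x) + \<bar>m' x\<bar> * (K * S x) + (m x * \<bar>r x\<bar>) * (2 * (K * (K * S x)))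
      \<le> \<bar>q1 x\<bar> * (K * S x) + \<bar>m' x\<bar> * (K * S x) + (K * (m x)\<^sup>2 + \<bar>q1 x\<bar>) * (2 * (K * (K * S x)))"
      using mr[OF that] K S0 by (intro add_left_mono mult_right_mono) auto
    also have "\<dots> = (\<bar>q1 x\<bar> * (K + 2 * K^2) + \<bar>m' x\<bar> * K + (m x)\<^sup>2 * (2 * K^3)) * S x"
      by (simp add: algebra_simps power2_eq_square power3_eq_cube)
    also have "\<dots> \<le> (\<bar>q1 x\<bar> * C + \<bar>m' x\<bar> * C + (m x)\<^sup>2 * C) * S x"
      using K1 S0 K unfolding C_def by (intro mult_right_mono add_mono mult_left_mono) auto
    finally show ?thesis by (simp add: \<rho>'_def algebra_simps)
  qed
  have g1b: "cmod (g1 x) \<le> C * \<rho>' x * S x" if x: "x \<ge> 0" for x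
  proof -
    have HQ: "cmod (- (H0 x * P x) + Hp x * Q x) \<le> 2 * (K * (K * S x))"
    proof -
      have "cmod (- (H0 x * P x) + Hp x * Q x) \<le> cmod (H0 x) * cmod (P x) + cmod (Hp x) * cmod (Q x)"
        by (metis norm_minus_cancel norm_mult norm_triangle_ineq)
      also have "\<dots> \<le> K * (K * S x) + (K * (1 / E x)) * (E x * (K * S x))"
        using H(1,2)[OF x] Pb[OF x] Qb[OF x] K E0[of x] S0[of x] by (intro add_mono mult_mono) auto
      finally show ?thesis using E0[of x] by simp
    qed
    have "cmod (g1 x) \<le> \<bar>q1 x\<bar> * cmod (P x) + \<bar>m' x\<bar> * cmod (PH x) + \<bar>m x * r x\<bar> * cmod (- (H0 x * P x) + Hp x * Q x)"
      unfolding g1_def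
      by (intro order_trans[OF norm_triangle_ineq] add_mono) (auto simp: norm_mult abs_mult)
    also have "\<dots> \<le> \<bar>q1 x\<bar> * (K * S x) + \<bar>m' x\<bar> * (K * S x) + \<bar>m x * r x\<bar> * (2 * (K * (K * S x)))"
      using Pb[OF x] PHb[OF x] HQ by (intro add_mono mult_left_mono) auto
    finally show ?thesis using key[OF x] m(2)[OF x] by (simp add: abs_mult)
  qed
  have g2b: "cmod (g2 x) \<le> E x * (C * \<rho>' x * S x)" if x: "x \<ge> 0" for x
  proof -
    have HQ: "cmod (- (Hm x * P x) + H0 x * Q x) \<le> E x * (2 * (K * (K * S x)))"
    proof -
      have "cmod (- (Hm x * P x) + H0 x * Q x) \<le> cmod (Hm x) * cmod (P x) + cmod (H0 x) * cmod (Q x)"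
        by (metis norm_minus_cancel norm_mult norm_triangle_ineq)
      also have "\<dots> \<le> (K * E x) * (K * S x) + K * (E x * (K * S x))"
        using H(1,3)[OF x] Pb[OF x] Qb[OF x] K E0[of x] S0[of x] by (intro add_mono mult_mono) auto
      finally show ?thesis by (simp add: mult_ac)
    qed
    have "cmod (g2 x) \<le> \<bar>q1 x\<bar> * cmod (Q x) + \<bar>m' x\<bar> * cmod (QH x) + \<bar>m x * r x\<bar> * cmod (- (Hm x * P x) + H0 x * Q x)"
      unfolding g2_def
      by (intro order_trans[OF norm_triangle_ineq4] add_mono) (auto simp: norm_mult abs_mult)
    also have "\<dots> \<le> \<bar>q1 x\<bar> * (E x * (K * S x)) + \<bar>m' x\<bar> * (E x * (K * S x)) + \<bar>m x * r x\<bar> * (E x * (2 * (K * (K * S x))))"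
      using Qb[OF x] QHb[OF x] HQ by (intro add_mono mult_left_mono) auto
    also have "\<dots> = E x * (\<bar>q1 x\<bar> * (K * S x) + \<bar>m' x\<bar> * (K * S x) + (m x * \<bar>r x\<bar>) * (2 * (K * (K * S x))))"
      using m(2)[OF x] by (simp add: abs_mult algebra_simps)
    also have "\<dots> \<le> E x * (C * \<rho>' x * S x)" using key[OF x] E0[of x] by (intro mult_left_mono) auto
    finally show ?thesis .
  qed
  have contS: "continuous_on {0..T} S" for T
    unfolding S_def E_def by (intro continuous_intros ac_prim_continuous[OF u] ac_prim_continuous[OF v]) auto
  have \<rho>S: "(\<lambda>x. \<rho>' x * S x) integrable_on {w..T}" if "w \<ge> 0" for w T
    by (intro abs_int_integrable abs_int_mult_continuous absolutely_integrable_on_subinterval[OF \<rho>(1)[of T]]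
         continuous_on_subset[OF contS[of T]]) (use that in auto)
  have \<rho>i: "\<rho>' integrable_on {w..T}" if "w \<ge> 0" for w T
    by (intro abs_int_integrable absolutely_integrable_on_subinterval[OF \<rho>(1)[of T]]) (use that in auto)
  have \<rho>0: "\<rho>' x \<ge> 0" for x by (simp add: \<rho>'_def)
  have C0: "C \<ge> 0" using K by (simp add: C_def)
  have z1d: "cmod (z1 x - z1 w) \<le> C * integral {w..x} (\<lambda>t. \<rho>' t * S t)" if "0 \<le> w" "w \<le> x" for w x
  proof -
    have "z1 x - z1 w = integral {w..x} g1" using ac_primD(2)[OF z1ac[of x], of w x] that by auto
    also have "cmod \<dots> \<le> integral {w..x} (\<lambda>t. C * (\<rho>' t * S t))"
    proof (rule integral_norm_bound_integral)
      show "g1 integrable_on {w..x}" by (rule abs_int_integrable[OF ac_primD(1)[OF ac_prim_sub[OF z1ac[of x]]]]) (use that in auto)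
      show "(\<lambda>t. C * (\<rho>' t * S t)) integrable_on {w..x}" using \<rho>S that by (intro integrable_on_mult_right) auto
    qed (use g1b that in \<open>auto simp: mult.assoc\<close>)
    finally show ?thesis by simp
  qed
  \<comment> \<open>\<open>E\<close> is nondecreasing, so it leaves the integral with its value at
    \<open>x\<close>. The initial term keeps its damping E w / E x: it is at most 1 for the Gronwall
    bound and tends to 0 when \<kappa> > 0.\<close>
  have z2d: "cmod (z2 x) / E x \<le> E w / E x * (cmod (z2 w) / E w) + C * integral {w..x} (\<lambda>t. \<rho>' t * S t)" if "0 \<le> w" "w \<le> x" for w x
  proof -
    have "z2 x - z2 w = integral {w..x} g2" using ac_primD(2)[OF z2ac[of x], of w x] that by auto
    also have "cmod \<dots> \<le> integral {w..x} (\<lambda>t. (E x * C) * (\<rho>' t * S t))"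
    proof (rule integral_norm_bound_integral)
      show "g2 integrable_on {w..x}" by (rule abs_int_integrable[OF ac_primD(1)[OF ac_prim_sub[OF z2ac[of x]]]]) (use that in auto)
      show "(\<lambda>t. (E x * C) * (\<rho>' t * S t)) integrable_on {w..x}" using \<rho>S that by (intro integrable_on_mult_right) auto
      fix t assume t: "t \<in> {w..x}"
      have "E t \<le> E x" using t kappa by (simp add: E_def mult_left_mono)
      then have "E t * (C * \<rho>' t * S t) \<le> E x * (C * \<rho>' t * S t)"
        using C0 \<rho>0 S0 by (intro mult_right_mono) auto
      then show "cmod (g2 t) \<le> (E x * C) * (\<rho>' t * S t)" using g2b[of t] t that by (simp add: mult.assoc)
    qed
    finally have "cmod (z2 x - z2 w) \<le> E x * (C * integral {w..x} (\<lambda>t. \<rho>' t * S t))" by (simp add: mult.assoc)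
    then have "cmod (z2 x) \<le> cmod (z2 w) + E x * (C * integral {w..x} (\<lambda>t. \<rho>' t * S t))"
      using norm_triangle_ineq2[of "z2 x" "z2 w"] by linarith
    then show ?thesis using E0[of x] E0[of w] by (simp add: field_simps)
  qed
  \<comment> \<open>Beyond \<open>x0\<close> the condition 4 K m \<le> 1 makes the change of
    variables close to the identity: each correction is at most S / 4, so the old and new norms
    differ by a factor of at most 2.\<close>
  have S_le: "S x \<le> 2 * (cmod (z1 x) + cmod (z2 x) / E x)" and zS: "cmod (z1 x) + cmod (z2 x) / E x \<le> 2 * S x" if x: "x \<ge> x0" for x
  proof -
    have x': "x \<ge> 0" using x x0 by simp
    have a1: "cmod (of_real (m x) * PH x) \<le> S x / 4"
    proof -
      have "m x * cmod (PH x) \<le> m x * (K * S x)" using m(2)[OF x'] PHb[OF x'] by (intro mult_left_mono) auto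
      also have "\<dots> \<le> S x / 4" using mult_right_mono[OF m(4)[OF x] S0[of x]] by (simp add: mult_ac)
      finally show ?thesis using m(2)[OF x'] by (simp add: norm_mult)
    qed
    have a2: "cmod (of_real (m x) * QH x) / E x \<le> S x / 4"
    proof -
      have "m x * cmod (QH x) \<le> m x * (E x * (K * S x))" using m(2)[OF x'] QHb[OF x'] by (intro mult_left_mono) auto
      also have "\<dots> \<le> E x * (S x / 4)" using mult_right_mono[OF m(4)[OF x] S0[of x]] E0[of x]
        by (simp add: mult_ac)
      finally show ?thesis using m(2)[OF x'] E0[of x] by (simp add: norm_mult field_simps)
    qed
    have "cmod (u x) \<le> cmod (z1 x) + cmod (of_real (m x) * PH x)" "cmod (z1 x) \<le> cmod (u x) + cmod (of_real (m x) * PH x)"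
      using norm_triangle_ineq4[of "z1 x" "of_real (m x) * PH x"] norm_triangle_ineq[of "u x" "of_real (m x) * PH x"] by (simp_all add: z1_def)
    moreover have "cmod (v x) \<le> cmod (z2 x) + cmod (of_real (m x) * QH x)" "cmod (z2 x) \<le> cmod (v x) + cmod (of_real (m x) * QH x)"
      using norm_triangle_ineq[of "z2 x" "of_real (m x) * QH x"] norm_triangle_ineq4[of "v x" "of_real (m x) * QH x"] by (simp_all add: z2_def)
    then have "cmod (v x) / E x \<le> cmod (z2 x) / E x + cmod (of_real (m x) * QH x) / E x"
      "cmod (z2 x) / E x \<le> cmod (v x) / E x + cmod (of_real (m x) * QH x) / E x"
      using E0[of x] by (simp_all add: divide_right_mono flip: add_divide_distrib)
    moreover have "S x = cmod (u x) + cmod (v x) / E x" by (simp add: S_def)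
    ultimately have "S x \<le> 2 * (cmod (z1 x) + cmod (z2 x) / E x) \<and> cmod (z1 x) + cmod (z2 x) / E x \<le> 2 * S x"
      using a1 a2 S0[of x] by argo
    then show "S x \<le> 2 * (cmod (z1 x) + cmod (z2 x) / E x)" "cmod (z1 x) + cmod (z2 x) / E x \<le> 2 * S x"
      by blast+
  qed
  have SL: "S x0 \<le> L"
  proof -
    have "1 \<le> E x0" using kappa x0 by (simp add: E_def)
    then have "cmod (v x0) / E x0 \<le> cmod (v x0) / 1" by (intro divide_left_mono) auto
    then show ?thesis using L by (simp add: S_def)
  qed
  have L0: "L \<ge> 0" using SL S0[of x0] by linarith
  have SM: "S x \<le> M" if x: "x \<ge> x0" for x
  proof -
    \<comment> \<open>Origin of the constants in \<open>M\<close>: passing to \<open>z1\<close>,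
      \<open>z2\<close> and back costs 2 twice, giving 4 L, and Gronwall doubles it to 8 L. The
      exponent is 4 times 4 C, that is 48 K^3, times the integral of the remainder.\<close>
    have "S x \<le> 2 * (4 * L) * exp (4 * integral {x0..x} (\<lambda>t. 4 * C * \<rho>' t))"
    proof (rule gronwall[where f=S and g="\<lambda>t. 4 * C * \<rho>' t" and a=x0 and b=x])
      show "(\<lambda>t. 4 * C * \<rho>' t) integrable_on {x0..x}" using x0 by (intro integrable_on_mult_right \<rho>i)
      show "continuous_on {x0..x} S" by (rule continuous_on_subset[OF contS[of x]]) (use x0 in auto)
      fix t assume t: "t \<in> {x0..x}"
      have "E x0 / E t * (cmod (z2 x0) / E x0) \<le> 1 * (cmod (z2 x0) / E x0)"
      proof (rule mult_right_mono)
        have "E x0 \<le> E t" using t kappa by (simp add: E_def mult_left_mono)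
        then show "E x0 / E t \<le> 1" using E0[of t] by simp
      qed (use E0[of x0] in simp)
      moreover have "cmod (z1 t) \<le> cmod (z1 x0) + cmod (z1 t - z1 x0)" using norm_triangle_ineq2[of "z1 t" "z1 x0"] by linarith
      ultimately have "cmod (z1 t) + cmod (z2 t) / E t \<le> (cmod (z1 x0) + cmod (z2 x0) / E x0) + 2 * (C * integral {x0..t} (\<lambda>t. \<rho>' t * S t))"
        using z1d[of x0 t] z2d[of x0 t] t x0 by auto
      also have "\<dots> \<le> 2 * L + 2 * (C * integral {x0..t} (\<lambda>t. \<rho>' t * S t))" using zS[of x0] SL by simp
      finally have "S t \<le> 4 * L + 4 * C * integral {x0..t} (\<lambda>t. \<rho>' t * S t)" using S_le[of t] t by auto
      then show "S t \<le> 4 * L + integral {x0..t} (\<lambda>t. 4 * C * \<rho>' t * S t)"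
        unfolding mult.assoc[of "4 * C"] by simp
    qed (use x C0 \<rho>0 L0 in auto)
    also have "\<dots> \<le> M"
    proof -
      have "integral {x0..x} \<rho>' \<le> integral {0..x} \<rho>'"
        by (rule integral_subset_le) (use x0 \<rho>i \<rho>0 in auto)
      then have "integral {x0..x} \<rho>' \<le> I" using \<rho>(3)[of x] by (simp add: \<rho>'_def[abs_def])
      then have "4 * (4 * C * integral {x0..x} \<rho>') \<le> 4 * (4 * C * I)" using C0 by (intro mult_left_mono) auto
      then have "exp (4 * integral {x0..x} (\<lambda>t. 4 * C * \<rho>' t)) \<le> exp (48 * K ^ 3 * I)" by (simp add: C_def)
      then show ?thesis unfolding M_def using L0 by (simp add: mult_left_mono)
    qed
    finally show ?thesis .
  qed
  have M0: "M \<ge> 0" using SM[of x0] S0[of x0] by simp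
  define R where "R x = I - integral {0..x} \<rho>'" for x
  have R_lim: "(R \<longlongrightarrow> 0) at_top"
  proof -
    have "((\<lambda>x. I - integral {0..x} \<rho>') \<longlongrightarrow> I - I) at_top"
      using \<rho>(2) by (intro tendsto_intros) (simp add: \<rho>'_def[abs_def])
    then show ?thesis by (simp add: R_def[abs_def])
  qed
  have int_R: "integral {w..x} (\<lambda>t. \<rho>' t * S t) \<le> M * R w" if "x0 \<le> w" "w \<le> x" for w x
  proof -
    have "integral {w..x} (\<lambda>t. \<rho>' t * S t) \<le> integral {w..x} (\<lambda>t. \<rho>' t * M)"
      by (rule integral_le) (use that x0 \<rho>S \<rho>i \<rho>0 SM in \<open>auto intro!: mult_left_mono integrable_on_mult_left\<close>)
    also have "\<dots> = integral {w..x} \<rho>' * M" by simp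
    also have "integral {w..x} \<rho>' = integral {0..x} \<rho>' - integral {0..w} \<rho>'"
    proof -
      have "integral {0..w} \<rho>' + integral {w..x} \<rho>' = integral {0..x} \<rho>'"
        using that x0 by (intro Henstock_Kurzweil_Integration.integral_combine \<rho>i) auto
      then show ?thesis by simp
    qed
    also have "\<dots> \<le> R w" using \<rho>(3)[of x] by (simp add: R_def \<rho>'_def[abs_def])
    finally show ?thesis using M0 by (simp add: mult_right_mono mult.commute)
  qed
  have z1c: "cmod (z1 x - z1 w) \<le> C * (M * R w)" if "x0 \<le> w" "w \<le> x" for w x
    using z1d[of w x] int_R[OF that] that x0 C0 by (meson mult_left_mono order_trans)
  have CR: "((\<lambda>w. C * (M * R w)) \<longlongrightarrow> 0) at_top"
    using tendsto_mult_right_zero[OF tendsto_mult_right_zero[OF R_lim]] by simp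
  \<comment> \<open>Sampling at unit steps reduces the existence of the limit to completeness for
    sequences. The estimate for all real x comes back by letting n tend to infinity in
    \<open>z1c\<close>.\<close>
  define X where "X n = z1 (x0 + real n)" for n
  have "Cauchy X"
  proof (rule metric_CauchyI)
    fix e :: real assume e: "e > 0"
    have "\<forall>\<^sub>F w in at_top. C * (M * R w) < e" using CR e by (rule order_tendstoD)
    then obtain w where w: "\<And>y. y \<ge> w \<Longrightarrow> C * (M * R y) < e" by (auto simp: eventually_at_top_linorder)
    obtain N where N: "real N \<ge> w" using real_arch_simple by blast
    have *: "dist (X p) (X n) < e" if "p \<ge> n" "n \<ge> N" for p n
    proof -
      have "cmod (X p - X n) \<le> C * (M * R (x0 + real n))" unfolding X_def using that x0 by (intro z1c) auto
      also have "\<dots> < e" using that N x0 by (intro w) auto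
      finally show ?thesis by (simp add: dist_norm)
    qed
    show "\<exists>N. \<forall>p\<ge>N. \<forall>n\<ge>N. dist (X p) (X n) < e"
    proof (intro exI[of _ N] allI impI)
      fix p n assume "N \<le> p" "N \<le> n"
      then show "dist (X p) (X n) < e" using *[of n p] *[of p n] by (cases "n \<le> p") (auto simp: dist_commute)
    qed
  qed
  then obtain A where A: "X \<longlonglongrightarrow> A" using Cauchy_convergent convergent_def by blast
  have z1A: "cmod (z1 x - A) \<le> C * (M * R x)" if "x \<ge> x0" for x
  proof -
    have "(\<lambda>n. cmod (z1 x - X n)) \<longlonglongrightarrow> cmod (z1 x - A)" by (intro tendsto_intros A)
    moreover have "\<forall>\<^sub>F n in sequentially. cmod (z1 x - X n) \<le> C * (M * R x)"
    proof -
      obtain N where "real N \<ge> x" using real_arch_simple by blast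
      then have "cmod (z1 x - X n) \<le> C * (M * R x)" if "n \<ge> N" for n
        using z1c[OF \<open>x \<ge> x0\<close>, of "x0 + real n"] x0 that by (simp add: X_def norm_minus_commute)
      then show ?thesis by (auto simp: eventually_sequentially)
    qed
    ultimately show ?thesis by (intro tendsto_upperbound) auto
  qed
  have "cmod (u x - A) \<le> C * (M * R x) + K * M * m x" if x: "x \<ge> x0" for x
  proof -
    have x': "x \<ge> 0" using x x0 by simp
    have "K * S x \<le> K * M" using K SM[OF x] by (intro mult_left_mono) auto
    then have "m x * cmod (PH x) \<le> m x * (K * M)" using m(2)[OF x'] PHb[OF x'] by (intro mult_left_mono) auto
    then have "cmod (of_real (m x) * PH x) \<le> K * M * m x" using m(2)[OF x'] by (simp add: norm_mult mult_ac)
    moreover have "cmod (u x - A) \<le> cmod (z1 x - A) + cmod (of_real (m x) * PH x)"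
      using norm_triangle_ineq4[of "z1 x - A" "of_real (m x) * PH x"] by (simp add: z1_def)
    ultimately show ?thesis using z1A[OF x] by linarith
  qed
  then show "\<exists>A. (\<forall>x\<ge>x0. cmod (u x - A) \<le> 3 * K ^ 3 * M * (I - integral {0..x} (\<lambda>x. \<bar>q1 x\<bar> + \<bar>m' x\<bar> + (m x)\<^sup>2)) + K * M * m x)"
    unfolding R_def C_def \<rho>'_def by (intro exI[of _ A]) (simp add: mult.assoc)
  assume kp: "\<kappa> > 0"
  show "((\<lambda>x. exp (- 2 * \<kappa> * x) * cmod (v x)) \<longlongrightarrow> 0) at_top"
  proof (rule tendstoI)
    fix e :: real assume e: "e > 0"
    then have "\<forall>\<^sub>F w in at_top. C * (M * R w) < e / 3" by (intro order_tendstoD(2)[OF CR]) simp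
    \<comment> \<open>The point \<open>w\<close> is chosen so far out that the integral beyond it
      contributes less than e/3. With \<open>w\<close> fixed, the damped initial term and the
      correction by \<open>QH\<close> become small as x grows.\<close>
    then obtain w where w: "w \<ge> x0" "C * (M * R w) < e / 3"
      by (auto simp: eventually_at_top_linorder) (metis linear)
    have "((\<lambda>x. exp (- 2 * \<kappa> * x)) \<longlongrightarrow> 0) at_top"
      using kp by (intro filterlim_compose[OF exp_at_bot] filterlim_tendsto_neg_mult_at_bot[OF tendsto_const _ filterlim_ident]) auto
    then have "((\<lambda>x. cmod (z2 w) * exp (- 2 * \<kappa> * x)) \<longlongrightarrow> 0) at_top" by (rule tendsto_mult_right_zero)
    then have "\<forall>\<^sub>F x in at_top. cmod (z2 w) * exp (- 2 * \<kappa> * x) < e / 3" by (rule order_tendstoD(2)) (use e in simp)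
    moreover have "((\<lambda>x. K * M * m x) \<longlongrightarrow> 0) at_top" using m(3) by (rule tendsto_mult_right_zero)
    then have "\<forall>\<^sub>F x in at_top. K * M * m x < e / 3" by (rule order_tendstoD(2)) (use e in simp)
    moreover have "\<forall>\<^sub>F x in at_top. x \<ge> w" by (rule eventually_ge_at_top)
    ultimately show "\<forall>\<^sub>F x in at_top. dist (exp (- 2 * \<kappa> * x) * cmod (v x)) 0 < e"
    proof eventually_elim
      case (elim x)
      then have x: "x \<ge> x0" "x \<ge> 0" using w x0 by auto
      have "cmod (z2 x) / E x \<le> E w / E x * (cmod (z2 w) / E w) + C * integral {w..x} (\<lambda>t. \<rho>' t * S t)"
        using z2d[of w x] elim w x0 by auto
      also have "E w / E x * (cmod (z2 w) / E w) = cmod (z2 w) * exp (- 2 * \<kappa> * x)"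
        unfolding Ei using E0[of w] by simp
      also have "C * integral {w..x} (\<lambda>t. \<rho>' t * S t) \<le> C * (M * R w)"
        using int_R[OF w(1) elim(3)] C0 by (rule mult_left_mono)
      finally have 1: "cmod (z2 x) / E x < 2 * (e / 3)" using elim w by linarith
      have "cmod (v x) \<le> cmod (z2 x) + cmod (of_real (m x) * QH x)"
        using norm_triangle_ineq[of "z2 x" "of_real (m x) * QH x"] by (simp add: z2_def)
      also have "cmod (of_real (m x) * QH x) \<le> m x * (E x * (K * M))"
      proof -
        have "E x * (K * S x) \<le> E x * (K * M)" using K SM[OF x(1)] E0[of x] by (intro mult_left_mono) auto
        then have "m x * cmod (QH x) \<le> m x * (E x * (K * M))"
          using m(2)[OF x(2)] QHb[OF x(2)] by (intro mult_left_mono) auto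
        then show ?thesis using m(2)[OF x(2)] by (simp add: norm_mult)
      qed
      finally have "cmod (v x) / E x \<le> cmod (z2 x) / E x + K * M * m x"
        using E0[of x] by (simp add: field_simps)
      then have "cmod (v x) / E x < e" using 1 elim(2) by linarith
      then show ?case unfolding Ei using E0[of x] by (simp add: abs_of_nonneg)
    qed
  qed
qed

section \<open>Bloch solutions\<close>

text \<open>Removing whole periods moves the point into {0..a}. The removed length differs from x by
  at most one period, which costs the factor exp(|\<sigma>| a).\<close>

lemma quasi_periodic_bound:
  fixes P :: "real \<Rightarrow> complex"
  assumes a: "a > 0" and per: "\<And>x. P (x + a) = \<zeta> * P x" and z: "cmod \<zeta> = exp (\<sigma> * a)"
    and bnd: "\<And>x. x \<in> {0..a} \<Longrightarrow> cmod (P x) \<le> K" and x: "x \<ge> 0"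
  shows "cmod (P x) \<le> K * exp (\<bar>\<sigma>\<bar> * a) * exp (\<sigma> * x)"
proof -
  define n where "n = nat \<lfloor>x / a\<rfloor>"
  define y where "y = x - real n * a"
  have "real n \<le> x / a" "x / a < real n + 1" using x a by (auto simp: n_def)
  then have y: "0 \<le> y" "y \<le> a" using a by (auto simp: y_def field_simps)
  have "P (y + real j * a) = \<zeta> ^ j * P y" for j
  proof (induction j)
    case (Suc j)
    have "P (y + real (Suc j) * a) = P ((y + real j * a) + a)" by (simp add: algebra_simps)
    also have "\<dots> = \<zeta> ^ Suc j * P y" using Suc by (simp add: per)
    finally show ?case .
  qed simp
  from this[of n] have "cmod (P x) = exp (\<sigma> * a) ^ n * cmod (P y)"
    by (simp add: y_def norm_mult norm_power z)
  also have "exp (\<sigma> * a) ^ n = exp (\<sigma> * (x - y))"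
    by (simp add: y_def algebra_simps flip: exp_of_nat_mult)
  also have "\<dots> \<le> exp (\<bar>\<sigma>\<bar> * a) * exp (\<sigma> * x)"
  proof -
    have "- \<sigma> * y \<le> \<bar>\<sigma>\<bar> * a" using y by (intro mult_mono) auto
    then show ?thesis by (simp add: algebra_simps flip: exp_add)
  qed
  finally have 1: "cmod (P x) \<le> exp (\<bar>\<sigma>\<bar> * a) * exp (\<sigma> * x) * cmod (P y)" by (simp add: mult_right_mono)
  also have "\<dots> \<le> exp (\<bar>\<sigma>\<bar> * a) * exp (\<sigma> * x) * K" using bnd[of y] y by (intro mult_left_mono) auto
  finally show ?thesis by (simp add: mult_ac)
qed

text \<open>The Bloch condition is imposed on the solutions alone; differentiating it transfers the
  multiplier to their derivatives.\<close>

lemma sl_solution_quasi_periodic_deriv: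
  assumes y: "sl_solution q lam UNIV y y'" and per: "\<And>x. y (x + a) = \<zeta> * y x"
  shows "y' (x + a) = \<zeta> * y' x"
proof -
  have d: "(y has_vector_derivative y' x) (at x)" for x using y by (simp add: sl_solution_def)
  have "((\<lambda>x. x + a) has_vector_derivative 1) (at x)" by (auto intro!: derivative_eq_intros)
  from vector_diff_chain_at[OF this d] have "((\<lambda>x. y (x + a)) has_vector_derivative y' (x + a)) (at x)"
    by (simp add: o_def)
  moreover have "((\<lambda>x. y (x + a)) has_vector_derivative \<zeta> * y' x) (at x)"
    unfolding per by (intro has_vector_derivative_mult_right d)
  ultimately show ?thesis by (rule vector_derivative_unique_at)
qed

text \<open>If \<open>y\<close> vanished, the integrated equation would keep \<open>y'\<close> equal
  to 1, and then \<open>y\<close> would have to grow.\<close>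

lemma sl_solution_nontrivial:
  assumes y: "sl_solution Q lam {0..} y y'" "y 0 = 0" "y' 0 = 1" and Q: "loc_int {0..} Q"
  shows "\<exists>x\<ge>0. y x \<noteq> 0"
proof (rule ccontr)
  assume "\<not> (\<exists>x\<ge>0. y x \<noteq> 0)"
  then have z: "y x = 0" if "x \<ge> 0" for x using that by auto
  have Qi: "Q absolutely_integrable_on {0..1}" using Q by (auto simp: loc_int_def)
  note ac = sl_solution_ac_prim[OF y(1) _ Qi, simplified]
  have "y' x = 1" if "x \<in> {0..1}" for x
  proof -
    have "integral {0..x} (\<lambda>t. (complex_of_real (Q t) - lam) * y t) = integral {0..x} (\<lambda>t. 0)"
      by (rule integral_cong) (use z in auto)
    then show ?thesis using ac_primD(2)[OF ac(2), of 0 x] that y by simp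
  qed
  then have "integral {0..1} y' = integral {0..1} (\<lambda>t::real. 1::complex)" by (intro integral_cong) auto
  then show False using ac_primD(2)[OF ac(1), of 0 1] z[of 0] z[of 1] by simp
qed

text \<open>Regularity in the spectral parameter is given for the values of the Bloch solutions and
  must be derived for their derivatives. In P t = P 0 th t + dP 0 ph t one can solve for
  \<open>dP 0\<close> near a given parameter once t is chosen with ph t nonzero there. The choice of
  t is local, which suffices for continuity and holomorphy. Expansion in \<open>th'\<close>,
  \<open>ph'\<close> then carries the result to every x.\<close>

lemma sl_solution_family_deriv_regular:
  assumes q: "loc_int {0..} q" and Hp: "open Hp" "Hp \<subseteq> G"
    and sol: "\<And>lam. lam \<in> G \<Longrightarrow> sl_solution q lam {0..} (\<lambda>x. P x lam) (\<lambda>x. dP x lam)"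
    and cont: "\<And>x. continuous_on G (P x)" and hol: "\<And>x. P x holomorphic_on Hp"
    and x: "x \<ge> 0"
  shows "continuous_on G (dP x)" "dP x holomorphic_on Hp"
proof -
  have qi: "q absolutely_integrable_on {0..T}" for T
    using q by (cases "T \<ge> 0") (auto simp: loc_int_def)
  have "\<forall>lam. \<exists>y y'. sl_solution q lam {0..} y y' \<and> y 0 = 1 \<and> y' 0 = 0"
    using sl_solution_exists_half_line[OF qi] by blast
  then obtain th th' where th: "\<And>lam. sl_solution q lam {0..} (th lam) (th' lam)" "\<And>lam. th lam 0 = 1" "\<And>lam. th' lam 0 = 0"
    by metis
  have "\<forall>lam. \<exists>y y'. sl_solution q lam {0..} y y' \<and> y 0 = 0 \<and> y' 0 = 1"
    using sl_solution_exists_half_line[OF qi] by blast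
  then obtain ph ph' where ph: "\<And>lam. sl_solution q lam {0..} (ph lam) (ph' lam)" "\<And>lam. ph lam 0 = 0" "\<And>lam. ph' lam 0 = 1"
    by metis
  note thh = sl_family_holomorphic[OF th q] and phh = sl_family_holomorphic[OF ph q]
  have ex: "P t lam = P 0 lam * th lam t + dP 0 lam * ph lam t" "dP t lam = P 0 lam * th' lam t + dP 0 lam * ph' lam t"
    if "lam \<in> G" "t \<ge> 0" for lam t
    using sl_solution_expand[OF sol[OF that(1)] th ph q, of t] that by auto
  have loc: "\<exists>N t. open N \<and> l \<in> N \<and> t \<ge> 0 \<and> (\<forall>lam\<in>N. ph lam t \<noteq> 0) \<and>
      (\<forall>lam\<in>N \<inter> G. dP 0 lam = (P t lam - P 0 lam * th lam t) / ph lam t)" for l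
  proof -
    obtain t where t: "t \<ge> 0" "ph l t \<noteq> 0" using sl_solution_nontrivial[OF ph q] by blast
    define N where "N = (\<lambda>lam. ph lam t) -` (- {0})"
    have "open N" unfolding N_def
      using holomorphic_on_imp_continuous_on[OF phh(1)[OF t(1)]] by (intro open_vimage) auto
    moreover have "dP 0 lam = (P t lam - P 0 lam * th lam t) / ph lam t" if "lam \<in> N \<inter> G" for lam
      using ex(1)[of lam t] that t by (simp add: N_def)
    ultimately show ?thesis using t by (intro exI[of _ N] exI[of _ t]) (auto simp: N_def)
  qed
  have c0: "continuous_on G (dP 0)"
    unfolding continuous_on_eq_continuous_within
  proof
    fix l assume l: "l \<in> G"
    obtain N t where N: "open N" "l \<in> N" "t \<ge> 0" "\<And>lam. lam \<in> N \<Longrightarrow> ph lam t \<noteq> 0"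
      "\<And>lam. lam \<in> N \<inter> G \<Longrightarrow> dP 0 lam = (P t lam - P 0 lam * th lam t) / ph lam t" using loc[of l] by blast
    have "continuous_on (N \<inter> G) (\<lambda>lam. (P t lam - P 0 lam * th lam t) / ph lam t)"
      using N(4) by (intro continuous_intros continuous_on_subset[OF cont]
         continuous_on_subset[OF holomorphic_on_imp_continuous_on[OF thh(1)[OF N(3)]]]
         continuous_on_subset[OF holomorphic_on_imp_continuous_on[OF phh(1)[OF N(3)]]]) auto
    then have "continuous_on (N \<inter> G) (dP 0)" using N(5) by (simp cong: continuous_on_cong_simp)
    then have "continuous (at l within N \<inter> G) (dP 0)"
      using l N(2) by (simp add: continuous_on_eq_continuous_within)
    moreover have "at l within N \<inter> G = at l within G"
      by (rule at_within_nhd[OF N(2,1)]) auto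
    ultimately show "continuous (at l within G) (dP 0)" by simp
  qed
  have h0: "dP 0 holomorphic_on Hp"
    unfolding holomorphic_on_def
  proof
    fix l assume l: "l \<in> Hp"
    obtain N t where N: "open N" "l \<in> N" "t \<ge> 0" "\<And>lam. lam \<in> N \<Longrightarrow> ph lam t \<noteq> 0"
      "\<And>lam. lam \<in> N \<inter> G \<Longrightarrow> dP 0 lam = (P t lam - P 0 lam * th lam t) / ph lam t" using loc[of l] by blast
    have "(\<lambda>lam. (P t lam - P 0 lam * th lam t) / ph lam t) holomorphic_on (N \<inter> Hp)"
      using N(4) by (intro holomorphic_intros holomorphic_on_subset[OF hol]
         holomorphic_on_subset[OF thh(1)[OF N(3)]] holomorphic_on_subset[OF phh(1)[OF N(3)]]) auto
    then have "dP 0 holomorphic_on (N \<inter> Hp)"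
      by (rule holomorphic_transform) (use N(5) Hp in auto)
    then show "dP 0 field_differentiable at l within Hp"
      using l N Hp by (meson IntI field_differentiable_at_within holomorphic_on_imp_differentiable_at open_Int)
  qed
  have "continuous_on G (\<lambda>lam. P 0 lam * th' lam x + dP 0 lam * ph' lam x)"
    by (intro continuous_intros cont c0
         continuous_on_subset[OF holomorphic_on_imp_continuous_on[OF thh(2)[OF x]]]
         continuous_on_subset[OF holomorphic_on_imp_continuous_on[OF phh(2)[OF x]]]) auto
  then show "continuous_on G (dP x)" using ex(2)[OF _ x] by (simp cong: continuous_on_cong_simp)
  have "(\<lambda>lam. P 0 lam * th' lam x + dP 0 lam * ph' lam x) holomorphic_on Hp"
    by (intro holomorphic_intros hol h0 holomorphic_on_subset[OF thh(2)[OF x]] holomorphic_on_subset[OF phh(2)[OF x]]) auto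
  then show "dP x holomorphic_on Hp"
    by (rule holomorphic_transform) (use ex(2)[OF _ x] Hp in auto)
qed

text \<open>Unlike \<open>at l within G\<close>, this filter does not exclude \<open>l\<close>.
  Properties that hold eventually therefore hold at \<open>l\<close> itself when \<open>l\<close> is
  in \<open>G\<close>, so one estimate covers a boundary point together with the nearby points above
  it.\<close>

definition near_in :: "complex set \<Rightarrow> complex \<Rightarrow> complex filter" where
  "near_in G l = inf (nhds l) (principal G)"

lemma tendsto_near_in:
  assumes "continuous_on G f" "l \<in> G"
  shows "(f \<longlongrightarrow> f l) (near_in G l)"
proof (rule topological_tendstoI)
  fix S assume S: "open S" "f l \<in> S"
  have "\<exists>A. open A \<and> l \<in> A \<and> (\<forall>y\<in>G. y \<in> A \<longrightarrow> f y \<in> S)"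
    using assms S unfolding continuous_on_topological by blast
  then show "\<forall>\<^sub>F x in near_in G l. f x \<in> S"
    unfolding near_in_def eventually_inf_principal eventually_nhds by blast
qed

lemma near_in_norm_bounded:
  fixes f :: "complex \<Rightarrow> 'a::real_normed_vector"
  assumes "continuous_on G f" "l \<in> G"
  shows "\<forall>\<^sub>F x in near_in G l. norm (f x) \<le> norm (f l) + 1"
  using order_tendstoD(2)[OF tendsto_norm[OF tendsto_near_in[OF assms]], of "norm (f l) + 1"]
  by (auto elim: eventually_mono)

lemma near_in_norm_lower:
  fixes f :: "complex \<Rightarrow> 'a::real_normed_vector"
  assumes "continuous_on G f" "l \<in> G" "f l \<noteq> 0"
  shows "\<forall>\<^sub>F x in near_in G l. norm (f x) \<ge> norm (f l) / 2"
  using order_tendstoD(1)[OF tendsto_norm[OF tendsto_near_in[OF assms(1,2)]], of "norm (f l) / 2"] assms(3)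
  by (auto elim: eventually_mono)

lemma near_in_memb: "\<forall>\<^sub>F x in near_in G l. x \<in> G"
  by (simp add: near_in_def eventually_inf_principal)

lemma near_in_ball:
  assumes "\<forall>\<^sub>F x in near_in G l. Pr x"
  shows "\<exists>r>0. \<forall>x \<in> G \<inter> ball l r. Pr x"
  using assms unfolding near_in_def eventually_inf_principal eventually_nhds_metric
  by (auto simp: dist_commute)

text \<open>The derivative is integrable because \<open>m\<close> is monotone and bounded, the
  square because 2 \<gamma> > 1. The bound 1 + 1 / (2 \<gamma> - 1) is read off an explicit
  antiderivative.\<close>

lemma power_decay:
  fixes \<gamma> :: real
  assumes g: "1/2 < \<gamma>"
  defines "m \<equiv> \<lambda>x. (x + 1) powr - \<gamma>" and "m' \<equiv> \<lambda>x. - \<gamma> * (x + 1) powr (- \<gamma> - 1)"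
  shows "ac_prim 0 T (\<lambda>x. complex_of_real (m x)) (\<lambda>x. complex_of_real (m' x))"
    and "x \<ge> 0 \<Longrightarrow> 0 \<le> m x \<and> m x \<le> 1" and "(m \<longlongrightarrow> 0) at_top"
    and "(\<lambda>x. \<bar>m' x\<bar> + (m x)\<^sup>2) absolutely_integrable_on {0..T}"
    and "integral {0..T} (\<lambda>x. \<bar>m' x\<bar> + (m x)\<^sup>2) \<le> 1 + 1 / (2 * \<gamma> - 1)"
proof -
  have pd: "((\<lambda>x. (x + 1) powr r) has_real_derivative r * (x + 1) powr (r - 1)) (at x within S)" if "x \<ge> 0" for x r S
  proof -
    have "((\<lambda>x. (x + 1) powr r) has_real_derivative r * (x + 1) powr (r - 1) * 1) (at x within S)"
      by (rule DERIV_chain2[OF has_real_derivative_powr]) (use that in \<open>auto intro!: derivative_eq_intros\<close>)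
    then show ?thesis by simp
  qed
  have dm: "(m has_real_derivative m' x) (at x within S)" if "x \<ge> 0" for x S
    unfolding m_def m'_def by (rule pd[OF that])
  have cm': "continuous_on {0..T} m'" for T
    unfolding m'_def by (intro continuous_intros) auto
  have cm: "continuous_on {0..T} m" for T
    unfolding m_def by (intro continuous_intros) auto
  show "ac_prim 0 T (\<lambda>x. complex_of_real (m x)) (\<lambda>x. complex_of_real (m' x))"
    by (rule ac_prim_C1) (auto intro!: has_vector_derivative_of_real dm continuous_intros cm' simp: has_real_derivative_iff_has_vector_derivative[symmetric])
  have m1: "m x \<le> 1" if "x \<ge> 0" for x
    using powr_mono2'[of "- \<gamma>" 1 "x+1"] g that by (simp add: m_def)
  then show "x \<ge> 0 \<Longrightarrow> 0 \<le> m x \<and> m x \<le> 1" by (simp add: m_def)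
  have "filterlim (\<lambda>x::real. x + 1) at_top at_top"
    using filterlim_tendsto_add_at_top[OF tendsto_const[of "1::real"] filterlim_ident] by (simp add: add.commute)
  then show "(m \<longlongrightarrow> 0) at_top" unfolding m_def
    using g by (intro tendsto_neg_powr) auto
  have cf: "continuous_on {0..T} (\<lambda>x. \<bar>m' x\<bar> + (m x)\<^sup>2)" for T
    by (intro continuous_intros cm cm')
  then show "(\<lambda>x. \<bar>m' x\<bar> + (m x)\<^sup>2) absolutely_integrable_on {0..T}"
    by (rule absolutely_integrable_continuous_real)
  show "integral {0..T} (\<lambda>x. \<bar>m' x\<bar> + (m x)\<^sup>2) \<le> 1 + 1 / (2 * \<gamma> - 1)"
  proof (cases "T \<ge> 0")
    case False
    then show ?thesis using g by simp
  next
    case T: True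
    \<comment> \<open>This antiderivative is nonpositive, so the integral up to any \<open>T\<close>
      is at most -F 0, which is the asserted constant.\<close>
    define F where "F x = - m x - (x + 1) powr (1 - 2 * \<gamma>) / (2 * \<gamma> - 1)" for x
    have "((\<lambda>x. \<bar>m' x\<bar> + (m x)\<^sup>2) has_integral (F T - F 0)) {0..T}"
    proof (rule fundamental_theorem_of_calculus[OF T])
      fix x assume x: "x \<in> {0..T}"
      have "\<bar>m' x\<bar> = - m' x" using g by (simp add: m'_def abs_mult)
      moreover have "(m x)\<^sup>2 = (x + 1) powr (- 2 * \<gamma>)" by (simp add: m_def power2_eq_square flip: powr_add)
      moreover have D2: "((\<lambda>x. (x + 1) powr (1 - 2 * \<gamma>) / (2 * \<gamma> - 1)) has_real_derivative - ((x + 1) powr (- 2 * \<gamma>))) (at x within {0..T})"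
      proof -
        have "((\<lambda>x. (x + 1) powr (1 - 2 * \<gamma>)) has_real_derivative (1 - 2 * \<gamma>) * (x + 1) powr (- 2 * \<gamma>)) (at x within {0..T})"
          using pd[of x "1 - 2 * \<gamma>"] x by simp
        from DERIV_cdivide[OF this, of "2 * \<gamma> - 1"] show ?thesis
          by (rule DERIV_cong) (use g in \<open>simp add: divide_eq_eq algebra_simps\<close>)
      qed
      ultimately have "(F has_real_derivative \<bar>m' x\<bar> + (m x)\<^sup>2) (at x within {0..T})"
        unfolding F_def by (intro DERIV_cong[OF DERIV_diff[OF DERIV_minus[OF dm] D2]]) (use x in auto)
      then show "(F has_vector_derivative \<bar>m' x\<bar> + (m x)\<^sup>2) (at x within {0..T})"
        by (simp add: has_real_derivative_iff_has_vector_derivative)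
    qed
    then have "integral {0..T} (\<lambda>x. \<bar>m' x\<bar> + (m x)\<^sup>2) = F T - F 0" by (rule integral_unique)
    moreover have "F T \<le> 0"
    proof -
      have "(T + 1) powr (1 - 2 * \<gamma>) / (2 * \<gamma> - 1) \<ge> 0" "m T \<ge> 0" using g by (simp_all add: m_def)
      then show ?thesis by (simp add: F_def)
    qed
    moreover have "F 0 = - 1 - 1 / (2 * \<gamma> - 1)" by (simp add: F_def m_def)
    ultimately show ?thesis by simp
  qed
qed

text \<open>The initial values \<open>y0\<close>, \<open>y1\<close> are real numbers, to be sin
  \<alpha> and cos \<alpha>. Their reality makes the solution real on the spectrum, which is the
  source of the conjugate amplitude there.\<close>

locale perturbed_hill =
  fixes a c \<omega> \<delta> \<gamma> :: real and q q1 :: "real \<Rightarrow> real" and k :: "complex \<Rightarrow> complex"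
    and psp dpsp psm dpsm :: "real \<Rightarrow> complex \<Rightarrow> complex" and y0 y1 :: real
  assumes a_pos: "a > 0"
    and q_per: "\<forall>x. q (x + a) = q x"
    and q_L1: "q absolutely_integrable_on {0..a}"
    and gamma: "1/2 < \<gamma>"
    and q1_L1: "q1 absolutely_integrable_on {0..}"
    and nonres: "2 * a * \<omega> / pi \<notin> \<int>"
    and k_qm: "is_quasi_momentum q a k"
    and bloch: "is_bloch_pair q a k psp dpsp psm dpsm"
begin

definition "Q = (\<lambda>x. q x + c * sin (2 * \<omega> * x + \<delta>) / (x + 1) powr \<gamma> + q1 x)"
definition "Hp = {z. Im z > 0}"
definition "B = spec_per q a - band_edges q a"
definition "G = Hp \<union> B"
definition "W lam = wronsk (psp 0 lam) (dpsp 0 lam) (psm 0 lam) (dpsm 0 lam)"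
definition "\<kappa> lam = Im (k lam) / a"
definition "s x = c * sin (2 * \<omega> * x + \<delta>)"
definition "m x = (x + 1) powr - \<gamma>"
definition "m' x = - \<gamma> * (x + 1) powr (- \<gamma> - 1)"
definition "bloch_bounded K lam \<longleftrightarrow> (\<forall>x\<ge>0.
    cmod (psp x lam) \<le> K * exp (- \<kappa> lam * x) \<and> cmod (dpsp x lam) \<le> K * exp (- \<kappa> lam * x) \<and>
    cmod (psm x lam) \<le> K * exp (\<kappa> lam * x) \<and> cmod (dpsm x lam) \<le> K * exp (\<kappa> lam * x))"
text \<open>The size of what the transformation leaves over: \<open>q1\<close> is untouched, m'
  comes from differentiating the factor of the primitives, and m^2 from inserting the system once
  more into m times a primitive.\<close>

definition "\<rho> x = \<bar>q1 x\<bar> + \<bar>m' x\<bar> + (m x)\<^sup>2"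

lemma q_loc: "loc_int UNIV q"
  by (rule periodic_loc_int[OF q_per q_L1 a_pos])

lemma q_int: "q absolutely_integrable_on {u..v}"
  using q_loc by (simp add: loc_int_def)

lemma q1_int: "q1 absolutely_integrable_on {0..T}"
  by (rule absolutely_integrable_on_subinterval[OF q1_L1]) auto

lemma Q_int: "Q absolutely_integrable_on {0..T}"
proof -
  have "(\<lambda>x. c * sin (2 * \<omega> * x + \<delta>) / (x + 1) powr \<gamma>) absolutely_integrable_on {0..T}"
    by (intro absolutely_integrable_continuous_real continuous_intros) auto
  then show ?thesis unfolding Q_def by (intro set_integral_add(1) q_int q1_int)
qed

lemma Q_loc: "loc_int {0..} Q"
  unfolding loc_int_def
  by (intro ballI absolutely_integrable_on_subinterval[OF Q_int]) auto

lemma Q_minus_q: "x \<ge> 0 \<Longrightarrow> Q x - q x = m x * s x + q1 x"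
  by (simp add: Q_def m_def s_def powr_minus_divide)

lemma rho_converges:
  "\<rho> absolutely_integrable_on {0..T}"
  "\<exists>I. ((\<lambda>x. integral {0..x} \<rho>) \<longlongrightarrow> I) at_top \<and> (\<forall>x. integral {0..x} \<rho> \<le> I)"
proof -
  have r: "\<rho> = (\<lambda>x. \<bar>q1 x\<bar> + (\<bar>m' x\<bar> + (m x)\<^sup>2))" by (auto simp: \<rho>_def)
  have mm: "(\<lambda>x. \<bar>m' x\<bar> + (m x)\<^sup>2) absolutely_integrable_on {0..T}"
    "integral {0..T} (\<lambda>x. \<bar>m' x\<bar> + (m x)\<^sup>2) \<le> 1 + 1 / (2 * \<gamma> - 1)" for T
    unfolding m_def m'_def using power_decay(4,5)[OF gamma, of T] by simp_all
  have qq: "(\<lambda>x. \<bar>q1 x\<bar>) absolutely_integrable_on {0..T}" for T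
    using q1_int by (simp add: absolutely_integrable_abs_iff)
  show i: "\<rho> absolutely_integrable_on {0..T}" for T
    unfolding r by (intro set_integral_add(1) mm qq)
  have qI: "(\<lambda>x. \<bar>q1 x\<bar>) integrable_on {0..}" using q1_L1 by (simp add: absolutely_integrable_on_def)
  show "\<exists>I. ((\<lambda>x. integral {0..x} \<rho>) \<longlongrightarrow> I) at_top \<and> (\<forall>x. integral {0..x} \<rho> \<le> I)"
  proof (rule bounded_integral_converges)
    show "\<rho> integrable_on {0..x}" for x by (rule abs_int_integrable[OF i])
    show "\<rho> x \<ge> 0" for x by (simp add: \<rho>_def)
    fix x
    have "integral {0..x} \<rho> = integral {0..x} (\<lambda>x. \<bar>q1 x\<bar>) + integral {0..x} (\<lambda>x. \<bar>m' x\<bar> + (m x)\<^sup>2)"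
      unfolding r by (intro Henstock_Kurzweil_Integration.integral_add abs_int_integrable qq mm)
    moreover have "integral {0..x} (\<lambda>x. \<bar>q1 x\<bar>) \<le> integral {0..} (\<lambda>x. \<bar>q1 x\<bar>)"
      by (intro integral_subset_le abs_int_integrable[OF qq] qI) auto
    ultimately show "integral {0..x} \<rho> \<le> integral {0..} (\<lambda>x. \<bar>q1 x\<bar>) + (1 + 1 / (2 * \<gamma> - 1))"
      using mm(2)[of x] by linarith
  qed
qed

lemma Hp_open: "open Hp" "Hp \<subseteq> G"
  by (auto simp: Hp_def G_def open_halfspace_Im_gt)

lemma bloch_facts:
  shows "lam \<in> G \<Longrightarrow> sl_solution q lam UNIV (\<lambda>x. psp x lam) (\<lambda>x. dpsp x lam)"
    "lam \<in> G \<Longrightarrow> sl_solution q lam UNIV (\<lambda>x. psm x lam) (\<lambda>x. dpsm x lam)"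
    "lam \<in> G \<Longrightarrow> psp (x + a) lam = exp (\<i> * k lam) * psp x lam"
    "lam \<in> G \<Longrightarrow> psm (x + a) lam = exp (- \<i> * k lam) * psm x lam"
    "lam \<in> G \<Longrightarrow> W lam \<noteq> 0"
    "psp x holomorphic_on Hp" "psm x holomorphic_on Hp"
    "continuous_on G (psp x)" "continuous_on G (psm x)"
    "W holomorphic_on Hp" "continuous_on G W"
    "lam \<in> B \<Longrightarrow> psp x lam = cnj (psm x lam)" "lam \<in> B \<Longrightarrow> dpsp x lam = cnj (dpsm x lam)"
    "lam \<in> B \<Longrightarrow> Re (W lam) = 0"
  using bloch unfolding is_bloch_pair_def Let_def G_def B_def Hp_def W_def[abs_def] by blast+

lemma k_facts:
  "continuous_on G k" "lam \<in> B \<Longrightarrow> k lam \<in> \<real>" "lam \<in> Hp \<Longrightarrow> Im (k lam) > 0" "lam \<in> B \<Longrightarrow> lam \<in> \<real>"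
proof -
  have c: "continuous_on {z. Im z \<ge> 0} k" and p: "lam \<in> Hp \<Longrightarrow> Im (k lam) > 0"
    using k_qm by (auto simp: is_quasi_momentum_def Hp_def)
  show "continuous_on G k"
    by (rule continuous_on_subset[OF c]) (auto simp: G_def Hp_def B_def spec_per_def complex_is_Real_iff)
  show "lam \<in> Hp \<Longrightarrow> Im (k lam) > 0" by (rule p)
  show "lam \<in> B \<Longrightarrow> k lam \<in> \<real>"
    using quasi_momentum_spec(1)[OF k_qm q_loc a_pos] by (auto simp: B_def)
  show "lam \<in> B \<Longrightarrow> lam \<in> \<real>" by (auto simp: B_def spec_per_def)
qed

lemma kappa_nonneg: "lam \<in> G \<Longrightarrow> \<kappa> lam \<ge> 0"
  using k_facts(2,3)[of lam] a_pos by (auto simp: G_def \<kappa>_def complex_is_Real_iff)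

lemma bloch_deriv_regular:
  assumes "x \<ge> 0"
  shows "continuous_on G (dpsp x)" "dpsp x holomorphic_on Hp" "continuous_on G (dpsm x)" "dpsm x holomorphic_on Hp"
proof -
  have q: "loc_int {0..} q" using q_loc by (rule loc_int_subset) simp
  have sol: "sl_solution q lam {0..} (\<lambda>x. psp x lam) (\<lambda>x. dpsp x lam)"
    "sl_solution q lam {0..} (\<lambda>x. psm x lam) (\<lambda>x. dpsm x lam)" if "lam \<in> G" for lam
    by (rule sl_solution_subset[OF bloch_facts(1)[OF that]], simp, simp add: is_interval_ci)
       (rule sl_solution_subset[OF bloch_facts(2)[OF that]], simp, simp add: is_interval_ci)
  note r = sl_solution_family_deriv_regular[OF q Hp_open _ _ _ assms]
  show "continuous_on G (dpsp x)" "dpsp x holomorphic_on Hp"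
    by (rule r[where P=psp]; intro sol bloch_facts; assumption)+
  show "continuous_on G (dpsm x)" "dpsm x holomorphic_on Hp"
    by (rule r[where P=psm]; intro sol bloch_facts; assumption)+
qed

lemma W_const:
  assumes "lam \<in> G"
  shows "dpsp x lam * psm x lam - psp x lam * dpsm x lam = W lam"
  using wronsk_constant[OF bloch_facts(1,2)[OF assms] q_loc, of 0 x] by (simp add: W_def wronsk_def)

text \<open>Near \<open>l\<close> the parameter, the quasi-momentum and the initial values stay
  within 1 of those at \<open>l\<close>. This bounds the Bloch solutions on one period by
  \<open>N * J\<close>, and the multiplier extends the bound to the half line at a cost of exp(|k|),
  for which \<open>Kk\<close> is a local bound.\<close>

lemma bloch_bounds:
  assumes l: "l \<in> G"
  shows "\<exists>K\<ge>0. \<forall>\<^sub>F lam in near_in G l. bloch_bounded K lam"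
proof -
  define J where "J = 2 * exp (4 * integral {0..a} (\<lambda>s. 1 + \<bar>q s\<bar> + (cmod l + 1)))"
  define Kk where "Kk = cmod (k l) + 1"
  define N where "N = (cmod (psp 0 l) + 1) + (cmod (dpsp 0 l) + 1) + (cmod (psm 0 l) + 1) + (cmod (dpsm 0 l) + 1)"
  have q: "loc_int {0..} q" using q_loc by (rule loc_int_subset) simp
  have N0: "N \<ge> 0" by (simp add: N_def)
  have J0: "J \<ge> 0" by (simp add: J_def)
  have gen: "cmod (P x) \<le> N * J * exp Kk * exp (\<sigma> * x) \<and> cmod (P' x) \<le> N * J * exp Kk * exp (\<sigma> * x)"
    if lam: "cmod lam \<le> cmod l + 1" and sol: "sl_solution q lam UNIV P P'" and per: "\<And>x. P (x + a) = \<zeta> * P x"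
      and z: "cmod \<zeta> = exp (\<sigma> * a)" and sg: "\<bar>\<sigma>\<bar> * a \<le> Kk" and n: "cmod (P 0) + cmod (P' 0) \<le> N" and x: "x \<ge> 0"
    for lam P P' \<zeta> \<sigma> x
  proof -
    have b: "cmod (P t) + cmod (P' t) \<le> N * J" if t: "t \<in> {0..a}" for t
    proof -
      have "sl_solution q lam {0..} P P'" by (rule sl_solution_subset[OF sol]) (auto simp: is_interval_ci)
      from sl_solution_bound[OF this q lam t] have "cmod (P t) + cmod (P' t) \<le> (cmod (P 0) + cmod (P' 0)) * J" by (simp add: J_def)
      also have "\<dots> \<le> N * J" using n J0 by (rule mult_right_mono)
      finally show ?thesis .
    qed
    have "cmod (R x) \<le> N * J * exp Kk * exp (\<sigma> * x)"
      if R: "\<And>x. R (x + a) = \<zeta> * R x" and Rb: "\<And>t. t \<in> {0..a} \<Longrightarrow> cmod (R t) \<le> N * J" for R :: "real \<Rightarrow> complex"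
    proof -
      have "cmod (R x) \<le> N * J * exp (\<bar>\<sigma>\<bar> * a) * exp (\<sigma> * x)"
        by (rule quasi_periodic_bound[where P=R, OF a_pos R z Rb x])
      also have "\<dots> \<le> N * J * exp Kk * exp (\<sigma> * x)"
        using sg N0 J0 by (intro mult_right_mono mult_left_mono) auto
      finally show ?thesis .
    qed
    from this[of P] this[of P'] show ?thesis
      using per sl_solution_quasi_periodic_deriv[OF sol per] b
      by (smt (verit) norm_ge_zero)
  qed
  have c0: "continuous_on G (\<lambda>z. z)" by (rule continuous_on_id)
  have "\<forall>\<^sub>F lam in near_in G l. bloch_bounded (N * J * exp Kk) lam"
    using near_in_memb[of G l] near_in_norm_bounded[OF c0 l] near_in_norm_bounded[OF k_facts(1) l]
      near_in_norm_bounded[OF bloch_facts(8)[of 0] l] near_in_norm_bounded[OF bloch_facts(9)[of 0] l]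
      near_in_norm_bounded[OF bloch_deriv_regular(1)[OF order_refl] l] near_in_norm_bounded[OF bloch_deriv_regular(3)[OF order_refl] l]
  proof eventually_elim
    case (elim lam)
    have sg: "\<bar>- \<kappa> lam\<bar> * a \<le> Kk" "\<bar>\<kappa> lam\<bar> * a \<le> Kk"
      using abs_Im_le_cmod[of "k lam"] elim(3) a_pos by (simp_all add: \<kappa>_def Kk_def abs_divide)
    have Nb: "cmod (psp 0 lam) + cmod (dpsp 0 lam) \<le> N" "cmod (psm 0 lam) + cmod (dpsm 0 lam) \<le> N"
      using elim(4-7) norm_ge_zero[of "psp 0 l"] norm_ge_zero[of "dpsp 0 l"] norm_ge_zero[of "psm 0 l"] norm_ge_zero[of "dpsm 0 l"]
      unfolding N_def by linarith+
    show ?case unfolding bloch_bounded_def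
    proof (intro allI impI)
      fix x :: real assume x: "x \<ge> 0"
      have 1: "cmod (psp x lam) \<le> N * J * exp Kk * exp (- \<kappa> lam * x) \<and> cmod (dpsp x lam) \<le> N * J * exp Kk * exp (- \<kappa> lam * x)"
        by (rule gen[where P="\<lambda>x. psp x lam", OF elim(2) bloch_facts(1)[OF elim(1)] bloch_facts(3)[OF elim(1)] _ sg(1) _ x])
           (use Nb a_pos in \<open>simp_all add: \<kappa>_def\<close>)
      have 2: "cmod (psm x lam) \<le> N * J * exp Kk * exp (\<kappa> lam * x) \<and> cmod (dpsm x lam) \<le> N * J * exp Kk * exp (\<kappa> lam * x)"
        by (rule gen[where P="\<lambda>x. psm x lam", OF elim(2) bloch_facts(2)[OF elim(1)] bloch_facts(4)[OF elim(1)] _ sg(2) _ x])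
           (use Nb a_pos in \<open>simp_all add: \<kappa>_def\<close>)
      show "cmod (psp x lam) \<le> N * J * exp Kk * exp (- \<kappa> lam * x) \<and> cmod (dpsp x lam) \<le> N * J * exp Kk * exp (- \<kappa> lam * x) \<and>
        cmod (psm x lam) \<le> N * J * exp Kk * exp (\<kappa> lam * x) \<and> cmod (dpsm x lam) \<le> N * J * exp Kk * exp (\<kappa> lam * x)"
        using 1 2 by blast
    qed
  qed
  then show ?thesis using N0 J0 by (intro exI[of _ "N * J * exp Kk"]) simp
qed

text \<open>For exp(2ik) the multiplier has modulus below 1 above the axis, and on the spectrum the
  critical set excludes the value 1. Those with exp(-2ik) are inverses of these. The multiplier 1 is
  settled by nonresonance. Continuity then turns the finitely many inequalities at \<open>l\<close>
  into a common lower bound nearby.\<close>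

lemma multiplier_lower:
  assumes l: "l \<in> G" "l \<notin> crit_set q a k \<omega>"
  shows "\<exists>d>0. \<forall>\<^sub>F lam in near_in G l. \<forall>\<zeta>\<in>{1, exp (2 * \<i> * k lam), exp (- 2 * \<i> * k lam)}.
     d \<le> cmod (\<zeta> * exp (2 * \<i> * of_real (\<omega> * a)) - 1) \<and> d \<le> cmod (\<zeta> * exp (- 2 * \<i> * of_real (\<omega> * a)) - 1)"
proof -
  define e1 where "e1 = exp (2 * \<i> * complex_of_real (\<omega> * a))"
  define e2 where "e2 = exp (- 2 * \<i> * complex_of_real (\<omega> * a))"
  have e12: "e1 * e2 = 1" by (simp add: e1_def e2_def flip: exp_add)
  have ee: "cmod e1 = 1" "cmod e2 = 1" by (simp_all add: e1_def e2_def)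
  define Kf where "Kf lam = exp (2 * \<i> * k lam)" for lam
  define Kg where "Kg lam = exp (- 2 * \<i> * k lam)" for lam
  have fg: "Kf lam * Kg lam = 1" for lam by (simp add: Kf_def Kg_def flip: exp_add)
  have n1: "e1 \<noteq> 1"
  proof
    assume "e1 = 1"
    then obtain n :: int where "2 * (\<omega> * a) = of_int (2 * n) * pi" by (auto simp: e1_def exp_eq_1)
    then have "2 * a * \<omega> / pi = of_int (2 * n)" by (simp add: field_simps)
    then show False using nonres by (metis Ints_of_int)
  qed
  have n2: "e2 \<noteq> 1" using n1 e12 by auto
  have nf: "Kf l * e1 \<noteq> 1 \<and> Kf l * e2 \<noteq> 1"
  proof (cases "l \<in> Hp")
    case True
    then have "cmod (Kf l) < 1" using k_facts(3)[OF True] by (simp add: Kf_def)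
    then have "cmod (Kf l * e1) \<noteq> cmod 1" "cmod (Kf l * e2) \<noteq> cmod 1" by (simp_all add: norm_mult ee)
    then show ?thesis by metis
  next
    case False
    then have "l \<in> spec_per q a - crit_set q a k \<omega>" using l by (auto simp: G_def B_def)
    from noncritical_multiplier[OF k_qm q_loc a_pos this nonres] show ?thesis
      by (simp add: Kf_def e1_def e2_def)
  qed
  have ng: "Kg l * e1 \<noteq> 1 \<and> Kg l * e2 \<noteq> 1"
  proof -
    have "(Kg l * e1) * (Kf l * e2) = 1" "(Kg l * e2) * (Kf l * e1) = 1"
      using fg[of l] e12 by (simp_all add: mult_ac)
    then show ?thesis using nf by auto
  qed
  have cK: "continuous_on G Kf" "continuous_on G Kg" unfolding Kf_def Kg_def by (intro continuous_intros k_facts(1))+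
  \<comment> \<open>Half of the smallest distance to 1 at \<open>l\<close>; the other half is given
    away to variation in a neighbourhood.\<close>
  define d where "d = Min ((\<lambda>z. cmod (z - 1) / 2) ` {e1, e2, Kf l * e1, Kf l * e2, Kg l * e1, Kg l * e2})"
  have d0: "d > 0" unfolding d_def using n1 n2 nf ng by (subst Min_gr_iff) auto
  have dle: "d \<le> cmod (z - 1) / 2" if "z \<in> {e1, e2, Kf l * e1, Kf l * e2, Kg l * e1, Kg l * e2}" for z
    unfolding d_def by (rule Min_le) (use that in auto)
  have ev: "\<forall>\<^sub>F lam in near_in G l. d \<le> cmod (f lam * e - 1)"
    if "continuous_on G f" "f l * e \<noteq> 1" "f l * e \<in> {e1, e2, Kf l * e1, Kf l * e2, Kg l * e1, Kg l * e2}" for f e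
  proof -
    have "continuous_on G (\<lambda>lam. f lam * e - 1)" by (intro continuous_intros that)
    from near_in_norm_lower[OF this l(1)] that(2)
    have "\<forall>\<^sub>F lam in near_in G l. cmod (f l * e - 1) / 2 \<le> cmod (f lam * e - 1)" by simp
    then show ?thesis by (rule eventually_mono) (use dle[OF that(3)] in linarith)
  qed
  have "\<forall>\<^sub>F lam in near_in G l. \<forall>\<zeta>\<in>{1, Kf lam, Kg lam}. d \<le> cmod (\<zeta> * e1 - 1) \<and> d \<le> cmod (\<zeta> * e2 - 1)"
    using ev[OF cK(1), of e1] ev[OF cK(1), of e2] ev[OF cK(2), of e1] ev[OF cK(2), of e2]
    by (rule eventually_elim2[OF eventually_conj eventually_conj])
       (use nf ng dle[of e1] dle[of e2] d0 in auto)
  then show ?thesis using d0 unfolding e1_def e2_def Kf_def Kg_def by blast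
qed

section \<open>The amplitude\<close>

text \<open>A choice is made because a solution on the half line does not determine the values of
  the functions at negative x, so the pair is unique only there where the equation holds.\<close>

definition "sol lam = (SOME p. sl_solution Q lam {0..} (fst p) (snd p) \<and> fst p 0 = of_real y0 \<and> snd p 0 = of_real y1)"
definition "\<phi> lam = fst (sol lam)"
definition "d\<phi> lam = snd (sol lam)"
text \<open>Cramer's rule for the expansion in \<open>psm\<close> and \<open>psp\<close>: pairing
  with \<open>psp\<close> gives -u W, pairing with \<open>psm\<close> gives v W, which explains the
  sign.\<close>

definition "u x lam = - wronsk (\<phi> lam x) (d\<phi> lam x) (psp x lam) (dpsp x lam) / W lam"
definition "v x lam = wronsk (\<phi> lam x) (d\<phi> lam x) (psm x lam) (dpsm x lam) / W lam"
text \<open>Being a limit, the amplitude is given by one formula above and on the spectrum, which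
  makes the comparison of the two immediate. Existence of the limit is proved off the critical
  set.\<close>

definition "amplitude lam = Lim at_top (\<lambda>x. u x lam)"

lemma phi_facts: "sl_solution Q lam {0..} (\<phi> lam) (d\<phi> lam)" "\<phi> lam 0 = of_real y0" "d\<phi> lam 0 = of_real y1"
proof -
  have "\<exists>p. sl_solution Q lam {0..} (fst p) (snd p) \<and> fst p 0 = of_real y0 \<and> snd p 0 = of_real y1"
    using sl_solution_exists_half_line[OF Q_int, of lam "of_real y0" "of_real y1"] by auto
  from someI_ex[OF this] show "sl_solution Q lam {0..} (\<phi> lam) (d\<phi> lam)" "\<phi> lam 0 = of_real y0" "d\<phi> lam 0 = of_real y1"
    unfolding \<phi>_def d\<phi>_def sol_def by blast+
qed

lemma phi_decomp:
  assumes "lam \<in> G"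
  shows "\<phi> lam x = u x lam * psm x lam + v x lam * psp x lam" "d\<phi> lam x = u x lam * dpsm x lam + v x lam * dpsp x lam"
proof -
  have W0: "W lam \<noteq> 0" by (rule bloch_facts(5)[OF assms])
  have uW: "W lam * u x lam = - wronsk (\<phi> lam x) (d\<phi> lam x) (psp x lam) (dpsp x lam)"
    and vW: "W lam * v x lam = wronsk (\<phi> lam x) (d\<phi> lam x) (psm x lam) (dpsm x lam)"
    using W0 by (simp_all add: u_def v_def)
  have "W lam * (u x lam * psm x lam + v x lam * psp x lam) = \<phi> lam x * (dpsp x lam * psm x lam - psp x lam * dpsm x lam)"
    "W lam * (u x lam * dpsm x lam + v x lam * dpsp x lam) = d\<phi> lam x * (dpsp x lam * psm x lam - psp x lam * dpsm x lam)"
    unfolding distrib_left mult.assoc[symmetric] uW vW by (simp_all add: wronsk_def algebra_simps)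
  then show "\<phi> lam x = u x lam * psm x lam + v x lam * psp x lam" "d\<phi> lam x = u x lam * dpsm x lam + v x lam * dpsp x lam"
    unfolding W_const[OF assms] using W0 by (simp_all add: mult.commute[of _ "W lam"])
qed

text \<open>The coefficients are Wronskians of solutions with the same parameter and potentials
  \<open>Q\<close> and \<open>q\<close>, so their densities are the perturbation times the solution
  times a Bloch function. Inserting the decomposition of the solution yields a closed linear
  system.\<close>

lemma uv_ac_prim:
  assumes l: "lam \<in> G"
  defines "b0 \<equiv> \<lambda>x. psp x lam * psm x lam / W lam" and "bp \<equiv> \<lambda>x. (psp x lam)\<^sup>2 / W lam" and "bm \<equiv> \<lambda>x. (psm x lam)\<^sup>2 / W lam"
  shows "ac_prim 0 T (\<lambda>x. u x lam) (\<lambda>x. - (of_real (m x * s x + q1 x) * (b0 x * u x lam + bp x * v x lam)))"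
    and "ac_prim 0 T (\<lambda>x. v x lam) (\<lambda>x. of_real (m x * s x + q1 x) * (bm x * u x lam + b0 x * v x lam))"
proof -
  have sp: "sl_solution q lam {0..} (\<lambda>x. psp x lam) (\<lambda>x. dpsp x lam)" and sm: "sl_solution q lam {0..} (\<lambda>x. psm x lam) (\<lambda>x. dpsm x lam)"
    by (rule sl_solution_subset[OF bloch_facts(1)[OF l]], simp, simp add: is_interval_ci)
       (rule sl_solution_subset[OF bloch_facts(2)[OF l]], simp, simp add: is_interval_ci)
  have W0: "W lam \<noteq> 0" by (rule bloch_facts(5)[OF l])
  have r: "complex_of_real (Q x - q x) - lam + lam = of_real (m x * s x + q1 x)" if "x \<ge> 0" for x
    using Q_minus_q[OF that] by simp
  have "ac_prim 0 T (\<lambda>x. wronsk (\<phi> lam x) (d\<phi> lam x) (psp x lam) (dpsp x lam))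
      (\<lambda>x. (of_real (Q x - q x) - lam + lam) * (\<phi> lam x * psp x lam))"
    by (rule wronsk_ac_prim[OF phi_facts(1) sp _ Q_int q_int]) auto
  from ac_prim_cmult[OF this, of "- 1 / W lam"]
  show "ac_prim 0 T (\<lambda>x. u x lam) (\<lambda>x. - (of_real (m x * s x + q1 x) * (b0 x * u x lam + bp x * v x lam)))"
  proof (rule ac_prim_cong)
    fix x :: real assume x: "0 \<le> x"
    show "- 1 / W lam * ((of_real (Q x - q x) - lam + lam) * (\<phi> lam x * psp x lam)) = - (of_real (m x * s x + q1 x) * (b0 x * u x lam + bp x * v x lam))"
      unfolding r[OF x] phi_decomp(1)[OF l] b0_def bp_def using W0 by (simp add: field_simps power2_eq_square)
  qed (simp add: u_def)
  have "ac_prim 0 T (\<lambda>x. wronsk (\<phi> lam x) (d\<phi> lam x) (psm x lam) (dpsm x lam))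
      (\<lambda>x. (of_real (Q x - q x) - lam + lam) * (\<phi> lam x * psm x lam))"
    by (rule wronsk_ac_prim[OF phi_facts(1) sm _ Q_int q_int]) auto
  from ac_prim_cmult[OF this, of "1 / W lam"]
  show "ac_prim 0 T (\<lambda>x. v x lam) (\<lambda>x. of_real (m x * s x + q1 x) * (bm x * u x lam + b0 x * v x lam))"
  proof (rule ac_prim_cong)
    fix x :: real assume x: "0 \<le> x"
    show "1 / W lam * ((of_real (Q x - q x) - lam + lam) * (\<phi> lam x * psm x lam)) = of_real (m x * s x + q1 x) * (bm x * u x lam + b0 x * v x lam)"
      unfolding r[OF x] phi_decomp(1)[OF l] b0_def bm_def using W0 by (simp add: field_simps power2_eq_square)
  qed (simp add: v_def)
qed

lemma uv_regular:
  assumes x: "x \<ge> 0"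
  shows "continuous_on G (u x)" "continuous_on G (v x)" "u x holomorphic_on Hp"
proof -
  have h: "(\<lambda>lam. \<phi> lam x) holomorphic_on UNIV" "(\<lambda>lam. d\<phi> lam x) holomorphic_on UNIV"
    by (rule sl_family_holomorphic[OF phi_facts Q_loc x])+
  have c: "continuous_on G (\<lambda>lam. \<phi> lam x)" "continuous_on G (\<lambda>lam. d\<phi> lam x)"
    by (rule continuous_on_subset[OF holomorphic_on_imp_continuous_on[OF h(1)]], simp)
       (rule continuous_on_subset[OF holomorphic_on_imp_continuous_on[OF h(2)]], simp)
  have h': "(\<lambda>lam. \<phi> lam x) holomorphic_on Hp" "(\<lambda>lam. d\<phi> lam x) holomorphic_on Hp"
    using h by (auto intro: holomorphic_on_subset)
  show "continuous_on G (u x)" "continuous_on G (v x)"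
    unfolding u_def v_def wronsk_def
    by (intro continuous_intros c bloch_facts(8,9,11) bloch_deriv_regular(1,3)[OF x] ballI bloch_facts(5); assumption)+
  show "u x holomorphic_on Hp"
    unfolding u_def wronsk_def
    by (intro holomorphic_intros h' bloch_facts(6,10) bloch_deriv_regular(2)[OF x] bloch_facts(5)) (use Hp_open in auto)
qed

text \<open>The order of the quantifiers is the point: \<open>r\<close>, \<open>x0\<close> and
  \<open>\<tau>\<close> are fixed before \<open>lam\<close>, so the rate of convergence is common to
  all points of \<open>G\<close> near \<open>l\<close>, including those on the spectrum.\<close>

lemma local_asymptotics:
  assumes l: "l \<in> G" "l \<notin> crit_set q a k \<omega>"
  shows "\<exists>r>0. \<exists>x0 \<tau>. (\<tau> \<longlongrightarrow> 0) at_top \<and> (\<forall>lam \<in> G \<inter> ball l r.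
     (\<exists>A. \<forall>x\<ge>x0. cmod (u x lam - A) \<le> \<tau> x) \<and>
     (\<kappa> lam > 0 \<longrightarrow> ((\<lambda>x. exp (- 2 * \<kappa> lam * x) * cmod (v x lam)) \<longlongrightarrow> 0) at_top))"
proof -
  obtain K1 where K1: "K1 \<ge> 0" and evK: "\<forall>\<^sub>F lam in near_in G l. bloch_bounded K1 lam"
    using bloch_bounds[OF l(1)] by blast
  obtain d where d: "d > 0" and evd: "\<forall>\<^sub>F lam in near_in G l. \<forall>\<zeta>\<in>{1, exp (2 * \<i> * k lam), exp (- 2 * \<i> * k lam)}.
     d \<le> cmod (\<zeta> * exp (2 * \<i> * of_real (\<omega> * a)) - 1) \<and> d \<le> cmod (\<zeta> * exp (- 2 * \<i> * of_real (\<omega> * a)) - 1)"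
    using multiplier_lower[OF l] by blast
  obtain I where I: "((\<lambda>x. integral {0..x} \<rho>) \<longlongrightarrow> I) at_top" "\<And>x. integral {0..x} \<rho> \<le> I"
    using rho_converges(2) by blast
  have W0: "W l \<noteq> 0" by (rule bloch_facts(5)[OF l(1)])
  \<comment> \<open>Bounds the products of two Bloch solutions divided by the Wronskian, whose
    modulus stays above half its value at \<open>l\<close>. In \<open>Kk\<close> the factor 2
    reflects that such products grow or decay at the rate 2 \<kappa>.\<close>
  define K2 where "K2 = K1\<^sup>2 / (cmod (W l) / 2)"
  define Kk where "Kk = 2 * (cmod (k l) + 1)"
  define K3 where "K3 = \<bar>c\<bar> * (a * K2 * exp Kk / d)"
  define K where "K = 1 + K2 + K3 + \<bar>c\<bar>"
  have K20: "K2 \<ge> 0" by (simp add: K2_def)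
  have K30: "K3 \<ge> 0" using K20 d a_pos by (simp add: K3_def)
  have KK: "1 \<le> K" "K2 \<le> K" "K3 \<le> K" "\<bar>c\<bar> \<le> K" using K20 K30 by (auto simp: K_def)
  have mlim: "(m \<longlongrightarrow> 0) at_top" unfolding m_def by (rule power_decay(3)[OF gamma])
  have "((\<lambda>x. 4 * K * m x) \<longlongrightarrow> 0) at_top" using mlim by (rule tendsto_mult_right_zero)
  then have "\<forall>\<^sub>F x in at_top. 4 * K * m x < 1 \<and> x \<ge> 0"
    by (intro eventually_conj order_tendstoD(2) eventually_ge_at_top) auto
  then obtain x0 where x0: "x0 \<ge> 0" "\<And>x. x \<ge> x0 \<Longrightarrow> 4 * K * m x \<le> 1"
    unfolding eventually_at_top_linorder by (meson less_imp_le order_refl)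
  \<comment> \<open>The starting values at \<open>x0\<close> vary continuously with the parameter;
    each added 1 covers that variation near \<open>l\<close>.\<close>
  define L where "L = cmod (u x0 l) + 1 + (cmod (v x0 l) + 1)"
  define M where "M = 8 * L * exp (48 * K ^ 3 * I)"
  define \<tau> where "\<tau> x = 3 * K ^ 3 * M * (I - integral {0..x} \<rho>) + K * M * m x" for x
  have "((\<lambda>x. 3 * K ^ 3 * M * (I - integral {0..x} \<rho>) + K * M * m x) \<longlongrightarrow> 3 * K ^ 3 * M * (I - I) + K * M * 0) at_top"
    by (intro tendsto_intros I mlim)
  then have \<tau>: "(\<tau> \<longlongrightarrow> 0) at_top" by (simp add: \<tau>_def[abs_def])
  have "\<forall>\<^sub>F lam in near_in G l. (\<exists>A. \<forall>x\<ge>x0. cmod (u x lam - A) \<le> \<tau> x) \<and>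
     (\<kappa> lam > 0 \<longrightarrow> ((\<lambda>x. exp (- 2 * \<kappa> lam * x) * cmod (v x lam)) \<longlongrightarrow> 0) at_top)"
    using near_in_memb[of G l] evK evd near_in_norm_lower[OF bloch_facts(11) l(1) W0] near_in_norm_bounded[OF k_facts(1) l(1)]
      near_in_norm_bounded[OF uv_regular(1)[OF x0(1)] l(1)] near_in_norm_bounded[OF uv_regular(2)[OF x0(1)] l(1)]
  proof eventually_elim
    case (elim lam)
    note lam = elim(1)
    have Wl: "W lam \<noteq> 0" by (rule bloch_facts(5)[OF lam])
    have pp: "cmod (psp x lam) \<le> K1 * exp (- \<kappa> lam * x)" "cmod (psm x lam) \<le> K1 * exp (\<kappa> lam * x)" if "x \<ge> 0" for x
      using elim(2) that by (auto simp: bloch_bounded_def)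
    define b0 where "b0 x = psp x lam * psm x lam / W lam" for x
    define bp where "bp x = (psp x lam)\<^sup>2 / W lam" for x
    define bm where "bm x = (psm x lam)\<^sup>2 / W lam" for x
    have quot: "cmod (z / W lam) \<le> K2 * e" if "cmod z \<le> K1\<^sup>2 * e" for z e
    proof -
      have "cmod (z / W lam) \<le> cmod z / (cmod (W l) / 2)"
        unfolding norm_divide using elim(4) W0 Wl by (intro divide_left_mono mult_pos_pos) auto
      also have "\<dots> \<le> (K1\<^sup>2 * e) / (cmod (W l) / 2)" using that by (rule divide_right_mono) simp
      finally show ?thesis by (simp add: K2_def mult_ac)
    qed
    have b0K: "cmod (b0 x) \<le> K2 * exp (0 * x)" if x: "x \<ge> 0" for x
      unfolding b0_def
    proof (rule quot)
      have "cmod (psp x lam * psm x lam) \<le> (K1 * exp (- \<kappa> lam * x)) * (K1 * exp (\<kappa> lam * x))"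
        unfolding norm_mult using pp[OF x] K1 by (intro mult_mono) auto
      also have "\<dots> = K1\<^sup>2 * exp (- \<kappa> lam * x + \<kappa> lam * x)" by (simp only: exp_add power2_eq_square mult_ac)
      finally show "cmod (psp x lam * psm x lam) \<le> K1\<^sup>2 * exp (0 * x)" by simp
    qed
    have bpK: "cmod (bp x) \<le> K2 * exp (- 2 * \<kappa> lam * x)" if x: "x \<ge> 0" for x
      unfolding bp_def
    proof (rule quot)
      have "cmod ((psp x lam)\<^sup>2) \<le> (K1 * exp (- \<kappa> lam * x))\<^sup>2"
        unfolding norm_power using pp[OF x] by (intro power_mono) auto
      also have "\<dots> = K1\<^sup>2 * exp (- \<kappa> lam * x + - \<kappa> lam * x)" by (simp only: exp_add power2_eq_square mult_ac)
      finally show "cmod ((psp x lam)\<^sup>2) \<le> K1\<^sup>2 * exp (- 2 * \<kappa> lam * x)" by (simp add: mult_ac)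
    qed
    have bmK: "cmod (bm x) \<le> K2 * exp (2 * \<kappa> lam * x)" if x: "x \<ge> 0" for x
      unfolding bm_def
    proof (rule quot)
      have "cmod ((psm x lam)\<^sup>2) \<le> (K1 * exp (\<kappa> lam * x))\<^sup>2"
        unfolding norm_power using pp[OF x] by (intro power_mono) auto
      also have "\<dots> = K1\<^sup>2 * exp (\<kappa> lam * x + \<kappa> lam * x)" by (simp only: exp_add power2_eq_square mult_ac)
      finally show "cmod ((psm x lam)\<^sup>2) \<le> K1\<^sup>2 * exp (2 * \<kappa> lam * x)" by (simp add: mult_ac)
    qed
    have per: "b0 (x + a) = 1 * b0 x" "bp (x + a) = exp (2 * \<i> * k lam) * bp x" "bm (x + a) = exp (- 2 * \<i> * k lam) * bm x" for x
    proof -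
      have e: "exp (\<i> * k lam) * exp (- \<i> * k lam) = 1" "(exp (\<i> * k lam))\<^sup>2 = exp (2 * \<i> * k lam)" "(exp (- \<i> * k lam))\<^sup>2 = exp (- 2 * \<i> * k lam)"
        by (simp_all add: mult.assoc flip: exp_add exp_double)
      have "psp (x + a) lam * psm (x + a) lam = (exp (\<i> * k lam) * exp (- \<i> * k lam)) * (psp x lam * psm x lam)"
        unfolding bloch_facts(3,4)[OF lam] by (simp only: mult_ac)
      then show "b0 (x + a) = 1 * b0 x" unfolding e b0_def by simp
      show "bp (x + a) = exp (2 * \<i> * k lam) * bp x" "bm (x + a) = exp (- 2 * \<i> * k lam) * bm x"
        unfolding bp_def bm_def bloch_facts(3,4)[OF lam] power_mult_distrib e by simp_all
    qed
    have pc: "continuous_on {0..} (\<lambda>x. psp x lam)" "continuous_on {0..} (\<lambda>x. psm x lam)"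
      using bloch_facts(1,2)[OF lam] unfolding sl_solution_def
      by (meson continuous_at_imp_continuous_on has_vector_derivative_continuous UNIV_I)+
    have cb: "continuous_on {0..} b0" "continuous_on {0..} bp" "continuous_on {0..} bm"
      unfolding b0_def bp_def bm_def using Wl by (intro continuous_intros pc; simp)+
    have osc: "\<exists>H. (\<forall>T. ac_prim 0 T H (\<lambda>x. of_real (s x) * F x)) \<and> (\<forall>x\<ge>0. cmod (H x) \<le> K * exp (\<sigma> * x))"
      if F: "continuous_on {0..} F" "\<And>x. F (x + a) = \<zeta> * F x" "\<zeta> \<in> {1, exp (2 * \<i> * k lam), exp (- 2 * \<i> * k lam)}"
        "\<And>x. x \<ge> 0 \<Longrightarrow> cmod (F x) \<le> K2 * exp (\<sigma> * x)" "\<bar>\<sigma>\<bar> * a \<le> Kk" for F \<zeta> \<sigma>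
    proof -
      have "\<exists>H. (\<forall>T. ac_prim 0 T H (\<lambda>x. of_real (c * sin (2 * \<omega> * x + \<delta>)) * F x)) \<and>
        (\<forall>x\<ge>0. cmod (H x) \<le> \<bar>c\<bar> * (a * K2 * exp (\<bar>\<sigma>\<bar> * a) / d) * exp (\<sigma> * x))"
        by (rule oscillating_primitive[OF F(1,2) a_pos d _ _ F(4) K20]) (use elim(3) F(3) in auto)
      then obtain H where H: "\<forall>T. ac_prim 0 T H (\<lambda>x. of_real (s x) * F x)"
        "\<And>x. x \<ge> 0 \<Longrightarrow> cmod (H x) \<le> \<bar>c\<bar> * (a * K2 * exp (\<bar>\<sigma>\<bar> * a) / d) * exp (\<sigma> * x)"
        unfolding s_def by blast
      have "\<bar>c\<bar> * (a * K2 * exp (\<bar>\<sigma>\<bar> * a) / d) \<le> K3"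
        unfolding K3_def using a_pos K20 d F(5) by (intro mult_left_mono divide_right_mono) auto
      then have "\<bar>c\<bar> * (a * K2 * exp (\<bar>\<sigma>\<bar> * a) / d) \<le> K" using KK by linarith
      then have "cmod (H x) \<le> K * exp (\<sigma> * x)" if "x \<ge> 0" for x
        using H(2)[OF that] by (meson exp_ge_zero mult_right_mono order_trans)
      with H(1) show ?thesis by blast
    qed
    have kb: "\<bar>2 * \<kappa> lam\<bar> * a \<le> Kk" "\<bar>- 2 * \<kappa> lam\<bar> * a \<le> Kk" "\<bar>0\<bar> * a \<le> Kk"
      using abs_Im_le_cmod[of "k lam"] elim(5) a_pos by (simp_all add: \<kappa>_def Kk_def abs_mult abs_divide add_nonneg_nonneg)
    obtain H0 where H0: "\<And>T. ac_prim 0 T H0 (\<lambda>x. of_real (s x) * b0 x)" "\<And>x. x \<ge> 0 \<Longrightarrow> cmod (H0 x) \<le> K * exp (0 * x)"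
      using osc[OF cb(1) per(1) _ b0K kb(3)] by blast
    obtain Hq where Hq: "\<And>T. ac_prim 0 T Hq (\<lambda>x. of_real (s x) * bp x)" "\<And>x. x \<ge> 0 \<Longrightarrow> cmod (Hq x) \<le> K * exp (- 2 * \<kappa> lam * x)"
      using osc[OF cb(2) per(2) _ bpK kb(2)] by blast
    obtain Hm where Hm: "\<And>T. ac_prim 0 T Hm (\<lambda>x. of_real (s x) * bm x)" "\<And>x. x \<ge> 0 \<Longrightarrow> cmod (Hm x) \<le> K * exp (2 * \<kappa> lam * x)"
      using osc[OF cb(3) per(3) _ bmK kb(1)] by blast
    have bK: "cmod (b0 x) \<le> K" "cmod (bp x) \<le> K * exp (- 2 * \<kappa> lam * x)" "cmod (bm x) \<le> K * exp (2 * \<kappa> lam * x)" if "x \<ge> 0" for x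
      using b0K[OF that] bpK[OF that] bmK[OF that] KK(2)
      by (auto intro: order_trans[OF _ mult_right_mono[OF KK(2)]])
    have sK: "\<bar>s x\<bar> \<le> K" for x
    proof -
      have "\<bar>s x\<bar> \<le> \<bar>c\<bar> * 1" unfolding s_def abs_mult by (intro mult_left_mono) auto
      then show ?thesis using KK by simp
    qed
    have LL: "cmod (u x0 lam) + cmod (v x0 lam) \<le> L" using elim by (simp add: L_def)
    have m1: "x \<ge> 0 \<Longrightarrow> 0 \<le> m x \<and> m x \<le> 1" for x unfolding m_def by (rule power_decay(2)[OF gamma])
    have m2: "ac_prim 0 T (\<lambda>x. complex_of_real (m x)) (\<lambda>x. complex_of_real (m' x))" for T
      unfolding m_def m'_def by (rule power_decay(1)[OF gamma])
    note uv = uv_ac_prim[OF lam, folded b0_def bp_def bm_def]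
    note asy = perturbed_system_asymptotics[OF KK(1) kappa_nonneg[OF lam] x0(1) m2 m1 mlim x0(2) sK bK(1) bK(2) bK(3)
        _ Hq(2) Hm(2) H0(1) Hq(1) Hm(1) uv(1) uv(2) rho_converges(1)[unfolded \<rho>_def] I(1)[unfolded \<rho>_def] I(2)[unfolded \<rho>_def] LL, folded \<rho>_def M_def]
    have "\<exists>A. \<forall>x\<ge>x0. cmod (u x lam - A) \<le> \<tau> x"
      unfolding \<tau>_def by (rule asy(1)) (use H0(2) in auto)
    moreover have "\<kappa> lam > 0 \<longrightarrow> ((\<lambda>x. exp (- 2 * \<kappa> lam * x) * cmod (v x lam)) \<longlongrightarrow> 0) at_top"
      by (intro impI, rule asy(2)) (use H0(2) in auto)
    ultimately show ?case by blast
  qed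
  from near_in_ball[OF this] \<tau> show ?thesis by blast
qed

lemma amplitude_bound:
  assumes t: "(\<tau> \<longlongrightarrow> 0) at_top" and A: "\<forall>x\<ge>x0. cmod (u x lam - A) \<le> \<tau> x"
  shows "amplitude lam = A" "((\<lambda>x. u x lam) \<longlongrightarrow> A) at_top"
proof -
  have "((\<lambda>x. u x lam - A) \<longlongrightarrow> 0) at_top"
    by (rule Lim_null_comparison[OF _ t]) (use A in \<open>auto simp: eventually_at_top_linorder\<close>)
  then show "((\<lambda>x. u x lam) \<longlongrightarrow> A) at_top" by (rule LIM_zero_cancel)
  then show "amplitude lam = A" unfolding amplitude_def by (intro tendsto_Lim) auto
qed

text \<open>The bound \<open>\<tau>\<close> is independent of the parameter, so pointwise
  convergence of \<open>u\<close> is uniform on the neighbourhood.\<close>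

lemma amplitude_uniform:
  assumes l: "l \<in> G" "l \<notin> crit_set q a k \<omega>"
  shows "\<exists>r>0. uniform_limit (G \<inter> ball l r) u amplitude at_top \<and>
    (\<forall>lam \<in> G \<inter> ball l r. \<kappa> lam > 0 \<longrightarrow> ((\<lambda>x. exp (- 2 * \<kappa> lam * x) * cmod (v x lam)) \<longlongrightarrow> 0) at_top)"
proof -
  obtain r x0 \<tau> where r: "r > 0" and t: "(\<tau> \<longlongrightarrow> 0) at_top" and
    A: "\<And>lam. lam \<in> G \<inter> ball l r \<Longrightarrow> \<exists>A. \<forall>x\<ge>x0. cmod (u x lam - A) \<le> \<tau> x" and
    v: "\<And>lam. lam \<in> G \<inter> ball l r \<Longrightarrow> \<kappa> lam > 0 \<longrightarrow> ((\<lambda>x. exp (- 2 * \<kappa> lam * x) * cmod (v x lam)) \<longlongrightarrow> 0) at_top"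
    using local_asymptotics[OF l] by blast
  have b: "cmod (u x lam - amplitude lam) \<le> \<tau> x" if "lam \<in> G \<inter> ball l r" "x \<ge> x0" for lam x
    using A[OF that(1)] amplitude_bound(1)[OF t] that by blast
  have "uniform_limit (G \<inter> ball l r) u amplitude at_top"
    unfolding uniform_limit_iff
  proof (intro allI impI)
    fix e :: real assume "e > 0"
    then have "\<forall>\<^sub>F x in at_top. \<tau> x < e" using t by (intro order_tendstoD(2))
    then show "\<forall>\<^sub>F x in at_top. \<forall>lam\<in>G \<inter> ball l r. dist (u x lam) (amplitude lam) < e"
      using eventually_ge_at_top[of x0] by eventually_elim (use b in \<open>force simp: dist_norm\<close>)
  qed
  then show ?thesis using r v by blast
qed

section \<open>Analyticity and boundary values of the amplitude\<close>

lemma Hp_not_crit: "lam \<in> Hp \<Longrightarrow> lam \<notin> crit_set q a k \<omega>"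
  by (auto simp: Hp_def crit_set_def band_edges_def spec_per_def complex_is_Real_iff)

lemma spec_minus_crit: "spec_per q a - crit_set q a k \<omega> \<subseteq> B"
  by (auto simp: B_def crit_set_def)

text \<open>Weierstrass' theorem: above the axis the amplitude is a locally uniform limit of the
  functions \<open>u x\<close>, which are holomorphic there.\<close>

lemma amplitude_holomorphic: "amplitude holomorphic_on Hp"
proof -
  have "\<exists>e>0. amplitude holomorphic_on ball l e" if l: "l \<in> Hp" for l
  proof -
    have lG: "l \<in> G" using l Hp_open by auto
    obtain r where r: "r > 0" "uniform_limit (G \<inter> ball l r) u amplitude at_top"
      using amplitude_uniform[OF lG Hp_not_crit[OF l]] by blast
    have "open (Hp \<inter> ball l r)" "l \<in> Hp \<inter> ball l r" using Hp_open(1) l r(1) by auto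
    then obtain e where e: "e > 0" "cball l e \<subseteq> Hp \<inter> ball l r" using open_contains_cball by blast
    have eb: "ball l e \<subseteq> Hp" using e(2) ball_subset_cball by blast
    have "\<forall>\<^sub>F x in at_top. continuous_on (cball l e) (u x) \<and> u x holomorphic_on ball l e"
      using eventually_ge_at_top[of "0::real"]
    proof eventually_elim
      case (elim x)
      show ?case
        using continuous_on_subset[OF uv_regular(1)[OF elim], of "cball l e"]
          holomorphic_on_subset[OF uv_regular(3)[OF elim] eb] e(2) Hp_open by auto
    qed
    moreover have "uniform_limit (cball l e) u amplitude at_top"
      by (rule uniform_limit_on_subset[OF r(2)]) (use e(2) Hp_open in auto)
    ultimately have "amplitude holomorphic_on ball l e"
      by (rule holomorphic_uniform_limit) auto
    then show ?thesis using e by blast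
  qed
  then have "amplitude analytic_on Hp" unfolding analytic_on_def by blast
  then show ?thesis by (rule analytic_imp_holomorphic)
qed

text \<open>An exchange of two limits. Uniformity holds on a neighbourhood in \<open>G\<close>,
  which contains the spectral point, and every \<open>u x\<close> with x \<ge> 0 is continuous
  there.\<close>

lemma amplitude_boundary:
  assumes mu: "mu \<in> spec_per q a - crit_set q a k \<omega>" and D: "D \<subseteq> Hp"
  shows "(amplitude \<longlongrightarrow> amplitude mu) (at mu within D)"
proof -
  have G: "mu \<in> G" "mu \<notin> crit_set q a k \<omega>" using mu spec_minus_crit by (auto simp: G_def)
  obtain r where r: "r > 0" "uniform_limit (G \<inter> ball mu r) u amplitude at_top"
    using amplitude_uniform[OF G] by blast
  have lim: "((\<lambda>x. u x mu) \<longlongrightarrow> amplitude mu) at_top"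
    by (rule tendsto_uniform_limitI[OF r(2)]) (use G r in auto)
  have "(amplitude \<longlongrightarrow> amplitude mu) (at mu within (G \<inter> ball mu r))"
  proof (rule swap_uniform_limit[OF _ lim r(2)])
    show "\<forall>\<^sub>F x in at_top. (u x \<longlongrightarrow> u x mu) (at mu within G \<inter> ball mu r)"
      using eventually_ge_at_top[of "0::real"]
    proof eventually_elim
      case (elim x)
      have "continuous_on (G \<inter> ball mu r) (u x)" by (rule continuous_on_subset[OF uv_regular(1)[OF elim]]) auto
      then show ?case using G r by (simp add: continuous_on_def)
    qed
  qed auto
  then have "(amplitude \<longlongrightarrow> amplitude mu) (at mu within (D \<inter> ball mu r))"
    by (rule tendsto_within_subset) (use D Hp_open in auto)
  moreover have "at mu within (D \<inter> ball mu r) = at mu within D"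
    by (rule at_within_nhd[of mu "ball mu r"]) (use r in auto)
  ultimately show ?thesis by simp
qed

section \<open>Asymptotics of the solution\<close>

lemma solution_is_phi:
  assumes "sl_solution Q lam {0..} f f'" "f 0 = of_real y0" "f' 0 = of_real y1" "x \<ge> 0"
  shows "f x = \<phi> lam x" "f' x = d\<phi> lam x"
  using sl_solution_unique[OF assms(1) phi_facts(1) _ _ Q_loc, of x] assms phi_facts by auto

lemma amplitude_limit:
  assumes "l \<in> G" "l \<notin> crit_set q a k \<omega>"
  shows "((\<lambda>x. u x l) \<longlongrightarrow> amplitude l) at_top"
    "\<kappa> l > 0 \<Longrightarrow> ((\<lambda>x. exp (- 2 * \<kappa> l * x) * cmod (v x l)) \<longlongrightarrow> 0) at_top"
proof -
  obtain r where r: "r > 0" "uniform_limit (G \<inter> ball l r) u amplitude at_top"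
    "\<forall>lam \<in> G \<inter> ball l r. \<kappa> lam > 0 \<longrightarrow> ((\<lambda>x. exp (- 2 * \<kappa> lam * x) * cmod (v x lam)) \<longlongrightarrow> 0) at_top"
    using amplitude_uniform[OF assms] by blast
  have m: "l \<in> G \<inter> ball l r" using assms r by auto
  show "((\<lambda>x. u x l) \<longlongrightarrow> amplitude l) at_top" by (rule tendsto_uniform_limitI[OF r(2) m])
  show "\<kappa> l > 0 \<Longrightarrow> ((\<lambda>x. exp (- 2 * \<kappa> l * x) * cmod (v x l)) \<longlongrightarrow> 0) at_top" using r(3) m by blast
qed

lemma bloch_bound_at:
  assumes l: "l \<in> G"
  shows "\<exists>K\<ge>0. bloch_bounded K l"
proof -
  obtain K where K: "K \<ge> 0" "\<forall>\<^sub>F lam in near_in G l. bloch_bounded K lam"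
    using bloch_bounds[OF l] by blast
  then show ?thesis using near_in_ball[OF K(2)] l by (intro exI[of _ K]) auto
qed

text \<open>The error is (u - A) psm + v psp. Divided by exp(\<kappa> x), the first term is of the
  size of u - A and the second of exp(-2 \<kappa> x) |v|. So \<open>v\<close> itself need not
  converge.\<close>

lemma asymptotics_upper:
  assumes l: "lam \<in> Hp" and f: "sl_solution Q lam {0..} f f'" "f 0 = of_real y0" "f' 0 = of_real y1"
  shows "((\<lambda>x. cmod (f x - amplitude lam * psm x lam) / exp (Im (k lam) * x / a)) \<longlongrightarrow> 0) at_top"
    "((\<lambda>x. cmod (f' x - amplitude lam * dpsm x lam) / exp (Im (k lam) * x / a)) \<longlongrightarrow> 0) at_top"
proof -
  have lG: "lam \<in> G" using l Hp_open by auto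
  have kp: "\<kappa> lam > 0" using k_facts(3)[OF l] a_pos by (simp add: \<kappa>_def)
  obtain K where "bloch_bounded K lam" using bloch_bound_at[OF lG] by blast
  then have K: "cmod (psp x lam) \<le> K * exp (- \<kappa> lam * x)" "cmod (dpsp x lam) \<le> K * exp (- \<kappa> lam * x)"
    "cmod (psm x lam) \<le> K * exp (\<kappa> lam * x)" "cmod (dpsm x lam) \<le> K * exp (\<kappa> lam * x)" if "x \<ge> 0" for x
    using that unfolding bloch_bounded_def by blast+
  note lim = amplitude_limit[OF lG Hp_not_crit[OF l]]
  have nn: "norm (cmod z / exp y) = cmod z / exp y" for z y by simp
  have e: "exp (Im (k lam) * x / a) = exp (\<kappa> lam * x)" for x by (simp add: \<kappa>_def)
  have d: "((\<lambda>x. cmod (u x lam - amplitude lam)) \<longlongrightarrow> 0) at_top"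
    by (rule tendsto_norm_zero[OF LIM_zero[OF lim(1)]])
  have z: "((\<lambda>x. cmod (u x lam - amplitude lam) * K + (exp (- 2 * \<kappa> lam * x) * cmod (v x lam)) * K) \<longlongrightarrow> 0) at_top"
    by (rule tendsto_add_zero[OF tendsto_mult_left_zero[OF d] tendsto_mult_left_zero[OF lim(2)[OF kp]]])
  have main: "cmod ((u x lam * p + v x lam * r) - amplitude lam * p) / exp (\<kappa> lam * x)
      \<le> cmod (u x lam - amplitude lam) * K + (exp (- 2 * \<kappa> lam * x) * cmod (v x lam)) * K"
    if "cmod p \<le> K * exp (\<kappa> lam * x)" "cmod r \<le> K * exp (- \<kappa> lam * x)" for p r x
  proof -
    define U where "U = cmod (u x lam - amplitude lam)"
    have "(u x lam * p + v x lam * r) - amplitude lam * p = (u x lam - amplitude lam) * p + v x lam * r" by (simp add: algebra_simps)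
    then have "cmod ((u x lam * p + v x lam * r) - amplitude lam * p) \<le> cmod ((u x lam - amplitude lam) * p) + cmod (v x lam * r)"
      by (simp only: norm_triangle_ineq)
    moreover have "cmod ((u x lam - amplitude lam) * p) \<le> U * (K * exp (\<kappa> lam * x))"
      unfolding norm_mult U_def using that(1) by (rule mult_left_mono) simp
    moreover have "cmod (v x lam * r) \<le> cmod (v x lam) * (K * (exp (- 2 * \<kappa> lam * x) * exp (\<kappa> lam * x)))"
    proof -
      have e2: "exp (- \<kappa> lam * x) = exp (- 2 * \<kappa> lam * x) * exp (\<kappa> lam * x)" by (simp flip: exp_add)
      show ?thesis unfolding norm_mult using that(2)[unfolded e2] by (rule mult_left_mono) simp
    qed
    ultimately have "cmod ((u x lam * p + v x lam * r) - amplitude lam * p) \<le>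
        U * (K * exp (\<kappa> lam * x)) + cmod (v x lam) * (K * (exp (- 2 * \<kappa> lam * x) * exp (\<kappa> lam * x)))"
      by linarith
    moreover have "U * (K * E1) + V * (K * (E2 * E1)) = (U * K + (E2 * V) * K) * E1" for E1 E2 V
      by (simp add: algebra_simps)
    ultimately have "cmod ((u x lam * p + v x lam * r) - amplitude lam * p) \<le> (U * K + (exp (- 2 * \<kappa> lam * x) * cmod (v x lam)) * K) * exp (\<kappa> lam * x)"
      by (simp only:)
    then show ?thesis unfolding U_def by (simp only: divide_le_eq exp_gt_zero if_True)
  qed
  have null: "((\<lambda>x. cmod (h x - amplitude lam * p x) / exp (\<kappa> lam * x)) \<longlongrightarrow> 0) at_top"
    if h: "\<And>x. x \<ge> 0 \<Longrightarrow> h x = u x lam * p x + v x lam * r x"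
      and b: "\<And>x. x \<ge> 0 \<Longrightarrow> cmod (p x) \<le> K * exp (\<kappa> lam * x)" "\<And>x. x \<ge> 0 \<Longrightarrow> cmod (r x) \<le> K * exp (- \<kappa> lam * x)"
    for h p r
  proof (rule Lim_null_comparison[OF eventually_mono[OF eventually_ge_at_top[of 0]] z])
    fix x :: real assume x: "0 \<le> x"
    show "norm (cmod (h x - amplitude lam * p x) / exp (\<kappa> lam * x)) \<le> cmod (u x lam - amplitude lam) * K + (exp (- 2 * \<kappa> lam * x) * cmod (v x lam)) * K"
      unfolding nn h[OF x] by (rule main[OF b(1)[OF x] b(2)[OF x]])
  qed
  show "((\<lambda>x. cmod (f x - amplitude lam * psm x lam) / exp (Im (k lam) * x / a)) \<longlongrightarrow> 0) at_top"
    unfolding e by (rule null[OF trans[OF solution_is_phi(1)[OF f] phi_decomp(1)[OF lG]] K(3,1)])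
  show "((\<lambda>x. cmod (f' x - amplitude lam * dpsm x lam) / exp (Im (k lam) * x / a)) \<longlongrightarrow> 0) at_top"
    unfolding e by (rule null[OF trans[OF solution_is_phi(2)[OF f] phi_decomp(2)[OF lG]] K(4,2)])
qed

text \<open>On the spectrum the solution is real and the Bloch solutions are conjugate, so
  conjugation exchanges the two Wronskians. The denominator \<open>W\<close> is purely imaginary,
  and its change of sign absorbs the minus in \<open>u\<close>.\<close>

lemma v_eq_cnj_u:
  assumes l: "lam \<in> B" and x: "x \<ge> 0"
  shows "v x lam = cnj (u x lam)"
proof -
  have "cnj lam = lam" using k_facts(4)[OF l] by (simp add: Reals_cnj_iff)
  then have "sl_solution Q lam {0..} (\<lambda>x. cnj (\<phi> lam x)) (\<lambda>x. cnj (d\<phi> lam x))"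
    using sl_solution_cnj[OF phi_facts(1)[of lam]] by simp
  from solution_is_phi[OF this _ _ x] have r: "cnj (\<phi> lam x) = \<phi> lam x" "cnj (d\<phi> lam x) = d\<phi> lam x"
    by (simp_all add: phi_facts)
  have "cnj (W lam) = - W lam" using bloch_facts(14)[OF l] by (simp add: complex_eq_iff)
  then show ?thesis
    using r bloch_facts(12,13)[OF l, of x] by (simp add: u_def v_def wronsk_def minus_divide_left)
qed

text \<open>Here \<kappa> = 0 and the Bloch solutions are bounded. Since \<open>v\<close> is the
  conjugate of \<open>u\<close>, both error terms are controlled by |u - A|, whence the factor
  2.\<close>

lemma asymptotics_real:
  assumes l: "lam \<in> spec_per q a - crit_set q a k \<omega>" and f: "sl_solution Q lam {0..} f f'" "f 0 = of_real y0" "f' 0 = of_real y1"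
  shows "((\<lambda>x. f x - amplitude lam * psm x lam - cnj (amplitude lam) * psp x lam) \<longlongrightarrow> 0) at_top"
    "((\<lambda>x. f' x - amplitude lam * dpsm x lam - cnj (amplitude lam) * dpsp x lam) \<longlongrightarrow> 0) at_top"
proof -
  have lB: "lam \<in> B" using l spec_minus_crit by auto
  have lG: "lam \<in> G" using lB by (simp add: G_def)
  have k0: "\<kappa> lam = 0" using k_facts(2)[OF lB] by (simp add: \<kappa>_def complex_is_Real_iff)
  obtain K where "bloch_bounded K lam" using bloch_bound_at[OF lG] by blast
  then have K: "cmod (psp x lam) \<le> K" "cmod (dpsp x lam) \<le> K" "cmod (psm x lam) \<le> K" "cmod (dpsm x lam) \<le> K"
    if "x \<ge> 0" for x
    using that k0 unfolding bloch_bounded_def by auto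
  have lim: "((\<lambda>x. u x lam) \<longlongrightarrow> amplitude lam) at_top"
    using amplitude_limit(1)[OF lG] l by blast
  have z: "((\<lambda>x. 2 * K * cmod (u x lam - amplitude lam)) \<longlongrightarrow> 0) at_top"
    by (intro tendsto_mult_right_zero tendsto_norm_zero LIM_zero lim)
  have main: "cmod ((u x lam * p + v x lam * r) - amplitude lam * p - cnj (amplitude lam) * r) \<le> 2 * K * cmod (u x lam - amplitude lam)"
    if "cmod p \<le> K" "cmod r \<le> K" "x \<ge> 0" for p r x
  proof -
    have "(u x lam * p + v x lam * r) - amplitude lam * p - cnj (amplitude lam) * r = (u x lam - amplitude lam) * p + cnj (u x lam - amplitude lam) * r"
      unfolding v_eq_cnj_u[OF lB that(3)] by (simp add: algebra_simps)
    then have "cmod ((u x lam * p + v x lam * r) - amplitude lam * p - cnj (amplitude lam) * r) \<le> cmod ((u x lam - amplitude lam) * p) + cmod (cnj (u x lam - amplitude lam) * r)"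
      by (simp only: norm_triangle_ineq)
    moreover have "cmod ((u x lam - amplitude lam) * p) \<le> cmod (u x lam - amplitude lam) * K"
      unfolding norm_mult using that(1) by (rule mult_left_mono) simp
    moreover have "cmod (cnj (u x lam - amplitude lam) * r) \<le> cmod (u x lam - amplitude lam) * K"
      unfolding norm_mult complex_mod_cnj using that(2) by (rule mult_left_mono) simp
    moreover have "2 * K * cmod (u x lam - amplitude lam) = cmod (u x lam - amplitude lam) * K + cmod (u x lam - amplitude lam) * K"
      by simp
    ultimately show ?thesis by linarith
  qed
  have null: "((\<lambda>x. h x - amplitude lam * p x - cnj (amplitude lam) * r x) \<longlongrightarrow> 0) at_top"
    if h: "\<And>x. x \<ge> 0 \<Longrightarrow> h x = u x lam * p x + v x lam * r x"
      and b: "\<And>x. x \<ge> 0 \<Longrightarrow> cmod (p x) \<le> K" "\<And>x. x \<ge> 0 \<Longrightarrow> cmod (r x) \<le> K" for h p r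
  proof (rule Lim_null_comparison[OF eventually_mono[OF eventually_ge_at_top[of 0]] z])
    fix x :: real assume x: "0 \<le> x"
    show "norm (h x - amplitude lam * p x - cnj (amplitude lam) * r x) \<le> 2 * K * cmod (u x lam - amplitude lam)"
      unfolding h[OF x] by (rule main[OF b(1)[OF x] b(2)[OF x] x])
  qed
  show "((\<lambda>x. f x - amplitude lam * psm x lam - cnj (amplitude lam) * psp x lam) \<longlongrightarrow> 0) at_top"
    by (rule null[OF trans[OF solution_is_phi(1)[OF f] phi_decomp(1)[OF lG]] K(3,1)])
  show "((\<lambda>x. f' x - amplitude lam * dpsm x lam - cnj (amplitude lam) * dpsp x lam) \<longlongrightarrow> 0) at_top"
    by (rule null[OF trans[OF solution_is_phi(2)[OF f] phi_decomp(2)[OF lG]] K(4,2)])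
qed

text \<open>\<open>U_set\<close> lies in the closed upper half plane, so its interior avoids the
  real axis and holomorphy on \<open>Hp\<close> applies.\<close>

lemma interior_U_set: "interior (U_set q a k \<omega> \<beta>) \<subseteq> Hp"
proof -
  have "U_set q a k \<omega> \<beta> \<subseteq> {z. 0 \<le> Im z}" by (auto simp: U_set_def U_mu_def)
  then have "interior (U_set q a k \<omega> \<beta>) \<subseteq> interior {z. 0 \<le> Im z}" by (rule interior_mono)
  also have "\<dots> = Hp" using interior_halfspace_ge[of \<i> 0] by (simp add: Hp_def inner_complex_def)
  finally show ?thesis .
qed

end

theorem theorem5p1:
  fixes a c \<omega> \<delta> \<gamma> \<alpha> \<beta> :: real
    and q q1 :: "real \<Rightarrow> real"
    and k :: "complex \<Rightarrow> complex"
    and psp dpsp psm dpsm :: "real \<Rightarrow> complex \<Rightarrow> complex"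
  assumes a_pos: "a > 0"
    and q_per: "\<forall>x. q (x + a) = q x"
    and q_L1: "q absolutely_integrable_on {0..a}"
    and gamma: "1/2 < \<gamma>" "\<gamma> \<le> 1"
    and alpha: "0 \<le> \<alpha>" "\<alpha> < pi"
    and q1_L1: "q1 absolutely_integrable_on {0..}"
    and nonres: "2 * a * \<omega> / pi \<notin> \<int>"
    and beta: "\<beta> > 0"
    and k_qm: "is_quasi_momentum q a k"
    and bloch: "is_bloch_pair q a k psp dpsp psm dpsm"
  defines "Q \<equiv> (\<lambda>x. q x + c * sin (2 * \<omega> * x + \<delta>) / (x + 1) powr \<gamma> + q1 x)"
  shows "\<exists>A :: complex \<Rightarrow> complex.
    (\<forall>lam \<in> U_set q a k \<omega> \<beta>. \<forall>\<phi> d\<phi>.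
       sl_solution Q lam {0..} \<phi> d\<phi> \<and> \<phi> 0 = of_real (sin \<alpha>) \<and> d\<phi> 0 = of_real (cos \<alpha>) \<longrightarrow>
       (Im lam > 0 \<longrightarrow>
          ((\<lambda>x. cmod (\<phi> x - A lam * psm x lam) / exp (Im (k lam) * x / a)) \<longlongrightarrow> 0) at_top \<and>
          ((\<lambda>x. cmod (d\<phi> x - A lam * dpsm x lam) / exp (Im (k lam) * x / a)) \<longlongrightarrow> 0) at_top) \<and>
       (lam \<in> spec_per q a - crit_set q a k \<omega> \<longrightarrow>
          ((\<lambda>x. \<phi> x - A lam * psm x lam - cnj (A lam) * psp x lam) \<longlongrightarrow> 0) at_top \<and>
          ((\<lambda>x. d\<phi> x - A lam * dpsm x lam - cnj (A lam) * dpsp x lam) \<longlongrightarrow> 0) at_top)) \<and>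
    A holomorphic_on interior (U_set q a k \<omega> \<beta>) \<and>
    (\<forall>mu \<in> spec_per q a - crit_set q a k \<omega>.
       (A \<longlongrightarrow> A mu) (at mu within interior (U_set q a k \<omega> \<beta>)))"
proof -
  \<comment> \<open>The angle \<alpha> enters through the two real initial values, so
    \<open>H.amplitude\<close> is the amplitude belonging to \<alpha>.\<close>
  interpret H: perturbed_hill a c \<omega> \<delta> \<gamma> q q1 k psp dpsp psm dpsm "sin \<alpha>" "cos \<alpha>"
    by unfold_locales (fact a_pos q_per q_L1 gamma(1) q1_L1 nonres k_qm bloch)+
  have Q: "Q = H.Q" by (simp add: Q_def H.Q_def)
  show ?thesis
  proof (intro exI[of _ H.amplitude] conjI ballI allI impI)
    fix lam \<phi> d\<phi>
    assume "sl_solution Q lam {0..} \<phi> d\<phi> \<and> \<phi> 0 = of_real (sin \<alpha>) \<and> d\<phi> 0 = of_real (cos \<alpha>)"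
    then have f: "sl_solution H.Q lam {0..} \<phi> d\<phi>" "\<phi> 0 = of_real (sin \<alpha>)" "d\<phi> 0 = of_real (cos \<alpha>)"
      by (simp_all add: Q)
    {
      assume "Im lam > 0"
      then have "lam \<in> H.Hp" by (simp add: H.Hp_def)
      note H.asymptotics_upper[OF this f]
      then show "((\<lambda>x. cmod (\<phi> x - H.amplitude lam * psm x lam) / exp (Im (k lam) * x / a)) \<longlongrightarrow> 0) at_top"
        "((\<lambda>x. cmod (d\<phi> x - H.amplitude lam * dpsm x lam) / exp (Im (k lam) * x / a)) \<longlongrightarrow> 0) at_top" by blast+
    }
    assume "lam \<in> spec_per q a - crit_set q a k \<omega>"
    note H.asymptotics_real[OF this f]
    then show "((\<lambda>x. \<phi> x - H.amplitude lam * psm x lam - cnj (H.amplitude lam) * psp x lam) \<longlongrightarrow> 0) at_top"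
      "((\<lambda>x. d\<phi> x - H.amplitude lam * dpsm x lam - cnj (H.amplitude lam) * dpsp x lam) \<longlongrightarrow> 0) at_top" by blast+
  next
    show "H.amplitude holomorphic_on interior (U_set q a k \<omega> \<beta>)"
      by (rule holomorphic_on_subset[OF H.amplitude_holomorphic H.interior_U_set])
    fix mu assume "mu \<in> spec_per q a - crit_set q a k \<omega>"
    then show "(H.amplitude \<longlongrightarrow> H.amplitude mu) (at mu within interior (U_set q a k \<omega> \<beta>))"
      by (rule H.amplitude_boundary[OF _ H.interior_U_set])
  qed
qed

end
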